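(* Let $\mu$ be a $\sigma$-finite (possibly signed) Borel measure on $(\mathbb{R},\mathfrak{B}(\mathbb{R}))$, let $F$ be (the distribution function of) a probability distribution on $\mathbb{R}$ such that $\int_{\mathbb{R}}\sqrt{F(1-F)}\,|d\mu|<\infty$, let $X_1,X_2,\dots$ be i.i.d. with distribution $F$, and let $\mathbb{F}_n(x)=\frac1n\sum_{i=1}^n\mathbf{1}\{X_i\le x\}$. Then the empirical process $\sqrt{n}(\mathbb{F}_n-F)$ converges weakly in $\mathbb{L}_\mu$ to a Gaussian process with mean zero and covariance function $\operatorname{Cov}(x,y)=F(x\wedge y)-F(x)F(y)$.
   Context: Here $T=\mathbb{R}$ and $\mathbb{L}_\mu$ is the space of bounded and $\mu$-integrable functions $z:\mathbb{R}\to\mathbb{R}$ with norm $\|z\|_{\mathbb{L}_\mu}=\bigl(\sup_{x}|z(x)|\bigr)\vee\bigl(\int|z|\,|d\mu|\bigr)$, where $|d\mu|$ denotes integration with respect to the total variation measure of $\mu$. Weak convergence of possibly non-measurable maps is in the Hoffmann-Jørgensen sense: $\mathbb{E}^*h(X_n)\to\mathbb{E}h(X)$ for every bounded continuous $h:\mathbb{L}_\mu\to\mathbb{R}$, where $\mathbb{E}^*$ is outer expectation and the limit $X$ is Borel measurable. *)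

theory Defs
  imports "HOL-Probability.Probability"
begin

text \<open>The \<^typ>\<open>'a measure\<close> argument \<open>A\<close> is only used for its underlying measurable space.\<close>

definition signed_measure :: "'a measure \<Rightarrow> ('a set \<Rightarrow> ereal) \<Rightarrow> bool" where
  "signed_measure A \<mu> \<longleftrightarrow>
     \<mu> {} = 0 \<and>
     (\<infinity> \<notin> \<mu> ` sets A \<or> - \<infinity> \<notin> \<mu> ` sets A) \<and>
     (\<forall>B :: nat \<Rightarrow> 'a set. range B \<subseteq> sets A \<and> disjoint_family B \<longrightarrow>
        (\<lambda>i. \<mu> (B i)) sums \<mu> (\<Union>i. B i))"

definition sigma_finite_signed_measure :: "'a measure \<Rightarrow> ('a set \<Rightarrow> ereal) \<Rightarrow> bool" where
  "sigma_finite_signed_measure A \<mu> \<longleftrightarrow>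
     signed_measure A \<mu> \<and>
     (\<exists>B :: nat \<Rightarrow> 'a set. range B \<subseteq> sets A \<and> (\<Union>i. B i) = space A \<and> (\<forall>i. \<bar>\<mu> (B i)\<bar> \<noteq> \<infinity>))"

definition variation :: "'a measure \<Rightarrow> ('a set \<Rightarrow> ereal) \<Rightarrow> 'a set \<Rightarrow> ennreal" where
  "variation A \<mu> B =
     (SUP P\<in>{P. finite P \<and> partition_on B P \<and> P \<subseteq> sets A}. \<Sum>C\<in>P. e2ennreal \<bar>\<mu> C\<bar>)"

definition total_variation :: "'a measure \<Rightarrow> ('a set \<Rightarrow> ereal) \<Rightarrow> 'a measure" where
  "total_variation A \<mu> = measure_of (space A) (sets A) (variation A \<mu>)"

lemma space_total_variation [simp]: "space (total_variation A \<mu>) = space A"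
  by (simp add: total_variation_def)

lemma sets_total_variation [simp, measurable_cong]: "sets (total_variation A \<mu>) = sets A"
  by (simp add: total_variation_def)

lemma variation_sum_le:
  assumes "\<mu> {} = 0" "finite I" "disjoint_family_on C I" "\<And>i. i \<in> I \<Longrightarrow> C i \<in> sets A"
    "(\<Union>i\<in>I. C i) = B"
  shows "(\<Sum>i\<in>I. e2ennreal \<bar>\<mu> (C i)\<bar>) \<le> variation A \<mu> B"
proof -
  define J where "J = {i\<in>I. C i \<noteq> {}}"
  have fJ: "finite J" using assms by (simp add: J_def)
  have inj: "inj_on C J"
  proof (rule inj_onI, rule ccontr)
    fix i j assume ij: "i \<in> J" "j \<in> J" "C i = C j" "i \<noteq> j"
    then have "C i \<inter> C j = {}"
      using assms(3) by (intro disjoint_family_onD) (auto simp: J_def)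
    with ij show False by (simp add: J_def)
  qed
  have "(\<Sum>i\<in>I. e2ennreal \<bar>\<mu> (C i)\<bar>) = (\<Sum>i\<in>J. e2ennreal \<bar>\<mu> (C i)\<bar>)"
    using assms(1,2) by (intro sum.mono_neutral_right) (auto simp: J_def e2ennreal_neg)
  also have "\<dots> = (\<Sum>D\<in>C ` J. e2ennreal \<bar>\<mu> D\<bar>)"
    using inj by (simp add: sum.reindex)
  also have "\<dots> \<le> variation A \<mu> B"
    unfolding variation_def
  proof (rule SUP_upper, intro CollectI conjI)
    show "finite (C ` J)" using fJ by simp
    show "C ` J \<subseteq> sets A" using assms(4) by (auto simp: J_def)
    show "partition_on B (C ` J)"
      unfolding partition_on_def
    proof (intro conjI)
      show "\<Union> (C ` J) = B" using assms(5) by (auto simp: J_def)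
      show "disjoint (C ` J)"
        using assms(3) by (intro disjoint_family_on_disjoint_image)
          (rule disjoint_family_on_mono[of _ I], auto simp: J_def)
      show "{} \<notin> C ` J" by (auto simp: J_def)
    qed
  qed
  finally show ?thesis .
qed

lemma variation_add_le:
  assumes \<mu>: "\<mu> {} = 0" and "B \<in> sets A" "C \<in> sets A" "B \<inter> C = {}"
  shows "variation A \<mu> B + variation A \<mu> C \<le> variation A \<mu> (B \<union> C)"
proof -
  let ?P = "\<lambda>B. {P. finite P \<and> partition_on B P \<and> P \<subseteq> sets A}"
  have ne: "?P D \<noteq> {}" if "D \<in> sets A" for D
  proof (cases "D = {}")
    case True
    then have "{} \<in> ?P D" by (simp add: partition_on_def)
    then show ?thesis by blast
  next
    case False
    then have "{D} \<in> ?P D" using that by (simp add: partition_on_def)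
    then show ?thesis by blast
  qed
  have le: "(\<Sum>D\<in>P. e2ennreal \<bar>\<mu> D\<bar>) + (\<Sum>D\<in>Q. e2ennreal \<bar>\<mu> D\<bar>) \<le> variation A \<mu> (B \<union> C)"
    if "P \<in> ?P B" "Q \<in> ?P C" for P Q
  proof -
    have dis: "P \<inter> Q = {}"
    proof (rule ccontr)
      assume "P \<inter> Q \<noteq> {}"
      then obtain D where D: "D \<in> P" "D \<in> Q" by blast
      then have "D \<subseteq> B \<inter> C" using that by (auto simp: partition_on_def)
      then show False using D that assms(4) by (auto simp: partition_on_def)
    qed
    have "(\<Sum>D\<in>P. e2ennreal \<bar>\<mu> D\<bar>) + (\<Sum>D\<in>Q. e2ennreal \<bar>\<mu> D\<bar>) = (\<Sum>D\<in>P \<union> Q. e2ennreal \<bar>\<mu> D\<bar>)"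
      using that dis by (intro sum.union_disjoint[symmetric]) auto
    also have "\<dots> \<le> variation A \<mu> (B \<union> C)"
      unfolding variation_def
    proof (rule SUP_upper, intro CollectI conjI)
      show "partition_on (B \<union> C) (P \<union> Q)"
        unfolding partition_on_def
      proof (intro conjI disjoint_union)
        show "\<Union> P \<inter> \<Union> Q = {}" using that assms(4) by (simp add: partition_on_def)
      qed (use that in \<open>simp_all add: partition_on_def\<close>)
    qed (use that in auto)
    finally show ?thesis .
  qed
  show ?thesis
    unfolding variation_def[of A \<mu> B] variation_def[of A \<mu> C]
    unfolding ennreal_SUP_add_left[symmetric, OF ne[OF assms(2)]]
  proof (rule SUP_least)
    fix P assume P: "P \<in> ?P B"
    show "(\<Sum>D\<in>P. e2ennreal \<bar>\<mu> D\<bar>) + (SUP Q\<in>?P C. \<Sum>D\<in>Q. e2ennreal \<bar>\<mu> D\<bar>)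
        \<le> variation A \<mu> (B \<union> C)"
      unfolding ennreal_SUP_add_right[OF ne[OF assms(3)]]
      by (rule SUP_least) (rule le[OF P])
  qed
qed

lemma variation_mono:
  assumes "\<mu> {} = 0" "B \<in> sets A" "C \<in> sets A" "B \<subseteq> C"
  shows "variation A \<mu> B \<le> variation A \<mu> C"
proof -
  have "variation A \<mu> B \<le> variation A \<mu> B + variation A \<mu> (C - B)" by simp
  also have "\<dots> \<le> variation A \<mu> (B \<union> (C - B))"
    using assms by (intro variation_add_le) auto
  also have "B \<union> (C - B) = C" using assms by auto
  finally show ?thesis .
qed

lemma variation_empty:
  assumes "\<mu> {} = 0"
  shows "variation A \<mu> {} = 0"
proof -
  have "{P. finite P \<and> partition_on {} P \<and> P \<subseteq> sets A} = {{}}"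
    by (auto simp: partition_on_def)
  then show ?thesis unfolding variation_def by simp
qed

lemma signed_measure_abs_le_suminf:
  assumes "signed_measure A \<mu>" "range B \<subseteq> sets A" "disjoint_family B"
  shows "e2ennreal \<bar>\<mu> (\<Union>i. B i)\<bar> \<le> (\<Sum>i. e2ennreal \<bar>\<mu> (B i)\<bar>)"
proof (rule LIMSEQ_le_const2)
  have "(\<lambda>n. \<Sum>i<n. \<mu> (B i)) \<longlonglongrightarrow> \<mu> (\<Union>i. B i)"
    using assms unfolding signed_measure_def sums_def by blast
  then have "(\<lambda>n. \<bar>\<Sum>i<n. \<mu> (B i)\<bar>) \<longlonglongrightarrow> \<bar>\<mu> (\<Union>i. B i)\<bar>"
    by (intro tendsto_intros)
  then show "(\<lambda>n. e2ennreal \<bar>\<Sum>i<n. \<mu> (B i)\<bar>) \<longlonglongrightarrow> e2ennreal \<bar>\<mu> (\<Union>i. B i)\<bar>"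
    by (rule tendsto_e2ennrealI)
next
  have "e2ennreal \<bar>\<Sum>i<n. \<mu> (B i)\<bar> \<le> (\<Sum>i<n. e2ennreal \<bar>\<mu> (B i)\<bar>)" for n
  proof (induction n)
    case (Suc n)
    have "e2ennreal \<bar>\<Sum>i<Suc n. \<mu> (B i)\<bar> \<le> e2ennreal (\<bar>\<Sum>i<n. \<mu> (B i)\<bar> + \<bar>\<mu> (B n)\<bar>)"
      by (simp add: e2ennreal_mono ereal_abs_add)
    also have "\<dots> = e2ennreal \<bar>\<Sum>i<n. \<mu> (B i)\<bar> + e2ennreal \<bar>\<mu> (B n)\<bar>"
      by (simp add: plus_ennreal.abs_eq eq_onp_def)
    also have "\<dots> \<le> (\<Sum>i<Suc n. e2ennreal \<bar>\<mu> (B i)\<bar>)"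
      using Suc by (simp add: add_mono)
    finally show ?case .
  qed (simp add: e2ennreal_neg)
  also have "(\<Sum>i<n. e2ennreal \<bar>\<mu> (B i)\<bar>) \<le> (\<Sum>i. e2ennreal \<bar>\<mu> (B i)\<bar>)" for n
    by (rule sum_le_suminf) auto
  finally show "\<exists>N. \<forall>n\<ge>N. e2ennreal \<bar>\<Sum>i<n. \<mu> (B i)\<bar> \<le> (\<Sum>i. e2ennreal \<bar>\<mu> (B i)\<bar>)"
    by blast
qed

text \<open>Since \<^const>\<open>measure_of\<close> falls back to the null measure on set functions that are not
  countably additive, the following lemma is needed for the definition to make sense.\<close>

lemma emeasure_total_variation:
  assumes sm: "signed_measure A \<mu>" and B: "B \<in> sets A"
  shows "emeasure (total_variation A \<mu>) B = variation A \<mu> B"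
  unfolding total_variation_def
proof (rule emeasure_measure_of_sigma[OF sets.sigma_algebra_axioms _ _ B])
  have \<mu>0: "\<mu> {} = 0" using sm by (simp add: signed_measure_def)
  show "positive (sets A) (variation A \<mu>)"
    by (simp add: positive_def variation_empty \<mu>0)
  show "countably_additive (sets A) (variation A \<mu>)"
  proof (rule countably_additiveI)
    fix B :: "nat \<Rightarrow> 'a set"
    assume B: "range B \<subseteq> sets A" "disjoint_family B" "(\<Union>i. B i) \<in> sets A"
    have Bi: "B i \<in> sets A" for i using B by auto
    show "(\<Sum>i. variation A \<mu> (B i)) = variation A \<mu> (\<Union>i. B i)"
    proof (rule antisym)
      have "(\<Sum>i<n. variation A \<mu> (B i)) \<le> variation A \<mu> (\<Union>i<n. B i)" for n
      proof (induction n)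
        case 0
        show ?case by (simp add: variation_empty \<mu>0)
      next
        case (Suc n)
        have disj: "(\<Union>i<n. B i) \<inter> B n = {}"
        proof -
          have "B i \<inter> B n = {}" if "i < n" for i
            using B(2) that by (intro disjoint_family_onD) auto
          then show ?thesis by blast
        qed
        have "(\<Sum>i<Suc n. variation A \<mu> (B i)) \<le> variation A \<mu> (\<Union>i<n. B i) + variation A \<mu> (B n)"
          using Suc by (simp add: add_mono)
        also have "\<dots> \<le> variation A \<mu> ((\<Union>i<n. B i) \<union> B n)"
          by (intro variation_add_le \<mu>0 disj Bi sets.finite_UN) auto
        also have "(\<Union>i<n. B i) \<union> B n = (\<Union>i<Suc n. B i)"
          by (auto simp: less_Suc_eq)
        finally show ?case .
      qed
      also have "variation A \<mu> (\<Union>i<n. B i) \<le> variation A \<mu> (\<Union>i. B i)" for n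
        by (intro variation_mono \<mu>0 sets.finite_UN B(3) Bi) auto
      finally show "(\<Sum>i. variation A \<mu> (B i)) \<le> variation A \<mu> (\<Union>i. B i)"
        by (intro suminf_le_const) auto
    next
      show "variation A \<mu> (\<Union>i. B i) \<le> (\<Sum>i. variation A \<mu> (B i))"
        unfolding variation_def[of A \<mu> "\<Union>i. B i"]
      proof (rule SUP_least)
        fix P assume "P \<in> {P. finite P \<and> partition_on (\<Union>i. B i) P \<and> P \<subseteq> sets A}"
        then have P: "finite P" "\<Union>P = (\<Union>i. B i)" "disjoint P" "P \<subseteq> sets A"
          by (auto simp: partition_on_def)
        have "(\<Sum>C\<in>P. e2ennreal \<bar>\<mu> C\<bar>) \<le> (\<Sum>C\<in>P. \<Sum>i. e2ennreal \<bar>\<mu> (C \<inter> B i)\<bar>)"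
        proof (rule sum_mono)
          fix C assume C: "C \<in> P"
          have "(\<Union>i. C \<inter> B i) = C" using C P(2) by auto
          moreover have "e2ennreal \<bar>\<mu> (\<Union>i. C \<inter> B i)\<bar> \<le> (\<Sum>i. e2ennreal \<bar>\<mu> (C \<inter> B i)\<bar>)"
          proof (rule signed_measure_abs_le_suminf[OF sm])
            show "range (\<lambda>i. C \<inter> B i) \<subseteq> sets A" using C P(4) Bi by auto
            show "disjoint_family (\<lambda>i. C \<inter> B i)"
            proof (unfold disjoint_family_on_def, intro ballI impI)
              fix i j :: nat assume "i \<noteq> j"
              then have "B i \<inter> B j = {}" using B(2) by (intro disjoint_family_onD) auto
              then show "(C \<inter> B i) \<inter> (C \<inter> B j) = {}" by blast
            qed
          qed
          ultimately show "e2ennreal \<bar>\<mu> C\<bar> \<le> (\<Sum>i. e2ennreal \<bar>\<mu> (C \<inter> B i)\<bar>)" by simp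
        qed
        also have "\<dots> = (\<Sum>i. \<Sum>C\<in>P. e2ennreal \<bar>\<mu> (C \<inter> B i)\<bar>)"
          by (rule suminf_sum[symmetric]) auto
        also have "\<dots> \<le> (\<Sum>i. variation A \<mu> (B i))"
        proof (rule suminf_le)
          fix i
          show "(\<Sum>C\<in>P. e2ennreal \<bar>\<mu> (C \<inter> B i)\<bar>) \<le> variation A \<mu> (B i)"
          proof (rule variation_sum_le[where \<mu> = \<mu>, OF \<mu>0 P(1)])
            show "disjoint_family_on (\<lambda>C. C \<inter> B i) P"
              using P(3) unfolding disjoint_family_on_def disjoint_def by blast
            show "C \<inter> B i \<in> sets A" if "C \<in> P" for C using that P(4) Bi by auto
            show "(\<Union>C\<in>P. C \<inter> B i) = B i" using P(2) by auto
          qed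
        qed auto
        finally show "(\<Sum>C\<in>P. e2ennreal \<bar>\<mu> C\<bar>) \<le> (\<Sum>i. variation A \<mu> (B i))" .
      qed
    qed
  qed
qed

definition L_space :: "'a measure \<Rightarrow> ('a set \<Rightarrow> ereal) \<Rightarrow> ('a \<Rightarrow> real) set" where
  "L_space A \<mu> = {z. bounded (z ` space A) \<and> integrable (total_variation A \<mu>) z}"

definition L_norm :: "'a measure \<Rightarrow> ('a set \<Rightarrow> ereal) \<Rightarrow> ('a \<Rightarrow> real) \<Rightarrow> real" where
  "L_norm A \<mu> z = max (SUP x\<in>space A. \<bar>z x\<bar>) (\<integral>x. \<bar>z x\<bar> \<partial>total_variation A \<mu>)"

definition L_topology :: "(real set \<Rightarrow> ereal) \<Rightarrow> (real \<Rightarrow> real) topology" where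
  "L_topology \<mu> =
     Metric_space.mtopology (L_space borel \<mu>) (\<lambda>z w. L_norm borel \<mu> (\<lambda>x. z x - w x))"

lemma Metric_space_L:
  "Metric_space (L_space borel \<mu>) (\<lambda>z w. L_norm borel \<mu> (\<lambda>x. z x - w x :: real))"
  for \<mu> :: "real set \<Rightarrow> ereal"
proof
  let ?V = "total_variation borel \<mu>" and ?L = "L_space borel \<mu>"
  have bdd: "bdd_above (range (\<lambda>x. \<bar>z x - w x\<bar>))" if "z \<in> ?L" "w \<in> ?L" for z w
  proof -
    have "bounded (range (\<lambda>x. z x - w x))"
      using that by (intro bounded_minus_comp) (auto simp: L_space_def)
    then show ?thesis by (auto simp: bounded_iff bdd_above_def)
  qed
  fix x y z :: "real \<Rightarrow> real"
  show "0 \<le> L_norm borel \<mu> (\<lambda>t. x t - y t)"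
    by (simp add: L_norm_def le_max_iff_disj)
  show "L_norm borel \<mu> (\<lambda>t. x t - y t) = L_norm borel \<mu> (\<lambda>t. y t - x t)"
    by (simp add: L_norm_def abs_minus_commute)
  assume x: "x \<in> ?L" and y: "y \<in> ?L"
  show "L_norm borel \<mu> (\<lambda>t. x t - y t) = 0 \<longleftrightarrow> x = y"
  proof
    assume "L_norm borel \<mu> (\<lambda>t. x t - y t) = 0"
    then have *: "(SUP t. \<bar>x t - y t\<bar>) \<le> 0" by (simp add: L_norm_def max_def split: if_splits)
    show "x = y"
    proof
      fix t
      have "\<bar>x t - y t\<bar> \<le> (SUP t. \<bar>x t - y t\<bar>)"
        by (rule cSUP_upper[OF UNIV_I bdd[OF x y]])
      with * show "x t = y t" by simp
    qed
  qed (simp add: L_norm_def)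
  assume z: "z \<in> ?L"
  have "(SUP t. \<bar>x t - z t\<bar>) \<le> (SUP t. \<bar>x t - y t\<bar>) + (SUP t. \<bar>y t - z t\<bar>)"
  proof (rule cSUP_least)
    fix t
    have "\<bar>x t - z t\<bar> \<le> \<bar>x t - y t\<bar> + \<bar>y t - z t\<bar>" by simp
    also have "\<dots> \<le> (SUP t. \<bar>x t - y t\<bar>) + (SUP t. \<bar>y t - z t\<bar>)"
      by (intro add_mono cSUP_upper UNIV_I bdd x y z)
    finally show "\<bar>x t - z t\<bar> \<le> (SUP t. \<bar>x t - y t\<bar>) + (SUP t. \<bar>y t - z t\<bar>)" .
  qed simp
  moreover have "(\<integral>t. \<bar>x t - z t\<bar> \<partial>?V) \<le> (\<integral>t. \<bar>x t - y t\<bar> \<partial>?V) + (\<integral>t. \<bar>y t - z t\<bar> \<partial>?V)"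
  proof -
    have i: "integrable ?V x" "integrable ?V y" "integrable ?V z"
      using x y z by (auto simp: L_space_def)
    have "(\<integral>t. \<bar>x t - z t\<bar> \<partial>?V) \<le> (\<integral>t. \<bar>x t - y t\<bar> + \<bar>y t - z t\<bar> \<partial>?V)"
      using i by (intro integral_mono) auto
    also have "\<dots> = (\<integral>t. \<bar>x t - y t\<bar> \<partial>?V) + (\<integral>t. \<bar>y t - z t\<bar> \<partial>?V)"
      using i by (intro Bochner_Integration.integral_add) auto
    finally show ?thesis .
  qed
  ultimately show "L_norm borel \<mu> (\<lambda>t. x t - z t)
      \<le> L_norm borel \<mu> (\<lambda>t. x t - y t) + L_norm borel \<mu> (\<lambda>t. y t - z t)"
    unfolding L_norm_def space_borel
    by (intro max.boundedI) (erule order_trans, intro add_mono max.cobounded1 max.cobounded2)+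
qed

lemma topspace_L_topology [simp]: "topspace (L_topology \<mu>) = L_space borel \<mu>"
  unfolding L_topology_def by (rule Metric_space.topspace_mtopology[OF Metric_space_L])

definition extended_expectation_exists :: "'w measure \<Rightarrow> ('w \<Rightarrow> ereal) \<Rightarrow> bool" where
  "extended_expectation_exists M U \<longleftrightarrow>
     (\<integral>\<^sup>+\<omega>. e2ennreal (U \<omega>) \<partial>M) \<noteq> \<infinity> \<or> (\<integral>\<^sup>+\<omega>. e2ennreal (- U \<omega>) \<partial>M) \<noteq> \<infinity>"

text \<open>\<^const>\<open>e2ennreal\<close> maps negative values to \<open>0\<close>, so this is \<open>E[U\<^sup>+] - E[U\<^sup>-]\<close>.\<close>

definition extended_expectation :: "'w measure \<Rightarrow> ('w \<Rightarrow> ereal) \<Rightarrow> ereal" where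
  "extended_expectation M U =
     enn2ereal (\<integral>\<^sup>+\<omega>. e2ennreal (U \<omega>) \<partial>M) - enn2ereal (\<integral>\<^sup>+\<omega>. e2ennreal (- U \<omega>) \<partial>M)"

definition outer_expectation :: "'w measure \<Rightarrow> ('w \<Rightarrow> ereal) \<Rightarrow> ereal" where
  "outer_expectation M T =
     (INF U\<in>{U \<in> borel_measurable M. (\<forall>\<omega>\<in>space M. T \<omega> \<le> U \<omega>) \<and> extended_expectation_exists M U}.
        extended_expectation M U)"

text \<open>Hoffmann-Joergensen weak convergence. The maps \<open>Y n\<close> are only required to take values in the space almost surely: the
  empirical process may fail to be integrable on a null set. Majorants in the outer expectation may
  take the value \<open>\<infinity>\<close>, so the values of \<open>h\<close> outside the space play no role.\<close>

definition converges_weakly_HJ ::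
  "'b topology \<Rightarrow> 'w measure \<Rightarrow> (nat \<Rightarrow> 'w \<Rightarrow> 'b) \<Rightarrow> 'v measure \<Rightarrow> ('v \<Rightarrow> 'b) \<Rightarrow> bool" where
  "converges_weakly_HJ T M Y N Z \<longleftrightarrow>
     (\<forall>n. AE \<omega> in M. Y n \<omega> \<in> topspace T) \<and>
     Z \<in> N \<rightarrow>\<^sub>M sigma (topspace T) {U. openin T U} \<and>
     (\<forall>h. continuous_map T euclideanreal h \<and> bounded (h ` topspace T) \<longrightarrow>
        (\<lambda>n. outer_expectation M (\<lambda>\<omega>. ereal (h (Y n \<omega>)))) \<longlonglongrightarrow> ereal (\<integral>\<omega>. h (Z \<omega>) \<partial>N))"

text \<open>Degenerate normal distributions (\<open>\<sigma> = 0\<close>) are included, and a random vector is multivariate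
  normal iff all linear combinations of its components are normal.\<close>

definition normal_distribution :: "real \<Rightarrow> real \<Rightarrow> real measure" where
  "normal_distribution m \<sigma> =
     (if \<sigma> = 0 then return borel m else density lborel (\<lambda>x. ennreal (normal_density m \<sigma> x)))"

definition gaussian_process :: "'v measure \<Rightarrow> ('v \<Rightarrow> 't \<Rightarrow> real) \<Rightarrow> bool" where
  "gaussian_process N G \<longleftrightarrow>
     (\<forall>t. (\<lambda>\<omega>. G \<omega> t) \<in> borel_measurable N) \<and>
     (\<forall>I (c :: 't \<Rightarrow> real). finite I \<longrightarrow>
        (\<exists>m \<sigma>. 0 \<le> \<sigma> \<and> distr N borel (\<lambda>\<omega>. \<Sum>t\<in>I. c t * G \<omega> t) = normal_distribution m \<sigma>))"

definition covariance :: "'v measure \<Rightarrow> ('v \<Rightarrow> real) \<Rightarrow> ('v \<Rightarrow> real) \<Rightarrow> real" where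
  "covariance N Y Z = (\<integral>\<omega>. (Y \<omega> - (\<integral>\<omega>'. Y \<omega>' \<partial>N)) * (Z \<omega> - (\<integral>\<omega>'. Z \<omega>' \<partial>N)) \<partial>N)"

definition empirical_cdf :: "(nat \<Rightarrow> 'w \<Rightarrow> real) \<Rightarrow> nat \<Rightarrow> 'w \<Rightarrow> real \<Rightarrow> real" where
  "empirical_cdf X n \<omega> x = (1 / real n) * (\<Sum>i<n. indicator {..x} (X i \<omega>))"

definition empirical_process ::
  "real measure \<Rightarrow> (nat \<Rightarrow> 'w \<Rightarrow> real) \<Rightarrow> nat \<Rightarrow> 'w \<Rightarrow> real \<Rightarrow> real" where
  "empirical_process F X n \<omega> = (\<lambda>x. sqrt (real n) * (empirical_cdf X n \<omega> x - cdf F x))"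

end

theory Submission
  imports Defs
begin

text \<open>
  By approximating bounded continuous functions monotonically by Lipschitz ones, it suffices to treat
  bounded Lipschitz functions \<open>h\<close>. The limit is \<open>B (F x)\<close> for a Brownian bridge \<open>B\<close>, built as a Schauder
  series, so that its paths are continuous functions of \<open>F\<close>. Both the empirical process and the limit
  are discretised: the line is cut at the dyadic quantiles of level \<open>a\<close> of \<open>F\<close>, the process is frozen on
  each cell, and it is set to zero where \<open>F\<close> or \<open>1 - F\<close> is below \<open>2^-m\<close>, so that only a set of finite
  \<open>|d\<mu>|\<close>-measure remains.

  The discretised processes live in a finite-dimensional space and converge by the central limit
  theorem and a Cramer-Wold argument. The discretisation error is small uniformly in large \<open>n\<close>: in the
  supremum norm by chaining along the dyadic quantiles with fourth moments, down to the level where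
  \<open>2^b\<close> is of order \<open>n\<close>; in the integral norm because the part outside the central region has expectation
  at most the tail of \<open>\<integral> sqrt (F (1 - F)) |d\<mu>|\<close>, and the central region has finite measure. These errors
  have measurable majorants, which turns the estimates into bounds for outer expectations.
\<close>

subsection \<open>Outer expectations and Lipschitz test functions\<close>

text \<open>In the supremum norm the space need not be separable and the empirical process need not
  be Borel measurable, so the argument rests on explicit measurable majorants rather than on
  tightness. Fourth moments are forced: a level \<open>b\<close> has about \<open>2^b\<close> cells
  of variance up to \<open>2^-b\<close>, whose second moments only add up to a constant, while
  fourth moments of order \<open>4^-b\<close> leave a factor \<open>2^-b\<close>. The base 9/10 of
  the thresholds is a number below 1 whose cube exceeds 1/2, so both the thresholds and the fourth
  moments divided by their cubes form geometric series; the levels of the Schauder series obey the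
  same count. The fourth moment of a cell of probability \<open>p\<close> also contains
  \<open>p / n\<close>, which ceases to be of order \<open>p^2\<close> once \<open>p\<close> is
  below \<open>1 / n\<close>; from there on only monotonicity in \<open>x\<close> is used. As
  \<open>F\<close> may have atoms, the discretised bridge is evaluated at the actual probabilities
  of the quantile sets instead of the dyadic numbers, which makes the covariances agree exactly. The
  truncation \<open>m\<close> is chosen before the level \<open>a\<close>, because the measure of
  the central region multiplies the error of level \<open>a\<close>; \<open>n\<close> comes
  last.\<close>

lemma extended_expectation_real:
  fixes f :: "'w \<Rightarrow> real"
  assumes f: "integrable M f" and U: "AE \<omega> in M. U \<omega> = ereal (f \<omega>)"
  shows "extended_expectation_exists M U" "extended_expectation M U = ereal (integral\<^sup>L M f)"
proof -
  have a: "(\<integral>\<^sup>+\<omega>. ennreal (f \<omega>) \<partial>M) < \<infinity>"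
    and b: "(\<integral>\<^sup>+\<omega>. ennreal (- f \<omega>) \<partial>M) < \<infinity>"
    using f unfolding real_integrable_def by (auto simp: less_top)
  have pos: "(\<integral>\<^sup>+\<omega>. e2ennreal (U \<omega>) \<partial>M) = (\<integral>\<^sup>+\<omega>. ennreal (f \<omega>) \<partial>M)"
    using U by (intro nn_integral_cong_AE) (auto elim!: eventually_mono)
  have neg: "(\<integral>\<^sup>+\<omega>. e2ennreal (- U \<omega>) \<partial>M) = (\<integral>\<^sup>+\<omega>. ennreal (- f \<omega>) \<partial>M)"
    using U by (intro nn_integral_cong_AE) (auto elim!: eventually_mono)
  show "extended_expectation_exists M U"
    unfolding extended_expectation_exists_def pos neg using a by auto
  have e: "enn2ereal c = ereal (enn2real c)" if "c < \<infinity>" for c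
    using that by (cases c) auto
  show "extended_expectation M U = ereal (integral\<^sup>L M f)"
    unfolding extended_expectation_def pos neg real_lebesgue_integral_def[OF f]
    by (simp add: e[OF a] e[OF b])
qed

lemma extended_expectation_ge:
  fixes f :: "'w \<Rightarrow> real"
  assumes f: "integrable M f" and U: "AE \<omega> in M. ereal (f \<omega>) \<le> U \<omega>"
  shows "ereal (integral\<^sup>L M f) \<le> extended_expectation M U"
proof -
  have "extended_expectation M (\<lambda>\<omega>. ereal (f \<omega>)) \<le> extended_expectation M U"
    unfolding extended_expectation_def
  proof (rule ereal_minus_mono; unfold less_eq_ennreal.rep_eq[symmetric], rule nn_integral_mono_AE)
    show "AE \<omega> in M. e2ennreal (ereal (f \<omega>)) \<le> e2ennreal (U \<omega>)"
      using U by eventually_elim (rule e2ennreal_mono)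
    show "AE \<omega> in M. e2ennreal (- U \<omega>) \<le> e2ennreal (- ereal (f \<omega>))"
      using U by eventually_elim (intro e2ennreal_mono, simp only: ereal_minus_le_minus)
  qed
  then show ?thesis using extended_expectation_real(2)[OF f] by simp
qed

text \<open>A majorant has to dominate everywhere, while the bound holds only almost surely; raising
  it to \<open>\<infinity>\<close> on the exceptional null set repairs this and leaves the
  expectation unchanged.\<close>

lemma outer_expectation_upper:
  fixes f g :: "'w \<Rightarrow> real"
  assumes g: "integrable M g" and le: "AE \<omega> in M. f \<omega> \<le> g \<omega>"
  shows "outer_expectation M (\<lambda>\<omega>. ereal (f \<omega>)) \<le> ereal (integral\<^sup>L M g)"
proof -
  obtain A where A: "{\<omega>\<in>space M. \<not> f \<omega> \<le> g \<omega>} \<subseteq> A" "A \<in> null_sets M"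
    using le unfolding eventually_ae_filter by auto
  define U where "U \<omega> = (if \<omega> \<in> A then \<infinity> else ereal (g \<omega>))" for \<omega>
  have [measurable]: "A \<in> sets M" "g \<in> borel_measurable M" using A g by auto
  have U: "AE \<omega> in M. U \<omega> = ereal (g \<omega>)"
    using AE_not_in[OF A(2)] by eventually_elim (simp add: U_def)
  have "U \<in> borel_measurable M" unfolding U_def by measurable
  moreover have "\<forall>\<omega>\<in>space M. ereal (f \<omega>) \<le> U \<omega>" using A by (auto simp: U_def)
  ultimately have "outer_expectation M (\<lambda>\<omega>. ereal (f \<omega>)) \<le> extended_expectation M U"
    unfolding outer_expectation_def
    using extended_expectation_real(1)[OF g U] by (intro INF_lower) auto
  then show ?thesis by (simp add: extended_expectation_real(2)[OF g U])
qed

lemma outer_expectation_lower: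
  fixes f g :: "'w \<Rightarrow> real"
  assumes g: "integrable M g" and le: "AE \<omega> in M. g \<omega> \<le> f \<omega>"
  shows "ereal (integral\<^sup>L M g) \<le> outer_expectation M (\<lambda>\<omega>. ereal (f \<omega>))"
  unfolding outer_expectation_def
proof (rule INF_greatest, rule extended_expectation_ge[OF g])
  fix U assume "U \<in> {U \<in> borel_measurable M.
    (\<forall>\<omega>\<in>space M. ereal (f \<omega>) \<le> U \<omega>) \<and> extended_expectation_exists M U}"
  then have U: "ereal (f \<omega>) \<le> U \<omega>" if "\<omega> \<in> space M" for \<omega> using that by auto
  from le AE_space show "AE \<omega> in M. ereal (g \<omega>) \<le> U \<omega>"
    by eventually_elim (use U in \<open>meson ereal_less_eq(3) order_trans\<close>)
qed

text \<open>Both functions may be non-measurable, so the modification is applied to an arbitrary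
  majorant of \<open>g\<close>: set to \<open>\<infinity>\<close> on the exceptional null set, it
  majorises \<open>f\<close>, and the integrals of its positive and negative parts stay the
  same.\<close>

lemma outer_expectation_mono_AE:
  fixes f g :: "'w \<Rightarrow> real"
  assumes le: "AE \<omega> in M. f \<omega> \<le> g \<omega>"
  shows "outer_expectation M (\<lambda>\<omega>. ereal (f \<omega>)) \<le> outer_expectation M (\<lambda>\<omega>. ereal (g \<omega>))"
  unfolding outer_expectation_def[of M "\<lambda>\<omega>. ereal (g \<omega>)"]
proof (rule INF_greatest)
  fix U assume "U \<in> {U \<in> borel_measurable M.
    (\<forall>\<omega>\<in>space M. ereal (g \<omega>) \<le> U \<omega>) \<and> extended_expectation_exists M U}"
  then have U[measurable]: "U \<in> borel_measurable M"
    and ge: "\<And>\<omega>. \<omega> \<in> space M \<Longrightarrow> ereal (g \<omega>) \<le> U \<omega>" and ex: "extended_expectation_exists M U"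
    by auto
  obtain A where A: "{\<omega>\<in>space M. \<not> f \<omega> \<le> g \<omega>} \<subseteq> A" "A \<in> null_sets M"
    using le unfolding eventually_ae_filter by auto
  have [measurable]: "A \<in> sets M" using A by auto
  define U' where "U' \<omega> = (if \<omega> \<in> A then \<infinity> else U \<omega>)" for \<omega>
  have ae: "AE \<omega> in M. U' \<omega> = U \<omega>"
    using AE_not_in[OF A(2)] by eventually_elim (simp add: U'_def)
  have pos: "(\<integral>\<^sup>+\<omega>. e2ennreal (U' \<omega>) \<partial>M) = (\<integral>\<^sup>+\<omega>. e2ennreal (U \<omega>) \<partial>M)"
    and neg: "(\<integral>\<^sup>+\<omega>. e2ennreal (- U' \<omega>) \<partial>M) = (\<integral>\<^sup>+\<omega>. e2ennreal (- U \<omega>) \<partial>M)"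
    using ae by (auto intro!: nn_integral_cong_AE elim!: eventually_mono)
  have "U' \<in> borel_measurable M" unfolding U'_def by measurable
  moreover have "ereal (f \<omega>) \<le> U' \<omega>" if "\<omega> \<in> space M" for \<omega>
  proof (cases "\<omega> \<in> A")
    case False
    then have "ereal (f \<omega>) \<le> ereal (g \<omega>)" using A that by auto
    also have "\<dots> \<le> U \<omega>" by (rule ge[OF that])
    finally show ?thesis using False by (simp add: U'_def)
  qed (simp add: U'_def)
  moreover have "extended_expectation_exists M U'"
    using ex unfolding extended_expectation_exists_def pos neg .
  ultimately have "outer_expectation M (\<lambda>\<omega>. ereal (f \<omega>)) \<le> extended_expectation M U'"
    unfolding outer_expectation_def by (intro INF_lower) auto
  also have "\<dots> = extended_expectation M U" unfolding extended_expectation_def pos neg ..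
  finally show "outer_expectation M (\<lambda>\<omega>. ereal (f \<omega>)) \<le> extended_expectation M U" .
qed

text \<open>The approximations are the infimal convolutions \<open>x \<mapsto> inf\<^sub>y h y + k * d x y\<close>.\<close>

lemma (in Metric_space) Lipschitz_approx_below:
  assumes h: "continuous_map mtopology euclideanreal h" and C: "\<And>x. x \<in> M \<Longrightarrow> \<bar>h x\<bar> \<le> C"
  obtains g :: "nat \<Rightarrow> 'a \<Rightarrow> real" where
    "\<And>k x y. \<lbrakk>x \<in> M; y \<in> M\<rbrakk> \<Longrightarrow> \<bar>g k x - g k y\<bar> \<le> real k * d x y"
    "\<And>k x. x \<in> M \<Longrightarrow> \<bar>g k x\<bar> \<le> C" "\<And>k x. x \<in> M \<Longrightarrow> g k x \<le> h x"
    "\<And>x. x \<in> M \<Longrightarrow> (\<lambda>k. g k x) \<longlonglongrightarrow> h x"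
proof
  let ?g = "\<lambda>k::nat. \<lambda>x. INF y\<in>M. h y + real k * d x y"
  have bdd: "bdd_below ((\<lambda>y. h y + real k * d x y) ` M)" for k x
  proof (rule bdd_belowI2)
    fix y assume "y \<in> M"
    then have "- C \<le> h y" using C[of y] by auto
    then show "- C \<le> h y + real k * d x y" by (simp add: add_increasing2)
  qed
  have lower: "?g k x \<le> h y + real k * d x y" if "y \<in> M" for k x y
    by (rule cINF_lower[OF bdd that])
  show le: "?g k x \<le> h x" if "x \<in> M" for k x using lower[OF that, of k x] that by simp
  have ge: "- C \<le> ?g k x" if "x \<in> M" for k x
  proof (rule cINF_greatest)
    fix y assume "y \<in> M"
    then have "- C \<le> h y" using C[of y] by auto
    then show "- C \<le> h y + real k * d x y" by (simp add: add_increasing2)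
  qed (use that in auto)
  show "\<bar>?g k x\<bar> \<le> C" if "x \<in> M" for k x
    using le[OF that, of k] ge[OF that, of k] C[OF that] by linarith
  have half: "?g k x \<le> ?g k y + real k * d x y" if x: "x \<in> M" and y: "y \<in> M" for k x y
  proof -
    have "?g k x - real k * d x y \<le> ?g k y"
    proof (rule cINF_greatest)
      fix w assume w: "w \<in> M"
      have "?g k x \<le> h w + real k * d x w" by (rule lower[OF w])
      also have "\<dots> \<le> h w + real k * (d x y + d y w)"
        by (intro add_left_mono mult_left_mono triangle x y w) auto
      finally show "?g k x - real k * d x y \<le> h w + real k * d y w" by (simp add: algebra_simps)
    qed (use x in auto)
    then show ?thesis by simp
  qed
  show "\<bar>?g k x - ?g k y\<bar> \<le> real k * d x y" if "x \<in> M" "y \<in> M" for k x y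
    using half[OF that, of k] half[OF that(2,1), of k] by (simp add: commute)
  show "(\<lambda>k. ?g k x) \<longlonglongrightarrow> h x" if x: "x \<in> M" for x
  proof (rule LIMSEQ_I)
    fix e :: real assume e: "0 < e"
    have "limitin euclidean h (h x) (atin mtopology x)"
      using h x by (simp add: continuous_map_atin)
    then have "openin mtopology {y \<in> M. h y \<in> ball (h x) (e/2)}"
      using h openin_continuous_map_preimage[OF h, of "ball (h x) (e/2)"] by simp
    then obtain \<delta> where \<delta>: "\<delta> > 0" "mball x \<delta> \<subseteq> {y \<in> M. h y \<in> ball (h x) (e/2)}"
      using e x unfolding openin_mtopology by auto
    \<comment> \<open>For \<open>k \<ge> K\<close> a point at distance at least
      \<open>\<delta>\<close> pays a penalty of at least \<open>2 * C\<close>, which bounds the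
      oscillation of \<open>h\<close>; only points of the \<open>\<delta>\<close>-ball can lower the
      infimum.\<close>
    define K where "K = nat \<lceil>2 * C / \<delta>\<rceil>"
    have "norm (?g k x - h x) < e" if k: "k \<ge> K" for k
    proof -
      have kd: "2 * C \<le> real k * \<delta>"
      proof -
        have "2 * C / \<delta> \<le> real k" using k unfolding K_def by linarith
        then show ?thesis using \<delta>(1) by (simp add: field_simps)
      qed
      have "h x - e/2 \<le> ?g k x"
      proof (rule cINF_greatest)
        fix y assume y: "y \<in> M"
        show "h x - e/2 \<le> h y + real k * d x y"
        proof (cases "d x y < \<delta>")
          case True
          then have "h y \<in> ball (h x) (e/2)" using \<delta>(2) x y by auto
          then have "h x - e/2 \<le> h y" using abs_ge_self[of "h x - h y"] by (simp add: dist_real_def)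
          then show ?thesis by (simp add: add_increasing2)
        next
          case False
          then have "real k * \<delta> \<le> real k * d x y" by (intro mult_left_mono) auto
          with kd have "2 * C \<le> real k * d x y" by linarith
          then show ?thesis using C[OF x] C[OF y] e by linarith
        qed
      qed (use x in auto)
      then show ?thesis using le[OF x, of k] e by auto
    qed
    then show "\<exists>K. \<forall>k\<ge>K. norm (?g k x - h x) < e" by blast
  qed
qed

text \<open>Outer expectation is monotone but not linear, so each half of the limit needs its own
  one-sided approximation: Lipschitz functions below \<open>h\<close> give the lower bound,
  negatives of Lipschitz functions below \<open>- h\<close> the upper one. For fixed
  \<open>k\<close> the limit in \<open>n\<close> comes from \<open>lim\<close>; the gap between
  \<open>g k\<close> and \<open>h\<close> is only measured under \<open>N\<close>, where dominated
  convergence applies.\<close>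

lemma (in Metric_space) converges_weakly_HJ_if_Lipschitz:
  assumes N: "prob_space N"
    and Y: "\<And>n. AE \<omega> in P. Y n \<omega> \<in> M"
    and Z: "Z \<in> N \<rightarrow>\<^sub>M sigma M {U. openin mtopology U}"
    and lim: "\<And>h L C. \<lbrakk>0 \<le> L; \<And>x. x \<in> M \<Longrightarrow> \<bar>h x\<bar> \<le> C;
        \<And>x y. \<lbrakk>x \<in> M; y \<in> M\<rbrakk> \<Longrightarrow> \<bar>h x - h y\<bar> \<le> L * d x y\<rbrakk> \<Longrightarrow>
        (\<lambda>n. outer_expectation P (\<lambda>\<omega>. ereal (h (Y n \<omega>)))) \<longlonglongrightarrow> ereal (\<integral>\<omega>. h (Z \<omega>) \<partial>N)"
  shows "converges_weakly_HJ mtopology P Y N Z"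
proof -
  interpret N: prob_space N by (rule N)
  have ZM: "Z \<omega> \<in> M" if "\<omega> \<in> space N" for \<omega>
    using measurable_space[OF Z that] by (simp add: space_measure_of_conv)
  have meas: "(\<lambda>\<omega>. h (Z \<omega>)) \<in> borel_measurable N"
    if "continuous_map mtopology euclideanreal h" for h
  proof (rule borel_measurableI)
    fix S :: "real set" assume "open S"
    then have o: "openin mtopology {x \<in> M. h x \<in> S}"
      using openin_continuous_map_preimage[OF that, of S] by simp
    then have "{x \<in> M. h x \<in> S} \<in> sets (sigma M {U. openin mtopology U})"
      by (intro in_measure_of) (use openin_subset[where U=mtopology] in auto)
    from measurable_sets[OF Z this]
    show "(\<lambda>\<omega>. h (Z \<omega>)) -` S \<inter> space N \<in> sets N"
      by (rule back_subst[of "\<lambda>A. A \<in> sets N"]) (use ZM in auto)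
  qed
  have lower: "\<forall>\<^sub>F n in sequentially. ereal (\<integral>\<omega>. h (Z \<omega>) \<partial>N) - ereal e < outer_expectation P (\<lambda>\<omega>. ereal (h (Y n \<omega>)))"
    (is ?low)
    and upper: "\<forall>\<^sub>F n in sequentially. outer_expectation P (\<lambda>\<omega>. ereal (h (Y n \<omega>))) < ereal (\<integral>\<omega>. h (Z \<omega>) \<partial>N) + ereal e"
    (is ?upp)
    if h: "continuous_map mtopology euclideanreal h" and b: "bounded (h ` M)" and e: "e > 0" for h e
  proof -
    obtain C where C: "\<And>x. x \<in> M \<Longrightarrow> \<bar>h x\<bar> \<le> C" using b by (auto simp: bounded_iff)
    have conv: "(\<lambda>k. \<integral>\<omega>. g k (Z \<omega>) \<partial>N) \<longlonglongrightarrow> (\<integral>\<omega>. h' (Z \<omega>) \<partial>N)"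
      if g1: "\<And>k x y. \<lbrakk>x \<in> M; y \<in> M\<rbrakk> \<Longrightarrow> \<bar>g k x - g k y\<bar> \<le> real k * d x y"
      and g2: "\<And>k x. x \<in> M \<Longrightarrow> \<bar>g k x\<bar> \<le> C" and g4: "\<And>x. x \<in> M \<Longrightarrow> (\<lambda>k. g k x) \<longlonglongrightarrow> h' x"
      and h': "continuous_map mtopology euclideanreal h'" for g :: "nat \<Rightarrow> 'a \<Rightarrow> real" and h'
    proof (rule integral_dominated_convergence[where w="\<lambda>_. C"])
      show "(\<lambda>\<omega>. h' (Z \<omega>)) \<in> borel_measurable N" by (rule meas[OF h'])
      show "(\<lambda>\<omega>. g k (Z \<omega>)) \<in> borel_measurable N" for k
      proof (rule meas)
        have "Lipschitz_continuous_map (metric (M,d)) euclidean_metric (g k)"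
          unfolding Lipschitz_continuous_map_def
          using g1[of _ _ k] by (auto simp: dist_real_def intro!: exI[of _ "real k"])
        then have "continuous_map (mtopology_of (metric (M,d))) (mtopology_of euclidean_metric) (g k)"
          by (intro Cauchy_continuous_imp_continuous_map
              uniformly_imp_Cauchy_continuous_map Lipschitz_imp_uniformly_continuous_map)
        then show "continuous_map mtopology euclideanreal (g k)" by (simp add: mtopology_of_def)
      qed
      show "integrable N (\<lambda>_. C)" by simp
      show "AE x in N. (\<lambda>k. g k (Z x)) \<longlonglongrightarrow> h' (Z x)" using g4 ZM by auto
      show "AE x in N. norm (g k (Z x)) \<le> C" for k using g2 ZM by auto
    qed
    show ?low
    proof -
      obtain g :: "nat \<Rightarrow> 'a \<Rightarrow> real" where
        g1: "\<And>k x y. \<lbrakk>x \<in> M; y \<in> M\<rbrakk> \<Longrightarrow> \<bar>g k x - g k y\<bar> \<le> real k * d x y"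
        and g2: "\<And>k x. x \<in> M \<Longrightarrow> \<bar>g k x\<bar> \<le> C" and g3: "\<And>k x. x \<in> M \<Longrightarrow> g k x \<le> h x"
        and g4: "\<And>x. x \<in> M \<Longrightarrow> (\<lambda>k. g k x) \<longlonglongrightarrow> h x"
        using Lipschitz_approx_below[OF h C] by blast
      from order_tendstoD(1)[OF conv[OF g1 g2 g4 h], of "(\<integral>\<omega>. h (Z \<omega>) \<partial>N) - e"] e
      obtain k where k: "(\<integral>\<omega>. h (Z \<omega>) \<partial>N) - e < (\<integral>\<omega>. g k (Z \<omega>) \<partial>N)"
        by (auto simp: eventually_sequentially)
      have "\<forall>\<^sub>F n in sequentially. ereal ((\<integral>\<omega>. h (Z \<omega>) \<partial>N) - e) < outer_expectation P (\<lambda>\<omega>. ereal (g k (Y n \<omega>)))"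
        by (rule order_tendstoD(1)[OF lim[OF _ g2 g1]]) (use k in auto)
      then show ?thesis
      proof (rule eventually_mono)
        fix n assume *: "ereal ((\<integral>\<omega>. h (Z \<omega>) \<partial>N) - e) < outer_expectation P (\<lambda>\<omega>. ereal (g k (Y n \<omega>)))"
        have "outer_expectation P (\<lambda>\<omega>. ereal (g k (Y n \<omega>))) \<le> outer_expectation P (\<lambda>\<omega>. ereal (h (Y n \<omega>)))"
          using Y[of n] by (intro outer_expectation_mono_AE) (auto elim!: eventually_mono intro: g3)
        with * show "ereal (\<integral>\<omega>. h (Z \<omega>) \<partial>N) - ereal e < outer_expectation P (\<lambda>\<omega>. ereal (h (Y n \<omega>)))"
          by simp
      qed
    qed
    show ?upp
    proof -
      have h': "continuous_map mtopology euclideanreal (\<lambda>x. - h x)"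
        using h by (intro continuous_intros)
      have C': "\<And>x. x \<in> M \<Longrightarrow> \<bar>- h x\<bar> \<le> C" using C by simp
      obtain g :: "nat \<Rightarrow> 'a \<Rightarrow> real" where
        g1: "\<And>k x y. \<lbrakk>x \<in> M; y \<in> M\<rbrakk> \<Longrightarrow> \<bar>g k x - g k y\<bar> \<le> real k * d x y"
        and g2: "\<And>k x. x \<in> M \<Longrightarrow> \<bar>g k x\<bar> \<le> C" and g3: "\<And>k x. x \<in> M \<Longrightarrow> g k x \<le> - h x"
        and g4: "\<And>x. x \<in> M \<Longrightarrow> (\<lambda>k. g k x) \<longlonglongrightarrow> - h x"
        using Lipschitz_approx_below[OF h' C'] by blast
      from order_tendstoD(1)[OF conv[OF g1 g2 g4 h'], of "(\<integral>\<omega>. - h (Z \<omega>) \<partial>N) - e"] e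
      obtain k where k: "(\<integral>\<omega>. - h (Z \<omega>) \<partial>N) - e < (\<integral>\<omega>. g k (Z \<omega>) \<partial>N)"
        by (auto simp: eventually_sequentially)
      have "\<forall>\<^sub>F n in sequentially. outer_expectation P (\<lambda>\<omega>. ereal (- g k (Y n \<omega>))) < ereal ((\<integral>\<omega>. h (Z \<omega>) \<partial>N) + e)"
      proof (rule order_tendstoD(2)[OF lim[of "real k" "\<lambda>x. - g k x" C]])
        show "\<bar>- g k x - - g k y\<bar> \<le> real k * d x y" if "x \<in> M" "y \<in> M" for x y
          using g1[OF that, of k] by linarith
      qed (use g2 k in auto)
      then show ?thesis
      proof (rule eventually_mono)
        fix n assume *: "outer_expectation P (\<lambda>\<omega>. ereal (- g k (Y n \<omega>))) < ereal ((\<integral>\<omega>. h (Z \<omega>) \<partial>N) + e)"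
        have "h x \<le> - g k x" if "x \<in> M" for x using g3[OF that, of k] by linarith
        then have "outer_expectation P (\<lambda>\<omega>. ereal (h (Y n \<omega>))) \<le> outer_expectation P (\<lambda>\<omega>. ereal (- g k (Y n \<omega>)))"
          using Y[of n] by (intro outer_expectation_mono_AE) (auto elim!: eventually_mono)
        with * show "outer_expectation P (\<lambda>\<omega>. ereal (h (Y n \<omega>))) < ereal (\<integral>\<omega>. h (Z \<omega>) \<partial>N) + ereal e"
          by simp
      qed
    qed
  qed
  show ?thesis
    unfolding converges_weakly_HJ_def topspace_mtopology
  proof (intro conjI allI impI Y Z)
    fix h assume h: "continuous_map mtopology euclideanreal h \<and> bounded (h ` M)"
    show "(\<lambda>n. outer_expectation P (\<lambda>\<omega>. ereal (h (Y n \<omega>)))) \<longlonglongrightarrow> ereal (\<integral>\<omega>. h (Z \<omega>) \<partial>N)"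
    proof (rule order_tendstoI)
      fix a assume a: "a < ereal (\<integral>\<omega>. h (Z \<omega>) \<partial>N)"
      obtain e where e: "e > 0" "a \<le> ereal (\<integral>\<omega>. h (Z \<omega>) \<partial>N) - ereal e"
      proof (cases a)
        case (real r)
        then show ?thesis using a by (intro that[of "(\<integral>\<omega>. h (Z \<omega>) \<partial>N) - r"]) auto
      qed (use a that[of 1] in auto)
      show "\<forall>\<^sub>F n in sequentially. a < outer_expectation P (\<lambda>\<omega>. ereal (h (Y n \<omega>)))"
        using lower[OF _ _ e(1)] h e(2) by (fast elim: eventually_mono intro: le_less_trans)
    next
      fix a assume a: "ereal (\<integral>\<omega>. h (Z \<omega>) \<partial>N) < a"
      obtain e where e: "e > 0" "ereal (\<integral>\<omega>. h (Z \<omega>) \<partial>N) + ereal e \<le> a"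
      proof (cases a)
        case (real r)
        then show ?thesis using a by (intro that[of "r - (\<integral>\<omega>. h (Z \<omega>) \<partial>N)"]) auto
      qed (use a that[of 1] in auto)
      show "\<forall>\<^sub>F n in sequentially. outer_expectation P (\<lambda>\<omega>. ereal (h (Y n \<omega>))) < a"
        using upper[OF _ _ e(1)] h e(2) by (fast elim: eventually_mono intro: less_le_trans)
    qed
  qed
qed

subsection \<open>Convergence of finite-dimensional distributions\<close>

inductive_set trig_poly :: "nat \<Rightarrow> ((nat \<Rightarrow> real) \<Rightarrow> real) set" for k where
  cos: "(\<lambda>y. cos (\<Sum>i<k. c i * y i)) \<in> trig_poly k"
| sin: "(\<lambda>y. sin (\<Sum>i<k. c i * y i)) \<in> trig_poly k"
| add: "f \<in> trig_poly k \<Longrightarrow> g \<in> trig_poly k \<Longrightarrow> (\<lambda>y. f y + g y) \<in> trig_poly k"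
| scale: "f \<in> trig_poly k \<Longrightarrow> (\<lambda>y. a * f y) \<in> trig_poly k"

lemma trig_poly_const: "(\<lambda>y. a) \<in> trig_poly k"
  using trig_poly.scale[OF trig_poly.cos[of "\<lambda>_. 0" k], of a] by simp

lemma trig_poly_combine:
  assumes "f \<in> trig_poly k" "g \<in> trig_poly k"
  shows "(\<lambda>y. a * f y + b * g y) \<in> trig_poly k"
  using assms by (intro trig_poly.add trig_poly.scale)

lemma trig_poly_mult_cos:
  assumes "g \<in> trig_poly k"
  shows "(\<lambda>y. cos (\<Sum>i<k. c i * y i) * g y) \<in> trig_poly k"
  using assms
proof induction
  case (cos d)
  have "(\<lambda>y. cos (\<Sum>i<k. c i * y i) * cos (\<Sum>i<k. d i * y i)) =
    (\<lambda>y. 1/2 * cos (\<Sum>i<k. (c i - d i) * y i) + 1/2 * cos (\<Sum>i<k. (c i + d i) * y i))"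
    by (simp add: cos_times_cos left_diff_distrib distrib_right sum.distrib sum_subtractf field_simps)
  then show ?case
    using trig_poly_combine[OF trig_poly.cos trig_poly.cos, of "1/2" "\<lambda>i. c i - d i" k "1/2" "\<lambda>i. c i + d i"]
    by simp
next
  case (sin d)
  have "(\<lambda>y. cos (\<Sum>i<k. c i * y i) * sin (\<Sum>i<k. d i * y i)) =
    (\<lambda>y. 1/2 * sin (\<Sum>i<k. (c i + d i) * y i) + (-1/2) * sin (\<Sum>i<k. (c i - d i) * y i))"
    by (simp add: cos_times_sin left_diff_distrib distrib_right sum.distrib sum_subtractf field_simps)
  then show ?case
    using trig_poly_combine[OF trig_poly.sin trig_poly.sin, of "1/2" "\<lambda>i. c i + d i" k "-1/2" "\<lambda>i. c i - d i"]
    by simp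
next
  case (add f g)
  then show ?case using trig_poly.add[OF add.IH] by (simp add: distrib_left)
next
  case (scale f a)
  then show ?case using trig_poly.scale[OF scale.IH, of a] by (simp add: mult.left_commute)
qed

lemma trig_poly_mult_sin:
  assumes "g \<in> trig_poly k"
  shows "(\<lambda>y. sin (\<Sum>i<k. c i * y i) * g y) \<in> trig_poly k"
  using assms
proof induction
  case (cos d)
  then show ?case using trig_poly_mult_cos[OF trig_poly.sin[of c k], of d] by (simp add: mult.commute)
next
  case (sin d)
  have "(\<lambda>y. sin (\<Sum>i<k. c i * y i) * sin (\<Sum>i<k. d i * y i)) =
    (\<lambda>y. 1/2 * cos (\<Sum>i<k. (c i - d i) * y i) + (-1/2) * cos (\<Sum>i<k. (c i + d i) * y i))"
    by (simp add: sin_times_sin left_diff_distrib distrib_right sum.distrib sum_subtractf field_simps)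
  then show ?case
    using trig_poly_combine[OF trig_poly.cos trig_poly.cos, of "1/2" "\<lambda>i. c i - d i" k "-1/2" "\<lambda>i. c i + d i"]
    by simp
next
  case (add f g)
  then show ?case using trig_poly.add[OF add.IH] by (simp add: distrib_left)
next
  case (scale f a)
  then show ?case using trig_poly.scale[OF scale.IH, of a] by (simp add: mult.left_commute)
qed

text \<open>The product-to-sum formulas make \<open>trig_poly k\<close> an algebra, as
  Stone-Weierstrass requires. At the same time the expectation of a member is a finite combination
  of real and imaginary parts of characteristic functions.\<close>

lemma trig_poly_mult:
  assumes "f \<in> trig_poly k" "g \<in> trig_poly k"
  shows "(\<lambda>y. f y * g y) \<in> trig_poly k"
  using assms(1)
proof induction
  case (add f1 f2)
  then show ?case using trig_poly.add[OF add.IH] by (simp add: distrib_right)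
next
  case (scale f a)
  then show ?case using trig_poly.scale[OF scale.IH, of a] by (simp add: mult.assoc)
qed (use assms(2) trig_poly_mult_cos trig_poly_mult_sin in auto)

section \<open>Lipschitz functions of finitely many coordinates\<close>

lemma compact_Pi_fun:
  fixes S :: "'i \<Rightarrow> 'b::topological_space set"
  assumes "\<And>i. compact (S i)"
  shows "compact {x. \<forall>i. x i \<in> S i}"
proof -
  have "compactin (product_topology (\<lambda>_::'i. euclidean) UNIV) (PiE UNIV S)"
    using assms by (subst compactin_PiE) auto
  then have "compact (PiE UNIV S)" by (simp add: euclidean_product_topology)
  moreover have "PiE UNIV S = {x. \<forall>i. x i \<in> S i}" by auto
  ultimately show ?thesis by simp
qed

text \<open>The function type carries the product topology. As \<open>g\<close> sees only the first
  \<open>k\<close> coordinates, finitely many continuous coordinate maps control it.\<close>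

lemma continuous_on_trunc_Lipschitz:
  fixes g :: "(nat \<Rightarrow> real) \<Rightarrow> real"
  assumes L: "0 \<le> L" and g: "\<And>x y. \<bar>g x - g y\<bar> \<le> L * (\<Sum>i<k. \<bar>x i - y i\<bar>)"
  shows "continuous_on S g"
proof (rule continuous_on_subset[OF _ subset_UNIV], simp add: continuous_on, intro allI)
  fix x :: "nat \<Rightarrow> real"
  have "((\<lambda>y. L * (\<Sum>i<k. \<bar>y i - x i\<bar>)) \<longlongrightarrow> L * (\<Sum>i<k. \<bar>x i - x i\<bar>)) (at x)"
    by (intro tendsto_intros continuous_on_product_coordinates
        [THEN continuous_on_eq_continuous_within[THEN iffD1], THEN bspec, OF UNIV_I, unfolded continuous_within])
  then have "((\<lambda>y. L * (\<Sum>i<k. \<bar>y i - x i\<bar>)) \<longlongrightarrow> 0) (at x)" by simp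
  then have "((\<lambda>y. g y - g x) \<longlongrightarrow> 0) (at x)"
    by (rule Lim_null_comparison[rotated]) (auto intro: always_eventually g)
  then show "(g \<longlongrightarrow> g x) (at x)" by (simp add: LIM_zero_iff)
qed

lemma measurable_trunc_Lipschitz:
  fixes g :: "(nat \<Rightarrow> real) \<Rightarrow> real"
  assumes L: "0 \<le> L" and g: "\<And>x y. \<bar>g x - g y\<bar> \<le> L * (\<Sum>i<k. \<bar>x i - y i\<bar>)"
    and V: "\<And>i. i < k \<Longrightarrow> (\<lambda>\<omega>. V \<omega> i) \<in> borel_measurable M"
  shows "(\<lambda>\<omega>. g (V \<omega>)) \<in> borel_measurable M"
proof -
  \<comment> \<open>The Lipschitz bound forces \<open>g\<close> to ignore the coordinates from
    \<open>k\<close> on; they are zeroed because measurability of \<open>V\<close> is known only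
    below \<open>k\<close>.\<close>
  have eq: "g x = g (\<lambda>i. if i < k then x i else 0)" for x
    using g[of x "\<lambda>i. if i < k then x i else 0"] by simp
  have "(\<lambda>\<omega> i. if i < k then V \<omega> i else 0) \<in> borel_measurable M"
  proof (rule measurable_coordinatewise_then_product)
    show "(\<lambda>\<omega>. if i < k then V \<omega> i else 0) \<in> borel_measurable M" for i
      using V by (cases "i < k") auto
  qed
  from measurable_comp[OF this borel_measurable_continuous_onI[OF continuous_on_trunc_Lipschitz[OF L g]]]
  show ?thesis by (simp add: comp_def eq[symmetric])
qed

lemma abs_sin_diff_le: "\<bar>u - sin u\<bar> \<le> u\<^sup>2" for u :: real
proof -
  have "\<bar>sin u - (\<Sum>m<2. sin_coeff m * u ^ m)\<bar> \<le> inverse (fact 2) * \<bar>u\<bar> ^ 2"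
    by (rule Maclaurin_sin_bound)
  moreover have "(\<Sum>m<2. sin_coeff m * u ^ m) = u"
    by (simp add: numeral_2_eq_2 sin_coeff_def)
  ultimately have "\<bar>u - sin u\<bar> \<le> u\<^sup>2 / 2" by (simp add: abs_minus_commute)
  also have "\<dots> \<le> u\<^sup>2" by simp
  finally show ?thesis .
qed

text \<open>Replacing \<open>y i\<close> by \<open>K * sin (y i / K)\<close> costs at most \<open>(y i)\<^sup>2 / K\<close> and makes the arguments
  range over a compact box. There Stone-Weierstrass applies to the functions that become trigonometric
  polynomials under this substitution, so the approximation is uniform on the whole space.\<close>

lemma Lipschitz_trig_poly_approx:
  fixes g :: "(nat \<Rightarrow> real) \<Rightarrow> real"
  assumes L: "0 \<le> L" and g: "\<And>x y. \<bar>g x - g y\<bar> \<le> L * (\<Sum>i<k. \<bar>x i - y i\<bar>)"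
    and K: "0 < K" and e: "0 < e"
  obtains p where "p \<in> trig_poly k"
    "\<And>y. \<bar>g y - p y\<bar> \<le> L * (\<Sum>i<k. (y i)\<^sup>2) / K + e"
proof -
  define \<tau> where "\<tau> y = (\<lambda>i. if i < k then K * sin (y i / K) else 0)" for y :: "nat \<Rightarrow> real"
  \<comment> \<open>Coordinates from \<open>k\<close> on are pinned to 0, so that the first
    \<open>k\<close> coordinate functions separate the points of this compact set.\<close>
  define S where "S = {x::nat \<Rightarrow> real. \<forall>i. x i \<in> (if i < k then {-K..K} else {0})}"
  define R where "R = {f. continuous_on S f \<and> (\<lambda>y. f (\<tau> y)) \<in> trig_poly k}"
  have coord: "(\<lambda>x. x i) \<in> R" if "i < k" for i
  proof -
    have "(\<lambda>y. K * sin (\<Sum>j<k. (if j = i then 1/K else 0) * y j)) \<in> trig_poly k"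
      by (intro trig_poly.scale trig_poly.sin)
    moreover have "(\<Sum>j<k. (if j = i then 1/K else 0) * y j) = y i / K" for y :: "nat \<Rightarrow> real"
      using that by (subst sum.remove[of _ i]) auto
    ultimately show ?thesis
      using that unfolding R_def \<tau>_def
      by (auto intro: continuous_on_subset[OF continuous_on_product_coordinates])
  qed
  interpret function_ring_on R S
  proof
    show "compact S" unfolding S_def by (rule compact_Pi_fun) auto
    show "\<exists>f\<in>R. f x \<noteq> f y" if xy: "x \<in> S" "y \<in> S" "x \<noteq> y" for x y
    proof -
      obtain i where i: "x i \<noteq> y i" using xy(3) by auto
      have "x i = 0" "y i = 0" if "\<not> i < k" using xy(1,2)[unfolded S_def, THEN CollectD, THEN spec, of i] that by simp_all
      with i have "i < k" by force
      then show ?thesis using i by (intro bexI[OF _ coord[of i]])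
    qed
    show "continuous_on S f" if "f \<in> R" for f using that by (simp add: R_def)
    show "(\<lambda>x. f x + g x) \<in> R" "(\<lambda>x. f x * g x) \<in> R" if "f \<in> R" "g \<in> R" for f g
      using that by (simp_all add: R_def trig_poly.add trig_poly_mult continuous_on_add continuous_on_mult)
    show "(\<lambda>_. c) \<in> R" for c by (simp add: R_def trig_poly_const)
  qed
  obtain f where f: "f \<in> R" "\<And>x. x \<in> S \<Longrightarrow> \<bar>g x - f x\<bar> < e"
    using Stone_Weierstrass_basic[OF continuous_on_trunc_Lipschitz[OF L g] e] by (elim bexE) simp
  show ?thesis
  proof
    show "(\<lambda>y. f (\<tau> y)) \<in> trig_poly k" using f(1) by (simp add: R_def)
    fix y :: "nat \<Rightarrow> real"
    have "\<bar>K * sin (y i / K)\<bar> \<le> K" for i :: nat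
      using K by (simp add: abs_mult mult_left_le)
    then have "\<tau> y \<in> S" by (simp add: S_def \<tau>_def abs_le_iff minus_le_iff)
    then have "\<bar>g (\<tau> y) - f (\<tau> y)\<bar> < e" by (rule f(2))
    moreover have "\<bar>g y - g (\<tau> y)\<bar> \<le> L * (\<Sum>i<k. (y i)\<^sup>2) / K"
    proof -
      have "\<bar>y i - \<tau> y i\<bar> \<le> (y i)\<^sup>2 / K" if "i < k" for i
      proof -
        have "\<bar>y i - \<tau> y i\<bar> = K * \<bar>y i / K - sin (y i / K)\<bar>"
        proof -
          have "y i - \<tau> y i = K * (y i / K - sin (y i / K))"
            using K that by (simp add: \<tau>_def right_diff_distrib)
          then show ?thesis using K by (simp add: abs_mult)
        qed
        also have "\<dots> \<le> K * (y i / K)\<^sup>2" using K by (intro mult_left_mono abs_sin_diff_le) auto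
        finally show ?thesis using K by (simp add: power2_eq_square field_simps)
      qed
      then have "(\<Sum>i<k. \<bar>y i - \<tau> y i\<bar>) \<le> (\<Sum>i<k. (y i)\<^sup>2 / K)" by (intro sum_mono) auto
      then have "L * (\<Sum>i<k. \<bar>y i - \<tau> y i\<bar>) \<le> L * (\<Sum>i<k. (y i)\<^sup>2 / K)"
        using L by (rule mult_left_mono)
      moreover have "L * (\<Sum>i<k. (y i)\<^sup>2 / K) = L * (\<Sum>i<k. (y i)\<^sup>2) / K"
        by (simp flip: sum_divide_distrib)
      ultimately show ?thesis using g[of y "\<tau> y"] by linarith
    qed
    ultimately show "\<bar>g y - f (\<tau> y)\<bar> \<le> L * (\<Sum>i<k. (y i)\<^sup>2) / K + e" by linarith
  qed
qed

lemma trig_poly_integrable: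
  assumes M: "prob_space M" and p: "p \<in> trig_poly k"
    and V: "\<And>i. i < k \<Longrightarrow> (\<lambda>\<omega>. V \<omega> i) \<in> borel_measurable M"
  shows "integrable M (\<lambda>\<omega>. p (V \<omega>))"
proof -
  interpret prob_space M by (rule M)
  from p show ?thesis
  proof induction
    case (cos c)
    show ?case using V by (intro integrable_const_bound[where B=1]) auto
  next
    case (sin c)
    show ?case using V by (intro integrable_const_bound[where B=1]) auto
  qed auto
qed

lemma trig_poly_tendsto:
  assumes M: "prob_space M" and N: "prob_space N" and p: "p \<in> trig_poly k"
    and V: "\<And>n i. i < k \<Longrightarrow> (\<lambda>\<omega>. V n \<omega> i) \<in> borel_measurable M"
    and W: "\<And>i. i < k \<Longrightarrow> (\<lambda>\<omega>. W \<omega> i) \<in> borel_measurable N"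
    and cos: "\<And>c. (\<lambda>n. \<integral>\<omega>. cos (\<Sum>i<k. c i * V n \<omega> i) \<partial>M) \<longlonglongrightarrow> (\<integral>\<omega>. cos (\<Sum>i<k. c i * W \<omega> i) \<partial>N)"
    and sin: "\<And>c. (\<lambda>n. \<integral>\<omega>. sin (\<Sum>i<k. c i * V n \<omega> i) \<partial>M) \<longlonglongrightarrow> (\<integral>\<omega>. sin (\<Sum>i<k. c i * W \<omega> i) \<partial>N)"
  shows "(\<lambda>n. \<integral>\<omega>. p (V n \<omega>) \<partial>M) \<longlonglongrightarrow> (\<integral>\<omega>. p (W \<omega>) \<partial>N)"
  using p
proof induction
  case (add f g)
  have "(\<integral>\<omega>. f (V n \<omega>) + g (V n \<omega>) \<partial>M) = (\<integral>\<omega>. f (V n \<omega>) \<partial>M) + (\<integral>\<omega>. g (V n \<omega>) \<partial>M)" for n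
    using add.hyps V by (intro Bochner_Integration.integral_add trig_poly_integrable[OF M]) auto
  moreover have "(\<integral>\<omega>. f (W \<omega>) + g (W \<omega>) \<partial>N) = (\<integral>\<omega>. f (W \<omega>) \<partial>N) + (\<integral>\<omega>. g (W \<omega>) \<partial>N)"
    using add.hyps W by (intro Bochner_Integration.integral_add trig_poly_integrable[OF N]) auto
  ultimately show ?case using tendsto_add[OF add.IH] by simp
next
  case (scale f a)
  then show ?case using tendsto_mult_left[OF scale.IH, of a] by simp
qed (fact cos sin)+

text \<open>The approximating trigonometric polynomial differs from \<open>g\<close> by a multiple
  of the sum of squares divided by \<open>K\<close>, plus a small constant. Second moments bounded
  by \<open>C\<close> make this error small in expectation uniformly in \<open>n\<close>, which
  takes the place of a tightness argument.\<close>

theorem Cramer_Wold_Lipschitz: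
  fixes g :: "(nat \<Rightarrow> real) \<Rightarrow> real"
  assumes M: "prob_space M" and N: "prob_space N"
    and V: "\<And>n i. i < k \<Longrightarrow> (\<lambda>\<omega>. V n \<omega> i) \<in> borel_measurable M"
    and W: "\<And>i. i < k \<Longrightarrow> (\<lambda>\<omega>. W \<omega> i) \<in> borel_measurable N"
    and V2: "\<And>n i. i < k \<Longrightarrow> integrable M (\<lambda>\<omega>. (V n \<omega> i)\<^sup>2)" "\<And>n i. i < k \<Longrightarrow> (\<integral>\<omega>. (V n \<omega> i)\<^sup>2 \<partial>M) \<le> C"
    and W2: "\<And>i. i < k \<Longrightarrow> integrable N (\<lambda>\<omega>. (W \<omega> i)\<^sup>2)" "\<And>i. i < k \<Longrightarrow> (\<integral>\<omega>. (W \<omega> i)\<^sup>2 \<partial>N) \<le> C"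
    and cos: "\<And>c. (\<lambda>n. \<integral>\<omega>. cos (\<Sum>i<k. c i * V n \<omega> i) \<partial>M) \<longlonglongrightarrow> (\<integral>\<omega>. cos (\<Sum>i<k. c i * W \<omega> i) \<partial>N)"
    and sin: "\<And>c. (\<lambda>n. \<integral>\<omega>. sin (\<Sum>i<k. c i * V n \<omega> i) \<partial>M) \<longlonglongrightarrow> (\<integral>\<omega>. sin (\<Sum>i<k. c i * W \<omega> i) \<partial>N)"
    and L: "0 \<le> L" and g: "\<And>x y. \<bar>g x - g y\<bar> \<le> L * (\<Sum>i<k. \<bar>x i - y i\<bar>)"
    and gB: "\<And>x. \<bar>g x\<bar> \<le> B"
  shows "(\<lambda>n. \<integral>\<omega>. g (V n \<omega>) \<partial>M) \<longlonglongrightarrow> (\<integral>\<omega>. g (W \<omega>) \<partial>N)"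
proof (rule LIMSEQ_I)
  interpret M: prob_space M by (rule M)
  interpret N: prob_space N by (rule N)
  fix r :: real assume r: "0 < r"
  \<comment> \<open>With this choice the quadratic error has expectation at most \<open>r/8\<close>;
    the summand 1 keeps \<open>K\<close> positive when \<open>L\<close>, \<open>k\<close> or
    \<open>C\<close> vanishes.\<close>
  define K where "K = 1 + 8 * L * (real k * \<bar>C\<bar>) / r"
  have K: "0 < K" using L r unfolding K_def by (auto intro!: add_pos_nonneg)
  have "L * (real k * \<bar>C\<bar>) / K \<le> r / 8"
    using L r K unfolding K_def by (simp add: field_simps)
  obtain p where p: "p \<in> trig_poly k"
    and gp: "\<And>y. \<bar>g y - p y\<bar> \<le> L * (\<Sum>i<k. (y i)\<^sup>2) / K + r/8"
    using Lipschitz_trig_poly_approx[OF L g K, of "r/8"] r by auto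
  \<comment> \<open>Stated for an arbitrary probability space since it is needed under both
    \<open>M\<close> and \<open>N\<close>; these two gaps and the convergence for \<open>p\<close>
    use up three quarters of \<open>r\<close>.\<close>
  have gap: "\<bar>(\<integral>\<omega>. g (Y \<omega>) \<partial>Q) - (\<integral>\<omega>. p (Y \<omega>) \<partial>Q)\<bar> \<le> r/4"
    if Q: "prob_space Q" and Y: "\<And>i. i < k \<Longrightarrow> (\<lambda>\<omega>. Y \<omega> i) \<in> borel_measurable Q"
      and Y2: "\<And>i. i < k \<Longrightarrow> integrable Q (\<lambda>\<omega>. (Y \<omega> i)\<^sup>2)" "\<And>i. i < k \<Longrightarrow> (\<integral>\<omega>. (Y \<omega> i)\<^sup>2 \<partial>Q) \<le> C"
    for Q :: "'x measure" and Y
  proof -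
    interpret Q: prob_space Q by (rule Q)
    have ig: "integrable Q (\<lambda>\<omega>. g (Y \<omega>))"
      using measurable_trunc_Lipschitz[OF L g Y] gB by (intro Q.integrable_const_bound[where B=B]) auto
    have ip: "integrable Q (\<lambda>\<omega>. p (Y \<omega>))" by (rule trig_poly_integrable[OF Q p Y])
    have iS: "integrable Q (\<lambda>\<omega>. L * (\<Sum>i<k. (Y \<omega> i)\<^sup>2) / K + r/8)"
      using Y2(1) by (intro Bochner_Integration.integrable_add integrable_mult_right
          integrable_divide Bochner_Integration.integrable_sum) auto
    have "\<bar>(\<integral>\<omega>. g (Y \<omega>) \<partial>Q) - (\<integral>\<omega>. p (Y \<omega>) \<partial>Q)\<bar> = \<bar>\<integral>\<omega>. g (Y \<omega>) - p (Y \<omega>) \<partial>Q\<bar>"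
      using ig ip by simp
    also have "\<dots> \<le> (\<integral>\<omega>. \<bar>g (Y \<omega>) - p (Y \<omega>)\<bar> \<partial>Q)" by (rule integral_abs_bound)
    also have "\<dots> \<le> (\<integral>\<omega>. L * (\<Sum>i<k. (Y \<omega> i)\<^sup>2) / K + r/8 \<partial>Q)"
      using ig ip iS by (intro integral_mono gp) auto
    also have "\<dots> = L * (\<Sum>i<k. (\<integral>\<omega>. (Y \<omega> i)\<^sup>2 \<partial>Q)) / K + r/8"
    proof -
      have "integrable Q (\<lambda>\<omega>. L * (\<Sum>i<k. (Y \<omega> i)\<^sup>2) / K)"
        using Y2(1) by (intro integrable_mult_right integrable_divide Bochner_Integration.integrable_sum) auto
      moreover have "(\<integral>\<omega>. (\<Sum>i<k. (Y \<omega> i)\<^sup>2) \<partial>Q) = (\<Sum>i<k. (\<integral>\<omega>. (Y \<omega> i)\<^sup>2 \<partial>Q))"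
        using Y2(1) by (intro Bochner_Integration.integral_sum) auto
      ultimately show ?thesis by (simp add: Q.prob_space)
    qed
    also have "\<dots> \<le> L * (real k * \<bar>C\<bar>) / K + r/8"
    proof -
      have "(\<Sum>i<k. (\<integral>\<omega>. (Y \<omega> i)\<^sup>2 \<partial>Q)) \<le> (\<Sum>i<k. \<bar>C\<bar>)"
        by (intro sum_mono order_trans[OF Y2(2) abs_ge_self]) simp
      then show ?thesis using L K by (intro add_right_mono divide_right_mono mult_left_mono) auto
    qed
    also have "\<dots> \<le> r/4" using \<open>L * (real k * \<bar>C\<bar>) / K \<le> r / 8\<close> by linarith
    finally show ?thesis .
  qed
  have "(\<lambda>n. \<integral>\<omega>. p (V n \<omega>) \<partial>M) \<longlonglongrightarrow> (\<integral>\<omega>. p (W \<omega>) \<partial>N)"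
    by (rule trig_poly_tendsto[OF M N p V W cos sin])
  from LIMSEQ_D[OF this, of "r/4"] r obtain n0 where
    n0: "\<And>n. n \<ge> n0 \<Longrightarrow> \<bar>(\<integral>\<omega>. p (V n \<omega>) \<partial>M) - (\<integral>\<omega>. p (W \<omega>) \<partial>N)\<bar> < r/4" by auto
  have "norm ((\<integral>\<omega>. g (V n \<omega>) \<partial>M) - (\<integral>\<omega>. g (W \<omega>) \<partial>N)) < r" if "n \<ge> n0" for n
    using n0[OF that] gap[of M "V n", OF M V V2] gap[of N W, OF N W W2] r
    unfolding real_norm_def by linarith
  then show "\<exists>n0. \<forall>n\<ge>n0. norm ((\<integral>\<omega>. g (V n \<omega>) \<partial>M) - (\<integral>\<omega>. g (W \<omega>) \<partial>N)) < r" by blast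
qed

subsection \<open>The Brownian bridge\<close>

text \<open>If \<open>\<bar>x\<bar>\<close> exceeds \<open>l\<close>, multiplying it by
  \<open>(\<bar>x\<bar> / l)^3\<close> only enlarges it. This bounds a maximum over many variables
  by a threshold plus a sum of fourth powers, whose expectation can be computed.\<close>

lemma abs_le_add_power4_div:
  fixes x l :: real
  assumes l: "0 < l"
  shows "\<bar>x\<bar> \<le> l + x ^ 4 / l ^ 3"
proof (cases "\<bar>x\<bar> \<le> l")
  case True
  then show ?thesis using l by (simp add: add_increasing2)
next
  case False
  then have "l ^ 3 * \<bar>x\<bar> \<le> \<bar>x\<bar> ^ 3 * \<bar>x\<bar>" using l by (intro mult_right_mono power_mono) auto
  also have "\<bar>x\<bar> ^ 3 * \<bar>x\<bar> = x ^ 4" by (simp add: power_even_abs flip: power_Suc2)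
  finally have "\<bar>x\<bar> \<le> x ^ 4 / l ^ 3" using l by (simp add: field_simps)
  then show ?thesis using l by simp
qed

lemma normal_distribution_eq_distr:
  assumes "0 \<le> s"
  shows "normal_distribution 0 s = distr std_normal_distribution borel (\<lambda>x. s * x)"
proof (cases "s = 0")
  case True
  interpret real_distribution std_normal_distribution by (rule real_dist_normal_dist)
  show ?thesis using True by (simp add: normal_distribution_def)
next
  case False
  interpret real_distribution std_normal_distribution by (rule real_dist_normal_dist)
  have "distributed std_normal_distribution lborel (\<lambda>x. x) std_normal_density"
    by (auto simp: distributed_def distr_id2)
  from normal_density_affine[OF this, of s 0] False assms
  have "distr std_normal_distribution lborel (\<lambda>x. s * x) = normal_distribution 0 s"
    by (simp add: distributed_def normal_distribution_def)
  moreover have "distr std_normal_distribution lborel (\<lambda>x. s * x) = distr std_normal_distribution borel (\<lambda>x. s * x)"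
    by (rule distr_cong) auto
  ultimately show ?thesis by simp
qed

lemma char_distr_scale_std_normal:
  "char (distr std_normal_distribution borel (\<lambda>x. s * x)) u = complex_of_real (exp (- (u\<^sup>2 * s\<^sup>2) / 2))"
proof -
  have "char (distr std_normal_distribution borel (\<lambda>x. s * x)) u = char std_normal_distribution (u * s)"
    by (simp add: char_def integral_distr mult.assoc)
  then show ?thesis by (simp add: char_std_normal_distribution power_mult_distrib)
qed

text \<open>The laws and moments of all Gaussian variables below are read off from their
  characteristic functions. That \<open>v\<close> is nonnegative is itself a consequence: at
  \<open>u = 1\<close> the value \<open>exp (- v / 2)\<close> is at most 1.\<close>

lemma normal_if_char:
  assumes N: "prob_space N" and Y[measurable]: "Y \<in> borel_measurable N"
    and char: "\<And>u. (CLINT \<omega>|N. iexp (u * Y \<omega>)) = complex_of_real (exp (- (u\<^sup>2 * v) / 2))"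
  shows "0 \<le> v" "distr N borel Y = normal_distribution 0 (sqrt v)"
    "integrable N (\<lambda>\<omega>. (Y \<omega>)\<^sup>2)" "(\<integral>\<omega>. (Y \<omega>)\<^sup>2 \<partial>N) = v" "(\<integral>\<omega>. Y \<omega> \<partial>N) = 0" "integrable N Y"
proof -
  interpret N: prob_space N by (rule N)
  interpret D: real_distribution "distr N borel Y" by (intro N.real_distribution_distr) simp
  interpret S: real_distribution std_normal_distribution by (rule real_dist_normal_dist)
  let ?S = "distr std_normal_distribution borel (\<lambda>x. sqrt v * x)"
  have c: "char (distr N borel Y) u = complex_of_real (exp (- (u\<^sup>2 * v) / 2))" for u
    using char[of u] by (simp add: char_def integral_distr)
  have "norm (char (distr N borel Y) 1) \<le> 1" by (rule D.cmod_char_le_1)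
  then show v: "0 \<le> v" by (simp add: c)
  have eq: "distr N borel Y = ?S"
  proof (rule Levy_uniqueness)
    show "real_distribution (distr N borel Y)" by (rule D.real_distribution_axioms)
    show "real_distribution ?S" by (intro S.real_distribution_distr) simp
    show "char (distr N borel Y) = char ?S"
      using v by (auto simp: c char_distr_scale_std_normal)
  qed
  then show "distr N borel Y = normal_distribution 0 (sqrt v)"
    using v by (simp add: normal_distribution_eq_distr)
  have transfer: "integrable N (\<lambda>\<omega>. f (Y \<omega>)) = integrable std_normal_distribution (\<lambda>x. f (sqrt v * x))"
      "(\<integral>\<omega>. f (Y \<omega>) \<partial>N) = (\<integral>x. f (sqrt v * x) \<partial>std_normal_distribution)"
    if f: "f \<in> borel_measurable borel" for f :: "real \<Rightarrow> real"
  proof -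
    have [measurable]: "(\<lambda>x. sqrt v * x) \<in> std_normal_distribution \<rightarrow>\<^sub>M borel" by simp
    show "integrable N (\<lambda>\<omega>. f (Y \<omega>)) = integrable std_normal_distribution (\<lambda>x. f (sqrt v * x))"
      using integrable_distr_eq[OF Y f] integrable_distr_eq[OF \<open>(\<lambda>x. sqrt v * x) \<in> _\<close> f]
      unfolding eq by blast
    show "(\<integral>\<omega>. f (Y \<omega>) \<partial>N) = (\<integral>x. f (sqrt v * x) \<partial>std_normal_distribution)"
      using integral_distr[OF Y f] integral_distr[OF \<open>(\<lambda>x. sqrt v * x) \<in> _\<close> f]
      unfolding eq by simp
  qed
  have sq: "(sqrt v * x)\<^sup>2 = v * x\<^sup>2" for x using v by (simp add: power_mult_distrib)
  show "integrable N (\<lambda>\<omega>. (Y \<omega>)\<^sup>2)"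
    unfolding transfer(1)[of "\<lambda>x. x\<^sup>2", simplified] sq
    by (intro integrable_mult_right integrable_std_normal_distribution_moment)
  show "integrable N Y"
    using transfer(1)[of "\<lambda>x. x"] integrable_std_normal_distribution_moment[of 1] by simp
  show "(\<integral>\<omega>. (Y \<omega>)\<^sup>2 \<partial>N) = v"
    unfolding transfer(2)[of "\<lambda>x. x\<^sup>2", simplified] sq
    using std_normal_distribution_even_moments(1)[of 1] by simp
  show "(\<integral>\<omega>. Y \<omega> \<partial>N) = 0"
    using transfer(2)[of "\<lambda>x. x"] integral_std_normal_distribution_moment_odd[of 1] by simp
qed

section \<open>Schauder functions and the covariance of the bridge\<close>

definition tent :: "real \<Rightarrow> real" where
  "tent u = max 0 (min u (1 - u))"

lemma tent_nonneg: "0 \<le> tent u" and tent_le_1: "tent u \<le> 1"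
  by (auto simp: tent_def)

lemma tent_eq_0: "u \<le> 0 \<or> 1 \<le> u \<Longrightarrow> tent u = 0"
  by (auto simp: tent_def)

lemma continuous_on_tent [continuous_intros]: "continuous_on S f \<Longrightarrow> continuous_on S (\<lambda>x. tent (f x))"
  unfolding tent_def by (intro continuous_intros)

lemma measurable_tent [measurable]: "tent \<in> borel_measurable borel"
  unfolding tent_def by measurable

text \<open>The supports of the shifted hats overlap at most in end points, so only the index
  \<open>nat \<lfloor>u\<rfloor>\<close> can contribute.\<close>

lemma sum_tent_le_1: "(\<Sum>k<n. tent (u - real k)) \<le> 1"
proof -
  have "(\<Sum>k<n. tent (u - real k)) \<le> (\<Sum>k<n. if k = nat \<lfloor>u\<rfloor> then 1 else 0)"
  proof (rule sum_mono)
    fix k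
    show "tent (u - real k) \<le> (if k = nat \<lfloor>u\<rfloor> then 1 else 0)"
    proof (cases "k = nat \<lfloor>u\<rfloor>")
      case False
      then have "u - real k \<le> 0 \<or> 1 \<le> u - real k" by linarith
      then show ?thesis using False by (simp add: tent_eq_0)
    qed (simp add: tent_le_1)
  qed
  also have "\<dots> \<le> 1" by simp
  finally show ?thesis .
qed

text \<open>This is the covariance of \<open>schauder_level\<close> at \<open>s\<close> and
  \<open>t\<close> when its coefficients are independent standard normal variables.\<close>

definition schauder_kernel :: "nat \<Rightarrow> real \<Rightarrow> real \<Rightarrow> real" where
  "schauder_kernel j s t = (1/2) ^ j * (\<Sum>k<2^j. tent (2^j * s - real k) * tent (2^j * t - real k))"

lemma sum_lessThan_2_power_Suc: "(\<Sum>k<2^Suc j. f k) = (\<Sum>k<2^j. f k) + (\<Sum>k<2^j. f (2^j + k))"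
  for f :: "nat \<Rightarrow> 'a::comm_monoid_add"
proof -
  have "(\<Sum>k<2^Suc j. f k) = (\<Sum>k<2^j + 2^j. f k)" by (simp add: mult_2)
  also have "\<dots> = (\<Sum>k<2^j. f k) + (\<Sum>k=2^j..<2^j+2^j. f k)"
    by (simp add: lessThan_atLeast0 sum.atLeastLessThan_concat)
  also have "(\<Sum>k=2^j..<2^j+2^j. f k) = (\<Sum>k<2^j. f (2^j + k))"
    using sum.shift_bounds_nat_ivl[of f 0 "2^j" "2^j"] by (simp add: lessThan_atLeast0 add.commute)
  finally show ?thesis .
qed

text \<open>At level \<open>Suc j\<close> the first \<open>2^j\<close> hats live on
  \<open>[0, 1/2]\<close> and the other \<open>2^j\<close> on \<open>[1/2, 1]\<close>. Each half is
  a copy of level \<open>j\<close> at half scale, the prefactor contributes the division by 2, and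
  points in different halves never share a hat.\<close>

lemma schauder_kernel_Suc:
  shows "\<lbrakk>s \<le> 1/2; t \<le> 1/2\<rbrakk> \<Longrightarrow> schauder_kernel (Suc j) s t = schauder_kernel j (2 * s) (2 * t) / 2"
    "\<lbrakk>1/2 \<le> s; 1/2 \<le> t\<rbrakk> \<Longrightarrow> schauder_kernel (Suc j) s t = schauder_kernel j (2 * s-1) (2 * t-1) / 2"
    "\<lbrakk>s \<le> 1/2; 1/2 \<le> t\<rbrakk> \<Longrightarrow> schauder_kernel (Suc j) s t = 0"
proof -
  have low: "tent (2^Suc j * s - real (2^j + k)) = 0" if "s \<le> 1/2" for s k
  proof -
    have "2^Suc j * s = 2^j * (2 * s)" by simp
    also have "\<dots> \<le> 2^j * 1" using that by (intro mult_left_mono) auto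
    finally have "2^Suc j * s \<le> 2^j" by simp
    then show ?thesis by (intro tent_eq_0 disjI1) (simp add: add_increasing2)
  qed
  have high: "tent (2^Suc j * s - real k) = 0" if "1/2 \<le> s" "k < 2^j" for s k
  proof -
    have "2^j * 1 \<le> 2^j * (2 * s)" using that by (intro mult_left_mono) auto
    also have "\<dots> = 2^Suc j * s" by simp
    finally have "2^j \<le> 2^Suc j * s" by simp
    moreover have "real k + 1 \<le> 2^j"
    proof -
      have "real (Suc k) \<le> real (2^j)" using that(2) by (intro of_nat_mono) auto
      then show ?thesis by simp
    qed
    ultimately have "1 \<le> 2^Suc j * s - real k" by linarith
    then show ?thesis by (intro tent_eq_0) auto
  qed
  have split: "schauder_kernel (Suc j) s t =
      (1/2)^Suc j * ((\<Sum>k<2^j. tent (2^Suc j * s - real k) * tent (2^Suc j * t - real k)) +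
        (\<Sum>k<2^j. tent (2^Suc j * s - real (2^j + k)) * tent (2^Suc j * t - real (2^j + k))))"
    unfolding schauder_kernel_def sum_lessThan_2_power_Suc ..
  show "schauder_kernel (Suc j) s t = schauder_kernel j (2 * s) (2 * t) / 2" if "s \<le> 1/2" "t \<le> 1/2"
  proof -
    have "2^Suc j * x = 2^j * (2 * x)" for x :: real by simp
    then show ?thesis
      unfolding split low[OF that(1)] unfolding schauder_kernel_def by (simp only:) simp
  qed
  show "schauder_kernel (Suc j) s t = schauder_kernel j (2 * s - 1) (2 * t - 1) / 2" if "1/2 \<le> s" "1/2 \<le> t"
  proof -
    have shift: "2^Suc j * x - real (2^j + k) = 2^j * (2 * x - 1) - real k" for x k
      by (simp add: right_diff_distrib)
    have zero: "(\<Sum>k<2^j. tent (2^Suc j * s - real k) * tent (2^Suc j * t - real k)) = 0"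
      by (intro sum.neutral ballI) (simp add: high[OF that(1)] del: power_Suc)
    show ?thesis unfolding split zero shift by (simp add: schauder_kernel_def)
  qed
  show "schauder_kernel (Suc j) s t = 0" if "s \<le> 1/2" "1/2 \<le> t"
  proof -
    have "(\<Sum>k<2^j. tent (2^Suc j * s - real k) * tent (2^Suc j * t - real k)) = 0"
      by (intro sum.neutral ballI) (simp add: high[OF that(2)] del: power_Suc)
    then show ?thesis unfolding split low[OF that(1)] by simp
  qed
qed

text \<open>The kernel \<open>K s t = min s t - s * t\<close> is self-similar: on each diagonal half square it is
  \<open>tent s * tent t\<close> plus a copy of \<open>K\<close> rescaled by the factor \<open>1/2\<close>.\<close>

lemma sum_schauder_kernel_approx:
  assumes "0 \<le> s" "s \<le> 1" "0 \<le> t" "t \<le> 1"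
  shows "\<bar>(min s t - s * t) - (\<Sum>j<m. schauder_kernel j s t)\<bar> \<le> (1/2)^m"
  using assms
proof (induction m arbitrary: s t)
  case 0
  have "s * t \<le> min s t" using 0 by (simp add: mult_left_le mult_left_le_one_le)
  moreover have "0 \<le> s * t" "min s t \<le> 1" using 0 by auto
  ultimately show ?case by simp
next
  case (Suc m)
  have split: "(\<Sum>j<Suc m. schauder_kernel j s t) = tent s * tent t + (\<Sum>j<m. schauder_kernel (Suc j) s t)"
    unfolding sum.lessThan_Suc_shift by (simp add: schauder_kernel_def)
  \<comment> \<open>The kernel and the partial sum split off the same \<open>c\<close>; what remains
    is the error of the rescaled copies, halved.\<close>
  have halve: "\<bar>a - b\<bar> \<le> (1/2)^Suc m"
    if "b = c + S / 2" "a = c + x / 2" "\<bar>x - S\<bar> \<le> (1/2)^m" for a b c x S :: real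
  proof -
    have "a - b = (x - S) / 2" using that(1,2) by (simp add: field_simps)
    show ?thesis unfolding \<open>a - b = (x - S) / 2\<close> using that(3) by simp
  qed
  have main: "\<bar>(min s t - s * t) - (\<Sum>j<Suc m. schauder_kernel j s t)\<bar> \<le> (1/2)^Suc m"
    if "s \<le> t" "0 \<le> s" "s \<le> 1" "0 \<le> t" "t \<le> 1"
    and split: "(\<Sum>j<Suc m. schauder_kernel j s t) = tent s * tent t + (\<Sum>j<m. schauder_kernel (Suc j) s t)" for s t
  proof -
    consider "t \<le> 1/2" | "1/2 \<le> s" | "s \<le> 1/2" "1/2 \<le> t" by linarith
    then show ?thesis
    proof cases
      case 1
      then have "(\<Sum>j<Suc m. schauder_kernel j s t) = s * t + (\<Sum>j<m. schauder_kernel j (2 * s) (2 * t)) / 2"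
        using that unfolding split by (simp add: schauder_kernel_Suc(1) sum_divide_distrib tent_def)
      moreover have "min s t - s * t = s * t + (min (2 * s) (2 * t) - (2 * s) * (2 * t)) / 2"
        using that by (simp add: min_def field_simps)
      moreover have "\<bar>(min (2 * s) (2 * t) - (2 * s) * (2 * t)) - (\<Sum>j<m. schauder_kernel j (2 * s) (2 * t))\<bar> \<le> (1/2)^m"
        by (rule Suc.IH) (use that 1 in auto)
      ultimately show ?thesis by (rule halve)
    next
      case 2
      then have "(\<Sum>j<Suc m. schauder_kernel j s t) = (1-s) * (1-t) + (\<Sum>j<m. schauder_kernel j (2 * s-1) (2 * t-1)) / 2"
        using that unfolding split by (simp add: schauder_kernel_Suc(2) sum_divide_distrib tent_def)
      moreover have "min s t - s * t = (1-s) * (1-t) + (min (2 * s-1) (2 * t-1) - (2 * s-1) * (2 * t-1)) / 2"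
        using that by (simp add: min_def field_simps)
      moreover have "\<bar>(min (2 * s-1) (2 * t-1) - (2 * s-1) * (2 * t-1)) - (\<Sum>j<m. schauder_kernel j (2 * s-1) (2 * t-1))\<bar> \<le> (1/2)^m"
        by (rule Suc.IH) (use that 2 in auto)
      ultimately show ?thesis by (rule halve)
    next
      \<comment> \<open>The points lie in different halves, so all levels above 0 vanish and the
        first term \<open>s * (1-t)\<close> is already the full kernel.\<close>
      case 3
      then have "(\<Sum>j<Suc m. schauder_kernel j s t) = s * (1-t)"
        using that unfolding split by (simp add: schauder_kernel_Suc(3) tent_def)
      then show ?thesis using that by (simp add: min_def algebra_simps)
    qed
  qed
  show ?case
  proof (cases "s \<le> t")
    case True
    show ?thesis by (rule main[OF True Suc.prems split])
  next
    case False
    have sym: "schauder_kernel j s t = schauder_kernel j t s" for j s t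
      by (simp add: schauder_kernel_def mult.commute)
    have "(\<Sum>j<Suc m. schauder_kernel j t s) = tent t * tent s + (\<Sum>j<m. schauder_kernel (Suc j) t s)"
      using split unfolding sym[of _ t s] by (simp only: mult.commute)
    then have "\<bar>(min t s - t * s) - (\<Sum>j<Suc m. schauder_kernel j t s)\<bar> \<le> (1/2)^Suc m"
      using False Suc.prems by (intro main) auto
    moreover have "min t s - t * s = min s t - s * t" by (simp add: min.commute)
    ultimately show ?thesis unfolding sym[of _ t s] by simp
  qed
qed

lemma sums_schauder_kernel:
  assumes "0 \<le> s" "s \<le> 1" "0 \<le> t" "t \<le> 1"
  shows "(\<lambda>j. schauder_kernel j s t) sums (min s t - s * t)"
  unfolding sums_def
proof (rule LIM_zero_cancel, rule Lim_null_comparison)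
  show "\<forall>\<^sub>F m in sequentially. norm ((\<Sum>j<m. schauder_kernel j s t) - (min s t - s * t)) \<le> (1/2)^m"
    using sum_schauder_kernel_approx[OF assms] by (intro always_eventually) (simp add: abs_minus_commute)
  show "(\<lambda>m. (1/2::real)^m) \<longlonglongrightarrow> 0" by (rule LIMSEQ_realpow_zero) auto
qed

text \<open>The factor \<open>(1 / sqrt 2)^j\<close> turns a hat into the integral of the normalised
  Haar function. The series is thus the Levy-Ciesielski expansion of Brownian motion without its
  linear term, which leaves the bridge.\<close>

definition schauder_level :: "(nat \<Rightarrow> nat \<Rightarrow> real) \<Rightarrow> nat \<Rightarrow> real \<Rightarrow> real" where
  "schauder_level z j t = (1 / sqrt 2) ^ j * (\<Sum>k<2^j. z j k * tent (2^j * t - real k))"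

text \<open>Free of \<open>t\<close>, so that it can serve as majorant in the M-test. The number
  729/250 is \<open>4 * (9/10)^3\<close>: the fourth power of \<open>(1 / sqrt 2)^j\<close> is
  \<open>4^-j\<close>, and the threshold \<open>(9/10)^j\<close> enters with its cube.\<close>

definition schauder_bound :: "(nat \<Rightarrow> nat \<Rightarrow> real) \<Rightarrow> nat \<Rightarrow> real" where
  "schauder_bound z j = (9/10)^j + (\<Sum>k<2^j. (z j k)^4) / (729/250)^j"

definition bridge :: "(nat \<Rightarrow> nat \<Rightarrow> real) \<Rightarrow> real \<Rightarrow> real" where
  "bridge z t = (\<Sum>j. schauder_level z j t)"

text \<open>The threshold inequality is applied to every coefficient. Since the hats sum to at most
  1, the threshold is paid only once, while each hat in front of a fourth power is replaced by
  1.\<close>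

lemma abs_schauder_level_le: "\<bar>schauder_level z j t\<bar> \<le> schauder_bound z j"
proof -
  let ?a = "(1 / sqrt 2) ^ j :: real" and ?l = "(9/10)^j :: real"
  have a4: "(?a * x)^4 = x^4 / 4^j" for x
  proof -
    have "?a^4 = ((1 / sqrt 2)^4)^j" by (simp only: power_mult[symmetric] mult.commute)
    also have "(1 / sqrt 2)^4 = (1/4 :: real)" by (simp add: power4_eq_xxxx)
    finally show ?thesis by (simp add: power_mult_distrib power_one_over field_simps)
  qed
  have l3: "x / 4^j / ?l^3 = x / (729/250)^j" for x
  proof -
    have "4^j * ?l^3 = (729/250)^j"
    proof -
      have "4^j * ?l^3 = (4::real)^j * ((9/10)^3)^j" by (simp only: power_mult[symmetric] mult.commute)
      also have "\<dots> = (4 * (9/10)^3)^j" by (simp only: power_mult_distrib)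
      also have "4 * (9/10)^3 = (729/250 :: real)" by (simp add: power3_eq_cube)
      finally show ?thesis .
    qed
    then show ?thesis by simp
  qed
  have "\<bar>schauder_level z j t\<bar> = \<bar>\<Sum>k<2^j. (?a * z j k) * tent (2^j * t - real k)\<bar>"
    unfolding schauder_level_def by (simp add: sum_distrib_left mult.assoc)
  also have "\<dots> \<le> (\<Sum>k<2^j. \<bar>?a * z j k\<bar> * tent (2^j * t - real k))"
    by (rule order_trans[OF sum_abs]) (simp add: abs_mult tent_nonneg)
  also have "\<dots> \<le> (\<Sum>k<2^j. ?l * tent (2^j * t - real k) + (z j k)^4 / (729/250)^j)"
  proof (rule sum_mono)
    fix k
    let ?t = "tent (2^j * t - real k)"
    have "\<bar>?a * z j k\<bar> * ?t \<le> (?l + (?a * z j k)^4 / ?l^3) * ?t"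
      by (intro mult_right_mono abs_le_add_power4_div tent_nonneg) auto
    also have "\<dots> = ?l * ?t + (z j k)^4 / (729/250)^j * ?t"
      unfolding a4 l3 by (simp add: distrib_right)
    also have "\<dots> \<le> ?l * ?t + (z j k)^4 / (729/250)^j * 1"
      by (intro add_left_mono mult_left_mono tent_le_1) auto
    finally show "\<bar>?a * z j k\<bar> * ?t \<le> ?l * ?t + (z j k)^4 / (729/250)^j" by simp
  qed
  also have "\<dots> = ?l * (\<Sum>k<2^j. tent (2^j * t - real k)) + (\<Sum>k<2^j. (z j k)^4) / (729/250)^j"
    by (simp add: sum.distrib sum_distrib_left sum_divide_distrib)
  also have "\<dots> \<le> ?l * 1 + (\<Sum>k<2^j. (z j k)^4) / (729/250)^j"
    by (intro add_right_mono mult_left_mono sum_tent_le_1) auto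
  finally show ?thesis by (simp add: schauder_bound_def)
qed

lemma continuous_on_bridge:
  assumes "summable (schauder_bound z)"
  shows "continuous_on S (bridge z)"
proof -
  have "uniform_limit UNIV (\<lambda>n t. \<Sum>j<n. schauder_level z j t) (\<lambda>t. \<Sum>j. schauder_level z j t) sequentially"
    using assms by (intro Weierstrass_m_test[of _ _ "schauder_bound z"]) (auto simp: abs_schauder_level_le)
  then have "continuous_on UNIV (\<lambda>t. \<Sum>j. schauder_level z j t)"
    by (rule uniform_limit_theorem[rotated])
      (auto intro!: always_eventually continuous_intros simp: schauder_level_def)
  then show ?thesis unfolding bridge_def[abs_def] by (rule continuous_on_subset) simp
qed

lemma bridge_sums:
  assumes "summable (schauder_bound z)"
  shows "(\<lambda>n. \<Sum>j<n. schauder_level z j t) \<longlonglongrightarrow> bridge z t"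
proof -
  have "summable (\<lambda>j. schauder_level z j t)"
    using assms by (rule summable_comparison_test'[where N=0]) (simp add: abs_schauder_level_le)
  then show ?thesis unfolding bridge_def by (rule summable_LIMSEQ)
qed

lemma bridge_0 [simp]: "bridge z 0 = 0" and bridge_1 [simp]: "bridge z 1 = 0"
proof -
  have "schauder_level z j 0 = 0" for j
    by (simp add: schauder_level_def tent_eq_0)
  then show "bridge z 0 = 0" by (simp add: bridge_def)
  have "schauder_level z j 1 = 0" for j
  proof -
    have "tent (2^j - real k) = 0" if "k < 2^j" for k
    proof -
      have "real (Suc k) \<le> real (2^j)" using that by (intro of_nat_mono) auto
      then show ?thesis by (intro tent_eq_0) auto
    qed
    then show ?thesis by (simp add: schauder_level_def)
  qed
  then show "bridge z 1 = 0" by (simp add: bridge_def)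
qed

section \<open>Gaussian noise and the random bridge\<close>

definition gauss_noise :: "(real \<Rightarrow> real) measure" where
  "gauss_noise = PiM UNIV (\<lambda>_. std_normal_distribution)"

text \<open>The limit has to live on a sample space of type \<open>real \<Rightarrow> real\<close>,
  so the noise is indexed by all reals; the doubly indexed coefficients are placed at natural
  numbers by \<open>prod_encode\<close>.\<close>

definition noise_coeff :: "(real \<Rightarrow> real) \<Rightarrow> nat \<Rightarrow> nat \<Rightarrow> real" where
  "noise_coeff z j k = z (real (prod_encode (j, k)))"

lemma prob_space_gauss_noise: "prob_space gauss_noise"
  unfolding gauss_noise_def by (intro prob_space_PiM) (simp add: prob_space_normal_density)

interpretation gauss_noise: prob_space gauss_noise
  by (rule prob_space_gauss_noise)

lemma sets_gauss_noise: "sets gauss_noise = sets (PiM UNIV (\<lambda>_. borel))"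
  unfolding gauss_noise_def by (intro sets_PiM_cong) auto

lemma measurable_gauss_noise_coord [measurable]: "(\<lambda>z. z i) \<in> borel_measurable gauss_noise"
  unfolding measurable_cong_sets[OF sets_gauss_noise refl] by simp

lemma distr_gauss_noise_coord: "distr gauss_noise borel (\<lambda>z. z i) = std_normal_distribution"
proof -
  have "distr gauss_noise std_normal_distribution (\<lambda>z. z i) = std_normal_distribution"
    unfolding gauss_noise_def by (rule distr_PiM_component) (auto simp: prob_space_normal_density)
  moreover have "distr gauss_noise std_normal_distribution (\<lambda>z. z i) = distr gauss_noise borel (\<lambda>z. z i)"
    by (rule distr_cong) auto
  ultimately show ?thesis by simp
qed

lemma indep_vars_gauss_noise: "gauss_noise.indep_vars (\<lambda>_. borel) (\<lambda>i z. z i) UNIV"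
proof (subst gauss_noise.indep_vars_iff_distr_eq_PiM)
  have "distr gauss_noise (PiM UNIV (\<lambda>_. borel)) (\<lambda>z. \<lambda>i\<in>UNIV. z i) = distr gauss_noise gauss_noise (\<lambda>z. z)"
    by (rule distr_cong) (auto simp: sets_gauss_noise)
  also have "\<dots> = gauss_noise" by (simp add: distr_id2)
  also have "\<dots> = PiM UNIV (\<lambda>i. distr gauss_noise borel (\<lambda>z. z i))"
    unfolding distr_gauss_noise_coord by (rule gauss_noise_def)
  finally show "distr gauss_noise (PiM UNIV (\<lambda>_. borel)) (\<lambda>z. \<lambda>i\<in>UNIV. z i)
      = PiM UNIV (\<lambda>i. distr gauss_noise borel (\<lambda>z. z i))" .
qed auto

lemma char_gauss_noise_sum:
  fixes A :: "real set"
  shows "(CLINT z|gauss_noise. iexp (u * (\<Sum>i\<in>A. b i * z i)))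
    = complex_of_real (exp (- (u\<^sup>2 * (\<Sum>i\<in>A. (b i)\<^sup>2)) / 2))"
proof -
  have "gauss_noise.indep_vars (\<lambda>_. borel) (\<lambda>i z. b i * z i) A"
    by (rule gauss_noise.indep_vars_subset[OF _ subset_UNIV])
      (rule gauss_noise.indep_vars_compose2[OF indep_vars_gauss_noise], simp)
  then have "char (distr gauss_noise borel (\<lambda>z. \<Sum>i\<in>A. b i * z i)) u
      = (\<Prod>i\<in>A. char (distr gauss_noise borel (\<lambda>z. b i * z i)) u)"
    by (rule gauss_noise.char_distr_sum)
  also have "\<dots> = (\<Prod>i\<in>A. complex_of_real (exp (- (u\<^sup>2 * (b i)\<^sup>2) / 2)))"
  proof (rule prod.cong[OF refl])
    fix i
    have "distr gauss_noise borel (\<lambda>z. b i * z i) = distr (distr gauss_noise borel (\<lambda>z. z i)) borel (\<lambda>x. b i * x)"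
      by (simp add: distr_distr comp_def)
    then show "char (distr gauss_noise borel (\<lambda>z. b i * z i)) u = complex_of_real (exp (- (u\<^sup>2 * (b i)\<^sup>2) / 2))"
      by (simp add: distr_gauss_noise_coord char_distr_scale_std_normal)
  qed
  also have "\<dots> = complex_of_real (exp (\<Sum>i\<in>A. - (u\<^sup>2 * (b i)\<^sup>2) / 2))"
    by (cases "finite A") (simp_all add: exp_sum)
  also have "(\<Sum>i\<in>A. - (u\<^sup>2 * (b i)\<^sup>2) / 2) = - (u\<^sup>2 * (\<Sum>i\<in>A. (b i)\<^sup>2)) / 2"
    by (simp add: sum_negf sum_distrib_left sum_divide_distrib)
  finally show ?thesis by (simp add: char_def integral_distr)
qed

lemma measurable_noise_coeff [measurable]: "(\<lambda>z. noise_coeff z j k) \<in> borel_measurable gauss_noise"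
  unfolding noise_coeff_def by measurable

lemma measurable_bridge_pair [measurable]:
  assumes [measurable]: "f \<in> gauss_noise \<Otimes>\<^sub>M M \<rightarrow>\<^sub>M borel"
  shows "(\<lambda>p. bridge (noise_coeff (fst p)) (f p)) \<in> borel_measurable (gauss_noise \<Otimes>\<^sub>M M)"
  unfolding bridge_def schauder_level_def by measurable

lemma measurable_bridge [measurable]: "(\<lambda>z. bridge (noise_coeff z) t) \<in> borel_measurable gauss_noise"
  unfolding bridge_def schauder_level_def by measurable

lemma measurable_schauder_bound [measurable]: "(\<lambda>z. schauder_bound (noise_coeff z) j) \<in> borel_measurable gauss_noise"
  unfolding schauder_bound_def by measurable

lemma schauder_bound_nonneg: "0 \<le> schauder_bound z j"
  unfolding schauder_bound_def by (intro add_nonneg_nonneg divide_nonneg_nonneg sum_nonneg) auto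

lemma summable_schauder_bound: "(\<Sum>j. ennreal (schauder_bound z j)) < \<infinity> \<Longrightarrow> summable (schauder_bound z)"
  by (rule summable_suminf_not_top) (auto simp: schauder_bound_nonneg)

text \<open>Each of the \<open>2^j\<close> fourth moments at level \<open>j\<close> equals 3, and
  \<open>2 / (729/250) = 500/729\<close>, so the expectations of the majorants form a convergent
  series.\<close>

lemma AE_suminf_schauder_bound: "AE z in gauss_noise. (\<Sum>j. ennreal (schauder_bound (noise_coeff z) j)) < \<infinity>"
proof -
  have mom: "integrable gauss_noise (\<lambda>z. (z i)^4)" "(\<integral>z. (z i)^4 \<partial>gauss_noise) = 3" for i
  proof -
    have "integrable (distr gauss_noise borel (\<lambda>z. z i)) (\<lambda>x. x^4)"
      unfolding distr_gauss_noise_coord by (rule integrable_std_normal_distribution_moment)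
    then show "integrable gauss_noise (\<lambda>z. (z i)^4)" by (simp add: integrable_distr_eq)
    have "(\<integral>z. (z i)^4 \<partial>gauss_noise) = (\<integral>x. x^4 \<partial>distr gauss_noise borel (\<lambda>z. z i))"
      by (simp add: integral_distr)
    also have "\<dots> = 3"
      unfolding distr_gauss_noise_coord
      using std_normal_distribution_even_moments(1)[of 2] by (simp add: fact_numeral)
    finally show "(\<integral>z. (z i)^4 \<partial>gauss_noise) = 3" .
  qed
  have int: "integrable gauss_noise (\<lambda>z. schauder_bound (noise_coeff z) j)" for j
    unfolding schauder_bound_def noise_coeff_def by (intro Bochner_Integration.integrable_add
        integrable_divide Bochner_Integration.integrable_sum mom gauss_noise.integrable_const)
  have "(\<integral>z. schauder_bound (noise_coeff z) j \<partial>gauss_noise) = (9/10)^j + 3 * (500/729)^j" for j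
  proof -
    have "(\<integral>z. schauder_bound (noise_coeff z) j \<partial>gauss_noise) = (9/10)^j + (\<Sum>k<(2::nat)^j. 3) / (729/250)^j"
      unfolding schauder_bound_def noise_coeff_def
      by (subst Bochner_Integration.integral_add)
        (simp_all add: mom integrable_divide Bochner_Integration.integral_sum gauss_noise.prob_space)
    also have "(\<Sum>k<(2::nat)^j. 3) / (729/250)^j = 3 * ((2::real)^j / (729/250)^j)" by simp
    also have "(2::real)^j / (729/250)^j = (500/729)^j"
      unfolding power_divide[symmetric] by simp
    finally show ?thesis .
  qed
  then have "(\<integral>\<^sup>+z. ennreal (schauder_bound (noise_coeff z) j) \<partial>gauss_noise) = ennreal ((9/10)^j + 3 * (500/729)^j)" for j
    using int schauder_bound_nonneg by (subst nn_integral_eq_integral) auto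
  then have "(\<integral>\<^sup>+z. (\<Sum>j. ennreal (schauder_bound (noise_coeff z) j)) \<partial>gauss_noise)
      = (\<Sum>j. ennreal ((9/10)^j + 3 * (500/729)^j))"
    by (subst nn_integral_suminf) auto
  also have "\<dots> \<noteq> \<infinity>"
    by (subst suminf_ennreal2) (auto intro!: summable_add summable_mult summable_geometric)
  finally have "AE z in gauss_noise. (\<Sum>j. ennreal (schauder_bound (noise_coeff z) j)) \<noteq> \<infinity>"
    by (intro nn_integral_PInf_AE) auto
  then show ?thesis by (simp add: less_top)
qed

declare measurable_gauss_noise_coord [measurable del]

lemma AE_summable_schauder_bound: "AE z in gauss_noise. summable (schauder_bound (noise_coeff z))"
  using AE_suminf_schauder_bound by eventually_elim (rule summable_schauder_bound)

text \<open>The partial sums are finite combinations of independent standard normals, whose variance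
  is a partial sum of the kernels; dominated convergence passes to the limit. The index type is
  arbitrary and times may be repeated, so one statement serves for one, two or finitely many
  points.\<close>

lemma char_bridge:
  assumes I: "finite I" and t: "\<And>i. i \<in> I \<Longrightarrow> 0 \<le> t i \<and> t i \<le> 1"
  shows "(CLINT z|gauss_noise. iexp (u * (\<Sum>i\<in>I. c i * bridge (noise_coeff z) (t i)))) =
    complex_of_real (exp (- (u\<^sup>2 * (\<Sum>i\<in>I. \<Sum>i'\<in>I. c i * c i' * (min (t i) (t i') - t i * t i'))) / 2))"
    (is "?L = complex_of_real (exp (- (u\<^sup>2 * ?v) / 2))")
proof (rule LIMSEQ_unique)
  \<comment> \<open>The noise is indexed by reals, so sums over pairs \<open>(j,k)\<close> are moved
    along this injection; \<open>inv e\<close> recovers the pair.\<close>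
  define e where "e p = real (prod_encode p)" for p
  have inj: "inj_on e A" for A
    unfolding e_def by (rule inj_onI) (use inj_prod_encode in \<open>auto dest: injD\<close>)
  define a where "a p = (\<Sum>i\<in>I. c i * ((1 / sqrt 2)^fst p * tent (2^fst p * t i - real (snd p))))"
    for p :: "nat \<times> nat"
  define A where "A m = (SIGMA j:{..<m}. {..<(2::nat)^j})" for m :: nat
  define S where "S m z = (\<Sum>i\<in>I. c i * (\<Sum>j<m. schauder_level (noise_coeff z) j (t i)))" for m z
  have "S m z = (\<Sum>p\<in>A m. a p * noise_coeff z (fst p) (snd p))" for m z
  proof -
    have "S m z = (\<Sum>i\<in>I. \<Sum>j<m. \<Sum>k<2^j. c i * ((1 / sqrt 2)^j * tent (2^j * t i - real k)) * noise_coeff z j k)"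
      unfolding S_def schauder_level_def by (simp add: sum_distrib_left mult_ac)
    also have "\<dots> = (\<Sum>j<m. \<Sum>k<2^j. \<Sum>i\<in>I. c i * ((1 / sqrt 2)^j * tent (2^j * t i - real k)) * noise_coeff z j k)"
      by (subst sum.swap, rule sum.cong[OF refl], rule sum.swap)
    also have "\<dots> = (\<Sum>j<m. \<Sum>k<2^j. a (j,k) * noise_coeff z j k)"
      unfolding a_def by (simp add: sum_distrib_right)
    finally show ?thesis by (simp add: A_def sum.Sigma split_beta)
  qed
  also have "(\<Sum>p\<in>A m. a p * noise_coeff z (fst p) (snd p)) = (\<Sum>r\<in>e ` A m. a (inv e r) * z r)" for m z
    using inj[of UNIV] by (subst sum.reindex[OF inj]) (simp add: noise_coeff_def e_def[symmetric])
  finally have S: "S m z = (\<Sum>r\<in>e ` A m. a (inv e r) * z r)" for m z .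
  have v: "(\<Sum>r\<in>e ` A m. (a (inv e r))\<^sup>2)
      = (\<Sum>i\<in>I. \<Sum>i'\<in>I. c i * c i' * (\<Sum>j<m. schauder_kernel j (t i) (t i')))" for m
  proof -
    have half: "(1 / sqrt 2)^j * (1 / sqrt 2)^j = (1/2 :: real)^j" for j
      by (simp flip: power_mult_distrib)
    have "(\<Sum>r\<in>e ` A m. (a (inv e r))\<^sup>2) = (\<Sum>p\<in>A m. (a p)\<^sup>2)"
      using inj[of UNIV] by (subst sum.reindex[OF inj]) simp
    also have "\<dots> = (\<Sum>j<m. \<Sum>k<2^j. (a (j,k))\<^sup>2)"
      by (simp add: A_def sum.Sigma split_beta)
    also have "\<dots> = (\<Sum>j<m. \<Sum>k<2^j. \<Sum>i\<in>I. \<Sum>i'\<in>I. c i * c i' * ((1/2)^j *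
        (tent (2^j * t i - real k) * tent (2^j * t i' - real k))))"
      unfolding a_def power2_eq_square sum_product half[symmetric] by (simp add: mult_ac)
    also have "\<dots> = (\<Sum>j<m. \<Sum>i\<in>I. \<Sum>i'\<in>I. c i * c i' * schauder_kernel j (t i) (t i'))"
      unfolding schauder_kernel_def sum_distrib_left
      by (rule sum.cong[OF refl], subst sum.swap, rule sum.cong[OF refl], rule sum.swap)
    also have "\<dots> = (\<Sum>i\<in>I. \<Sum>i'\<in>I. c i * c i' * (\<Sum>j<m. schauder_kernel j (t i) (t i')))"
      unfolding sum_distrib_left
      by (subst sum.swap, rule sum.cong[OF refl], rule sum.swap)
    finally show ?thesis .
  qed
  show "(\<lambda>m. CLINT z|gauss_noise. iexp (u * S m z)) \<longlonglongrightarrow> complex_of_real (exp (- (u\<^sup>2 * ?v) / 2))"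
    unfolding S char_gauss_noise_sum v
    using sums_schauder_kernel[unfolded sums_def] t
    by (intro tendsto_of_real tendsto_exp tendsto_intros) auto
  show "(\<lambda>m. CLINT z|gauss_noise. iexp (u * S m z)) \<longlonglongrightarrow> ?L"
  proof (rule integral_dominated_convergence[where w="\<lambda>_. 1"])
    show "(\<lambda>z. iexp (u * S m z)) \<in> borel_measurable gauss_noise" for m
      unfolding S_def schauder_level_def by measurable
    show "AE z in gauss_noise. (\<lambda>m. iexp (u * S m z)) \<longlonglongrightarrow> iexp (u * (\<Sum>i\<in>I. c i * bridge (noise_coeff z) (t i)))"
      using AE_summable_schauder_bound
    proof eventually_elim
      case (elim z)
      show ?case unfolding S_def by (intro tendsto_intros bridge_sums elim)
    qed
  qed auto
qed

lemma bridge_moments: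
  assumes t: "0 \<le> t" "t \<le> 1"
  shows "(\<integral>z. bridge (noise_coeff z) t \<partial>gauss_noise) = 0"
    "integrable gauss_noise (\<lambda>z. bridge (noise_coeff z) t)"
    "integrable gauss_noise (\<lambda>z. (bridge (noise_coeff z) t)\<^sup>2)"
    "(\<integral>z. (bridge (noise_coeff z) t)\<^sup>2 \<partial>gauss_noise) = t * (1 - t)"
    "(\<integral>z. \<bar>bridge (noise_coeff z) t\<bar> \<partial>gauss_noise) \<le> sqrt (t * (1 - t))"
proof -
  have c: "(CLINT z|gauss_noise. iexp (u * bridge (noise_coeff z) t)) = complex_of_real (exp (- (u\<^sup>2 * (t * (1 - t))) / 2))" for u
    using char_bridge[of "{()}" "\<lambda>_. t" u "\<lambda>_. 1"] t by (simp add: right_diff_distrib)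
  note n = normal_if_char[OF prob_space_gauss_noise measurable_bridge c]
  show "(\<integral>z. bridge (noise_coeff z) t \<partial>gauss_noise) = 0"
    "integrable gauss_noise (\<lambda>z. bridge (noise_coeff z) t)"
    "integrable gauss_noise (\<lambda>z. (bridge (noise_coeff z) t)\<^sup>2)"
    "(\<integral>z. (bridge (noise_coeff z) t)\<^sup>2 \<partial>gauss_noise) = t * (1 - t)"
    by (fact n)+
  \<comment> \<open>Nonnegativity of the variance of the absolute value bounds its mean by the root
    of the second moment.\<close>
  have "0 \<le> gauss_noise.variance (\<lambda>z. \<bar>bridge (noise_coeff z) t\<bar>)" by (rule gauss_noise.variance_positive)
  also have "\<dots> = (\<integral>z. \<bar>bridge (noise_coeff z) t\<bar>\<^sup>2 \<partial>gauss_noise) - (\<integral>z. \<bar>bridge (noise_coeff z) t\<bar> \<partial>gauss_noise)\<^sup>2"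
    using n by (intro gauss_noise.variance_eq) auto
  finally show "(\<integral>z. \<bar>bridge (noise_coeff z) t\<bar> \<partial>gauss_noise) \<le> sqrt (t * (1 - t))"
    using n(4) by (intro real_le_rsqrt) simp
qed

text \<open>Polarisation: the variance of the sum of the two values is known from its characteristic
  function, and so are the two single variances.\<close>

lemma bridge_covariance:
  assumes s: "0 \<le> s" "s \<le> 1" and t: "0 \<le> t" "t \<le> 1"
  shows "(\<integral>z. bridge (noise_coeff z) s * bridge (noise_coeff z) t \<partial>gauss_noise) = min s t - s * t"
proof -
  let ?B = "\<lambda>z t. bridge (noise_coeff z) t"
  have c: "(CLINT z|gauss_noise. iexp (u * (?B z s + ?B z t)))
      = complex_of_real (exp (- (u\<^sup>2 * (s * (1 - s) + t * (1 - t) + 2 * (min s t - s * t))) / 2))" for u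
    using char_bridge[of UNIV "\<lambda>b. if b then s else t" u "\<lambda>_. 1"] s t
    by (simp add: UNIV_bool min.commute[of t s] algebra_simps)
  have n: "integrable gauss_noise (\<lambda>z. (?B z s + ?B z t)\<^sup>2)"
    "(\<integral>z. (?B z s + ?B z t)\<^sup>2 \<partial>gauss_noise) = s * (1 - s) + t * (1 - t) + 2 * (min s t - s * t)"
    using normal_if_char(3,4)[OF prob_space_gauss_noise _ c] by auto
  have eq: "?B z s * ?B z t = ((?B z s + ?B z t)\<^sup>2 - (?B z s)\<^sup>2 - (?B z t)\<^sup>2) / 2" for z
    by (simp add: power2_eq_square algebra_simps)
  have "(\<integral>z. ?B z s * ?B z t \<partial>gauss_noise)
      = (s * (1 - s) + t * (1 - t) + 2 * (min s t - s * t) - s * (1 - s) - t * (1 - t)) / 2"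
    unfolding eq using n bridge_moments(3,4)[OF s] bridge_moments(3,4)[OF t] by simp
  then show ?thesis by simp
qed

subsection \<open>Quantiles and oscillations of the empirical process\<close>

text \<open>This is the half-line up to the smallest \<open>t\<close>-quantile, or everything if \<open>F\<close> never reaches \<open>t\<close>;
  defining it as a set avoids infinite quantiles.\<close>

definition quantile_set :: "real measure \<Rightarrow> real \<Rightarrow> real set" where
  "quantile_set F t = {y. \<forall>z. t \<le> cdf F z \<longrightarrow> y \<le> z}"

lemma sets_quantile_set [measurable]: "quantile_set F t \<in> sets borel"
proof -
  have "quantile_set F t = (\<Inter>z\<in>{z. t \<le> cdf F z}. {..z})" by (auto simp: quantile_set_def)
  then have "closed (quantile_set F t)" by (auto intro: closed_INT)
  then show ?thesis by simp
qed

lemma quantile_set_mono: "s \<le> t \<Longrightarrow> quantile_set F s \<subseteq> quantile_set F t"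
  unfolding quantile_set_def by (auto intro: order_trans)

lemma quantile_set_subset_atMost: "t \<le> cdf F x \<Longrightarrow> quantile_set F t \<subseteq> {..x}"
  unfolding quantile_set_def by auto

lemma quantile_set_down: "\<lbrakk>y \<in> quantile_set F t; x \<le> y\<rbrakk> \<Longrightarrow> x \<in> quantile_set F t"
  unfolding quantile_set_def by (auto intro: order_trans)

section \<open>Probabilities of quantile sets and of cells\<close>

context real_distribution
begin

lemma borel_measurable_cdf [measurable]: "cdf M \<in> borel_measurable borel"
  by (rule borel_measurable_mono) (auto intro: monoI cdf_nondecreasing)

lemma quantile_set_0: "quantile_set M 0 = {}"
proof -
  have "y \<notin> quantile_set M 0" for y
    unfolding quantile_set_def using cdf_nonneg[of "y - 1"] by (auto intro!: exI[of _ "y - 1"])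
  then show ?thesis by auto
qed

text \<open>By right continuity \<open>cdf M\<close> is at least \<open>t\<close> at the infimum of
  the points where it is at least \<open>t\<close>, and the quantile set contains the closed
  half-line up to there. If there are no such points, the quantile set is the whole line and
  \<open>t \<le> 1\<close> settles the claim.\<close>

lemma prob_quantile_set_ge:
  assumes "t \<le> 1"
  shows "t \<le> prob (quantile_set M t)"
proof (cases "t \<le> 0")
  case True
  then show ?thesis by (rule order_trans) simp
next
  case False
  let ?Z = "{z. t \<le> cdf M z}"
  show ?thesis
  proof (cases "?Z = {}")
    case True
    then have "quantile_set M t = space M" by (auto simp: quantile_set_def)
    then show ?thesis using assms prob_space by simp
  next
    case Z: False
    have "\<forall>\<^sub>F x in at_bot. cdf M x < t"
      using order_tendstoD(2)[OF cdf_lim_at_bot] False by simp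
    then obtain z0 where z0: "\<And>x. x \<le> z0 \<Longrightarrow> cdf M x < t"
      by (auto simp: eventually_at_bot_linorder)
    have lb: "z0 \<le> z" if "z \<in> ?Z" for z using z0[of z] that by force
    define c where "c = Inf ?Z"
    have c: "c \<le> z" if "z \<in> ?Z" for z
      unfolding c_def using that lb by (intro cInf_lower bdd_belowI[of _ z0]) auto
    have "t \<le> cdf M c"
    proof (rule ccontr)
      assume n: "\<not> t \<le> cdf M c"
      have "(cdf M \<longlongrightarrow> cdf M c) (at_right c)"
        using cdf_is_right_cont[of c] by (simp add: continuous_within)
      from order_tendstoD(2)[OF this, of t] n
      obtain b where b: "b > c" "\<And>y. \<lbrakk>c < y; y < b\<rbrakk> \<Longrightarrow> cdf M y < t"
        by (auto simp: eventually_at_right_field)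
      have "b \<le> c" unfolding c_def
      proof (rule cInf_greatest[OF Z])
        fix z assume z: "z \<in> ?Z"
        show "b \<le> z"
        proof (rule ccontr)
          assume "\<not> b \<le> z"
          then show False using b(2)[of z] c[OF z] z n by (cases "z = c") auto
        qed
      qed
      with b(1) show False by simp
    qed
    also have "cdf M c \<le> prob (quantile_set M t)"
      unfolding cdf_def
    proof (rule finite_measure_mono)
      show "{..c} \<subseteq> quantile_set M t" using c by (fastforce simp: quantile_set_def intro: order_trans)
    qed simp
    finally show ?thesis .
  qed
qed

text \<open>The set is a half-line. If it contains its supremum \<open>c\<close>, its probability is
  at most \<open>cdf M c < s\<close>; otherwise it is at most the left limit of \<open>cdf M\<close>
  at \<open>c\<close>, so that a jump at \<open>c\<close> is not counted.\<close>

lemma prob_cdf_less_le: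
  assumes "0 \<le> s"
  shows "prob {y. cdf M y < s} \<le> s"
proof -
  let ?A = "{y. cdf M y < s}"
  show ?thesis
  proof (cases "bdd_above ?A \<and> ?A \<noteq> {}")
    case False
    show ?thesis
    proof (cases "?A = {}")
      case True
      then show ?thesis using assms by simp
    next
      case ne: False
      then have nb: "\<not> bdd_above ?A" using False by simp
      have "cdf M x \<le> s" for x
      proof -
        obtain y where "y \<in> ?A" "x < y" using nb unfolding bdd_above_def by (meson not_le)
        then show ?thesis using cdf_nondecreasing[of x y] by auto
      qed
      then have "1 \<le> s" by (intro tendsto_upperbound[OF cdf_lim_at_top_prob]) auto
      then show ?thesis using prob_le_1 order_trans by blast
    qed
  next
    case True
    define c where "c = Sup ?A"
    have ub: "y \<le> c" if "y \<in> ?A" for y unfolding c_def using that True by (intro cSup_upper) auto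
    show ?thesis
    proof (cases "c \<in> ?A")
      case c: True
      have "prob ?A \<le> cdf M c" unfolding cdf_def2[of M c]
      proof (rule finite_measure_mono)
        show "?A \<subseteq> {..c}" using ub by auto
      qed simp
      then show ?thesis using c by simp
    next
      case c: False
      have "?A \<subseteq> {..<c}" using ub c by (auto simp: less_le)
      then have "prob ?A \<le> prob {..<c}" by (intro finite_measure_mono) auto
      also have "\<dots> \<le> s"
      proof (rule tendsto_upperbound[OF cdf_at_left[of c]])
        show "\<forall>\<^sub>F y in at_left c. cdf M y \<le> s"
          unfolding eventually_at_left_field
        proof (intro exI[of _ "c - 1"] conjI allI impI)
          fix y assume y: "y < c"
          then obtain z where "z \<in> ?A" "y < z"
            using less_cSup_iff[of ?A y] True unfolding c_def by auto
          then show "cdf M y \<le> s" using cdf_nondecreasing[of y z] by auto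
        qed simp
      qed simp
      finally show ?thesis .
    qed
  qed
qed

text \<open>Jumps do no harm: an atom at the \<open>t\<close>-quantile lies in the quantile set, and
  an atom at which \<open>cdf M\<close> reaches \<open>s\<close> lies outside
  \<open>{y. cdf M y < s}\<close>, so the cell contains neither.\<close>

lemma prob_cell_le:
  assumes "0 \<le> t" "t \<le> s" "t \<le> 1"
  shows "prob ({y. cdf M y < s} - quantile_set M t) \<le> s - t"
proof (cases "quantile_set M t \<subseteq> {y. cdf M y < s}")
  case True
  then have "prob ({y. cdf M y < s} - quantile_set M t) = prob {y. cdf M y < s} - prob (quantile_set M t)"
    by (intro finite_measure_Diff) auto
  also have "\<dots> \<le> s - t"
    using prob_cdf_less_le[of s] prob_quantile_set_ge[of t] assms by simp
  finally show ?thesis .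
next
  \<comment> \<open>Both sets are half-lines; if the quantile set is not contained in the other one,
    it contains it, and the cell is empty.\<close>
  case False
  then obtain y where y: "y \<in> quantile_set M t" "\<not> cdf M y < s" by auto
  have "x \<in> quantile_set M t" if "cdf M x < s" for x
  proof (rule quantile_set_down[OF y(1)], rule ccontr)
    assume "\<not> x \<le> y"
    then have "cdf M y \<le> cdf M x" by (intro cdf_nondecreasing) auto
    with that y(2) show False by simp
  qed
  then have "{y. cdf M y < s} - quantile_set M t = {}" by auto
  then show ?thesis using assms by (simp only: measure_empty)
qed

end

section \<open>Moments and a central limit theorem for an i.i.d. sample\<close>

locale iid_sample = F: real_distribution F + P: prob_space M
  for F :: "real measure" and M :: "'w measure" +
  fixes X :: "nat \<Rightarrow> 'w \<Rightarrow> real"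
  assumes indep: "P.indep_vars (\<lambda>_. borel) X UNIV"
    and distr_X: "\<And>i. distr M borel (X i) = F"
begin

lemma measurable_X [measurable]: "X i \<in> borel_measurable M"
  using indep unfolding P.indep_vars_def by auto

lemma integral_X:
  fixes f :: "real \<Rightarrow> 'b::{banach, second_countable_topology}"
  assumes [measurable]: "f \<in> borel_measurable borel"
  shows "(\<integral>\<omega>. f (X i \<omega>) \<partial>M) = (\<integral>x. f x \<partial>F)"
  using integral_distr[of "X i" M borel f] by (simp add: distr_X)

lemma indep_f:
  assumes [measurable]: "f \<in> borel_measurable borel"
  shows "P.indep_vars (\<lambda>_. borel) (\<lambda>i \<omega>. f (X i \<omega>)) UNIV"
  by (rule P.indep_vars_compose2[OF indep]) simp

text \<open>Induction on \<open>n\<close>: in the expansion of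
  \<open>(S n \<omega> + f (X n \<omega>))^4\<close> independence and the zero means remove the
  terms of odd degree in \<open>f\<close>, the middle term gives \<open>6 * n * v\<^sup>2\<close>,
  and the fourth moment of \<open>f\<close> is at most \<open>v\<close> because \<open>f\<close> is
  bounded by 1. The square of \<open>v\<close> in the main term is what makes sets of small
  probability contribute little.\<close>

lemma moments_sum:
  fixes f :: "real \<Rightarrow> real"
  assumes f[measurable]: "f \<in> borel_measurable borel" and f1: "\<And>x. \<bar>f x\<bar> \<le> 1"
    and mean: "(\<integral>x. f x \<partial>F) = 0"
  defines "S n \<omega> \<equiv> \<Sum>i<n. f (X i \<omega>)" and "v \<equiv> \<integral>x. (f x)\<^sup>2 \<partial>F"
  shows "\<And>n k. integrable M (\<lambda>\<omega>. (S n \<omega>)^k)" "\<And>n. (\<integral>\<omega>. (S n \<omega>)\<^sup>2 \<partial>M) = real n * v"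
    "\<And>n. (\<integral>\<omega>. (S n \<omega>)^4 \<partial>M) \<le> real n * v + 3 * (real n)\<^sup>2 * v\<^sup>2"
proof -
  have [measurable]: "S n \<in> borel_measurable M" for n unfolding S_def by measurable
  have Sb: "\<bar>S n \<omega>\<bar> \<le> real n" for n \<omega>
  proof -
    have "\<bar>S n \<omega>\<bar> \<le> (\<Sum>i<n. \<bar>f (X i \<omega>)\<bar>)" unfolding S_def by (rule sum_abs)
    also have "\<dots> \<le> (\<Sum>i<n. 1)" by (intro sum_mono f1)
    finally show ?thesis by simp
  qed
  show iS: "integrable M (\<lambda>\<omega>. (S n \<omega>)^k)" for n k
  proof (rule P.integrable_const_bound[where B="real n ^ k"])
    show "AE \<omega> in M. norm ((S n \<omega>)^k) \<le> real n ^ k"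
      using Sb by (auto simp: power_abs intro!: power_mono)
  qed simp
  have ifk: "integrable M (\<lambda>\<omega>. (f (X i \<omega>))^k)" for i k
    using f1 by (intro P.integrable_const_bound[where B=1]) (auto simp: power_abs intro!: power_le_one)
  have iprod: "integrable M (\<lambda>\<omega>. (S n \<omega>)^k * (f (X n \<omega>))^l)" for n k l
    using Sb f1 by (intro P.integrable_const_bound[where B="real n ^ k * 1"])
      (auto simp: abs_mult power_abs simp del: mult_1_right intro!: mult_mono power_mono power_le_one)
  have prod: "(\<integral>\<omega>. (S n \<omega>)^k * (f (X n \<omega>))^l \<partial>M) = (\<integral>\<omega>. (S n \<omega>)^k \<partial>M) * (\<integral>x. (f x)^l \<partial>F)" for n k l
  proof -
    have "P.indep_var borel (\<lambda>\<omega>. f (X n \<omega>)) borel (\<lambda>\<omega>. \<Sum>i<n. f (X i \<omega>))"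
      by (rule P.indep_vars_sum[OF _ _ P.indep_vars_subset[OF indep_f[OF f]]]) auto
    then have "P.indep_var borel ((\<lambda>x. x^l) \<circ> (\<lambda>\<omega>. f (X n \<omega>))) borel ((\<lambda>x. x^k) \<circ> S n)"
      unfolding S_def by (rule P.indep_var_compose) auto
    then have "(\<integral>\<omega>. (f (X n \<omega>))^l * (S n \<omega>)^k \<partial>M) = (\<integral>\<omega>. (f (X n \<omega>))^l \<partial>M) * (\<integral>\<omega>. (S n \<omega>)^k \<partial>M)"
      unfolding comp_def by (intro P.indep_var_lebesgue_integral ifk iS)
    then show ?thesis using integral_X[of "\<lambda>x. (f x)^l" n] by (simp add: mult.commute)
  qed
  have m1: "(\<integral>\<omega>. (S n \<omega>)^k * f (X n \<omega>) \<partial>M) = 0" for n k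
    using prod[of n k 1] mean by simp
  have S_Suc: "S (Suc n) \<omega> = S n \<omega> + f (X n \<omega>)" for n \<omega> by (simp add: S_def)
  have S1: "(\<integral>\<omega>. S n \<omega> \<partial>M) = 0" for n
    unfolding S_def using ifk[of _ 1] integral_X[OF f] mean
    by (subst Bochner_Integration.integral_sum) auto
  show S2: "(\<integral>\<omega>. (S n \<omega>)\<^sup>2 \<partial>M) = real n * v" for n
  proof (induction n)
    case (Suc n)
    have "(\<integral>\<omega>. (S (Suc n) \<omega>)\<^sup>2 \<partial>M)
        = (\<integral>\<omega>. (S n \<omega>)^2 + 2 * ((S n \<omega>)^1 * (f (X n \<omega>))^1) + (f (X n \<omega>))^2 \<partial>M)"
      unfolding S_Suc by (simp add: power2_eq_square algebra_simps)
    also have "\<dots> = (\<integral>\<omega>. (S n \<omega>)^2 \<partial>M) + 2 * (\<integral>\<omega>. (S n \<omega>)^1 * (f (X n \<omega>))^1 \<partial>M) + (\<integral>\<omega>. (f (X n \<omega>))^2 \<partial>M)"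
      using iS ifk iprod[of n 1 1] by simp
    also have "\<dots> = real (Suc n) * v"
      using Suc prod[of n 1 1] mean integral_X[of "\<lambda>x. (f x)^2" n] by (simp add: v_def algebra_simps)
    finally show ?case .
  qed (simp add: S_def)
  have v0: "0 \<le> v" unfolding v_def by (rule Bochner_Integration.integral_nonneg) simp
  have f4: "(\<integral>x. (f x)^4 \<partial>F) \<le> v"
    unfolding v_def
  proof (rule integral_mono)
    have "integrable F (\<lambda>x. (f x)^k)" for k
      using f1 by (intro F.integrable_const_bound[where B=1]) (auto simp: power_abs intro!: power_le_one)
    then show "integrable F (\<lambda>x. (f x)^4)" "integrable F (\<lambda>x. (f x)\<^sup>2)" by auto
    fix x
    have "\<bar>f x\<bar>^4 \<le> \<bar>f x\<bar>^2" using f1 by (intro power_decreasing) auto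
    then show "(f x)^4 \<le> (f x)\<^sup>2" by (simp add: power_even_abs)
  qed
  show "(\<integral>\<omega>. (S n \<omega>)^4 \<partial>M) \<le> real n * v + 3 * (real n)\<^sup>2 * v\<^sup>2" for n
  proof (induction n)
    case (Suc n)
    have "(\<integral>\<omega>. (S (Suc n) \<omega>)^4 \<partial>M)
        = (\<integral>\<omega>. (S n \<omega>)^4 + 4 * ((S n \<omega>)^3 * (f (X n \<omega>))^1) + 6 * ((S n \<omega>)^2 * (f (X n \<omega>))^2)
           + 4 * ((S n \<omega>)^1 * (f (X n \<omega>))^3) + (f (X n \<omega>))^4 \<partial>M)"
      unfolding S_Suc by (simp add: power4_eq_xxxx power3_eq_cube power2_eq_square algebra_simps)
    also have "\<dots> = (\<integral>\<omega>. (S n \<omega>)^4 \<partial>M) + 4 * (\<integral>\<omega>. (S n \<omega>)^3 * (f (X n \<omega>))^1 \<partial>M)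
        + 6 * (\<integral>\<omega>. (S n \<omega>)^2 * (f (X n \<omega>))^2 \<partial>M) + 4 * (\<integral>\<omega>. (S n \<omega>)^1 * (f (X n \<omega>))^3 \<partial>M)
        + (\<integral>\<omega>. (f (X n \<omega>))^4 \<partial>M)"
      using iS ifk iprod[of n 3 1] iprod[of n 1 3] iprod[of n 2 2] by simp
    also have "\<dots> = (\<integral>\<omega>. (S n \<omega>)^4 \<partial>M) + 6 * (real n * v * v) + (\<integral>x. (f x)^4 \<partial>F)"
      unfolding prod using mean S1 S2 integral_X[of "\<lambda>x. (f x)^4" n] by (simp add: v_def)
    also have "\<dots> \<le> (real n * v + 3 * (real n)\<^sup>2 * v\<^sup>2) + 6 * (real n * v * v) + v"
      using Suc f4 by simp
    also have "\<dots> \<le> real (Suc n) * v + 3 * (real (Suc n))\<^sup>2 * v\<^sup>2"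
      by (simp add: power2_eq_square algebra_simps)
    finally show ?case .
  qed (simp add: S_def)
qed

text \<open>Zero variance is a case of its own, since the central limit theorem normalises by the
  standard deviation; there all summands vanish almost surely. Otherwise evaluating the
  characteristic function at the standard deviation undoes that normalisation.\<close>

lemma CLT_iexp:
  fixes f :: "real \<Rightarrow> real"
  assumes f[measurable]: "f \<in> borel_measurable borel" and fB: "\<And>x. \<bar>f x\<bar> \<le> B"
    and mean: "(\<integral>x. f x \<partial>F) = 0"
  shows "(\<lambda>n. CLINT \<omega>|M. iexp ((\<Sum>i<n. f (X i \<omega>)) / sqrt (real n)))
    \<longlonglongrightarrow> complex_of_real (exp (- (\<integral>x. (f x)\<^sup>2 \<partial>F) / 2))"
proof (cases "(\<integral>x. (f x)\<^sup>2 \<partial>F) = 0")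
  case True
  have B: "0 \<le> B" using fB[of 0] by linarith
  have i2: "integrable F (\<lambda>x. (f x)\<^sup>2)"
  proof (rule F.integrable_const_bound[where B="B\<^sup>2"])
    show "AE x in F. norm ((f x)\<^sup>2) \<le> B\<^sup>2" using fB B by (auto intro!: AE_I2 abs_le_square_iff[THEN iffD1])
  qed simp
  then have "AE x in F. (f x)\<^sup>2 = 0" using True by (subst (asm) integral_nonneg_eq_0_iff_AE) auto
  then have "AE x in F. f x = 0" by simp
  then have "AE \<omega> in M. f (X i \<omega>) = 0" for i
    unfolding distr_X[of i, symmetric] by (subst (asm) AE_distr_iff) auto
  then have "AE \<omega> in M. \<forall>i. f (X i \<omega>) = 0" by (simp add: AE_all_countable)
  then have "(CLINT \<omega>|M. iexp ((\<Sum>i<n. f (X i \<omega>)) / sqrt (real n))) = (CLINT \<omega>|M. 1)" for n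
    by (intro integral_cong_AE) (auto elim!: eventually_mono)
  then show ?thesis using True by (simp add: P.prob_space)
next
  case False
  define \<sigma> where "\<sigma> = sqrt (\<integral>x. (f x)\<^sup>2 \<partial>F)"
  have "0 \<le> (\<integral>x. (f x)\<^sup>2 \<partial>F)" by (rule Bochner_Integration.integral_nonneg) simp
  with False have s: "\<sigma> > 0" "\<sigma>\<^sup>2 = (\<integral>x. (f x)\<^sup>2 \<partial>F)" by (auto simp: \<sigma>_def less_le)
  have B: "0 \<le> B" using fB[of 0] by linarith
  have m0: "(\<integral>\<omega>. f (X i \<omega>) \<partial>M) = 0" for i using integral_X[OF f] mean by simp
  have weak: "weak_conv_m (\<lambda>n. distr M borel (\<lambda>\<omega>. (\<Sum>i<n. f (X i \<omega>)) / sqrt (real n * \<sigma>\<^sup>2))) std_normal_distribution"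
  proof (rule P.central_limit_theorem_zero_mean)
    show "P.indep_vars (\<lambda>i. borel) (\<lambda>i \<omega>. f (X i \<omega>)) UNIV" by (rule indep_f[OF f])
    show "P.expectation (\<lambda>\<omega>. f (X n \<omega>)) = 0" for n by (rule m0)
    show "integrable M (\<lambda>\<omega>. (f (X n \<omega>))\<^sup>2)" for n
    proof (rule P.integrable_const_bound[where B="B\<^sup>2"])
      show "AE \<omega> in M. norm ((f (X n \<omega>))\<^sup>2) \<le> B\<^sup>2"
        using fB B by (auto intro!: AE_I2 abs_le_square_iff[THEN iffD1])
    qed simp
    show "P.variance (\<lambda>\<omega>. f (X n \<omega>)) = \<sigma>\<^sup>2" for n
      unfolding m0 s(2) using integral_X[of "\<lambda>x. (f x)\<^sup>2" n] by simp
    show "distr M borel (\<lambda>\<omega>. f (X n \<omega>)) = distr F borel f" for n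
      using distr_distr[of f borel borel "X n" M] by (simp add: distr_X comp_def)
  qed fact
  have "(\<lambda>n. char (distr M borel (\<lambda>\<omega>. (\<Sum>i<n. f (X i \<omega>)) / sqrt (real n * \<sigma>\<^sup>2))) \<sigma>) \<longlonglongrightarrow> char std_normal_distribution \<sigma>"
    by (rule levy_continuity1[OF _ real_dist_normal_dist weak]) (intro P.real_distribution_distr, simp)
  moreover have "char (distr M borel (\<lambda>\<omega>. (\<Sum>i<n. f (X i \<omega>)) / sqrt (real n * \<sigma>\<^sup>2))) \<sigma>
      = (CLINT \<omega>|M. iexp ((\<Sum>i<n. f (X i \<omega>)) / sqrt (real n)))" for n
    using s(1) by (simp add: char_def integral_distr real_sqrt_mult)
  ultimately show ?thesis by (simp add: char_std_normal_distribution s(2))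
qed

text \<open>Indexing by sets turns increments of the process into values at differences of sets. For
  \<open>n = 0\<close> the value is 0, in agreement with \<open>empirical_process\<close>.\<close>

definition emp :: "nat \<Rightarrow> real set \<Rightarrow> 'w \<Rightarrow> real" where
  "emp n C \<omega> = (\<Sum>i<n. indicator C (X i \<omega>) - F.prob C) / sqrt (real n)"

lemma measurable_emp [measurable]:
  assumes [measurable]: "C \<in> sets borel"
  shows "emp n C \<in> borel_measurable M"
  unfolding emp_def by measurable

lemma emp_eq: "emp n C \<omega> = (\<Sum>i<n. indicator C (X i \<omega>)) / sqrt (real n) - sqrt (real n) * F.prob C"
proof -
  have "real n * F.prob C / sqrt (real n) = (real n / sqrt (real n)) * F.prob C" by simp
  also have "real n / sqrt (real n) = sqrt (real n)" by (rule real_div_sqrt) simp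
  finally show ?thesis by (simp add: emp_def sum_subtractf diff_divide_distrib)
qed

lemma empirical_process_eq_emp: "empirical_process F X n \<omega> x = emp n {..x} \<omega>"
proof -
  have "sqrt (real n) * (1 / real n * S) = S / sqrt (real n)" for S
    by (cases "n = 0") (simp_all add: field_simps)
  then show ?thesis
    by (simp add: empirical_process_def empirical_cdf_def emp_eq cdf_def right_diff_distrib)
qed

lemma emp_empty [simp]: "emp n {} \<omega> = 0"
  by (simp add: emp_def)

lemma emp_Diff:
  assumes "C \<subseteq> D" "C \<in> sets borel" "D \<in> sets borel"
  shows "emp n (D - C) \<omega> = emp n D \<omega> - emp n C \<omega>"
proof -
  have "F.prob (D - C) = F.prob D - F.prob C" using assms by (intro F.finite_measure_Diff) auto
  moreover have "indicator (D - C) x = indicator D x - (indicator C x :: real)" for x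
    using assms(1) by (auto simp: indicator_def)
  ultimately show ?thesis
    by (simp add: emp_def sum_subtractf diff_divide_distrib[symmetric] right_diff_distrib)
qed

text \<open>The counting part is monotone in the set, so only the centring has to be paid for.
  Finitely many sets \<open>D\<close> thus control uncountably many sets \<open>C\<close> inside
  them.\<close>

lemma abs_emp_subset_le:
  assumes "C \<subseteq> D" "C \<in> sets borel" "D \<in> sets borel"
  shows "\<bar>emp n C \<omega>\<bar> \<le> \<bar>emp n D \<omega>\<bar> + sqrt (real n) * F.prob D"
proof -
  have p: "F.prob C \<le> F.prob D" using assms by (intro F.finite_measure_mono) auto
  have "(\<Sum>i<n. indicator C (X i \<omega>)) \<le> (\<Sum>i<n. indicator D (X i \<omega>) :: real)"
    using assms(1) by (intro sum_mono) (auto simp: indicator_def)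
  then have "(\<Sum>i<n. indicator C (X i \<omega>)) / sqrt (real n) \<le> (\<Sum>i<n. indicator D (X i \<omega>)) / sqrt (real n)"
    by (rule divide_right_mono) simp
  moreover have "sqrt (real n) * F.prob C \<le> sqrt (real n) * F.prob D" using p by (intro mult_left_mono) auto
  moreover have "0 \<le> (\<Sum>i<n. indicator C (X i \<omega>)) / sqrt (real n)" "0 \<le> sqrt (real n) * F.prob C"
    by (auto intro!: divide_nonneg_nonneg sum_nonneg)
  ultimately show ?thesis unfolding emp_eq by linarith
qed

lemma centred_indicator:
  assumes C[measurable]: "C \<in> sets borel"
  shows "(\<integral>x. indicator C x - F.prob C \<partial>F) = 0"
    "(\<integral>x. (indicator C x - F.prob C)\<^sup>2 \<partial>F) = F.prob C * (1 - F.prob C)"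
    "\<And>x. \<bar>indicator C x - F.prob C\<bar> \<le> 1"
proof -
  have [simp]: "integrable F (indicator C :: real \<Rightarrow> real)"
    by (intro F.integrable_const_bound[where B=1]) (auto simp: indicator_def)
  have one [simp]: "F.prob UNIV = 1" using F.prob_space by simp
  show "(\<integral>x. indicator C x - F.prob C \<partial>F) = 0"
    by simp
  have sq: "(indicator C x - F.prob C)\<^sup>2 = indicator C x * (1 - 2 * F.prob C) + (F.prob C)\<^sup>2" for x :: real
    by (auto simp: indicator_def power2_eq_square algebra_simps)
  have "(\<integral>x. (indicator C x - F.prob C)\<^sup>2 \<partial>F) = F.prob C * (1 - 2 * F.prob C) + (F.prob C)\<^sup>2"
    unfolding sq by (subst Bochner_Integration.integral_add) auto
  then show "(\<integral>x. (indicator C x - F.prob C)\<^sup>2 \<partial>F) = F.prob C * (1 - F.prob C)"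
    by (simp add: power2_eq_square algebra_simps)
  show "\<bar>indicator C x - F.prob C\<bar> \<le> 1" for x :: real
    using F.prob_le_1[of C] measure_nonneg[of F C] by (auto simp: indicator_def)
qed

lemma emp_moments:
  assumes C[measurable]: "C \<in> sets borel" and n: "n > 0"
  shows "\<And>k. integrable M (\<lambda>\<omega>. (emp n C \<omega>)^k)"
    "(\<integral>\<omega>. (emp n C \<omega>)\<^sup>2 \<partial>M) = F.prob C * (1 - F.prob C)"
    "(\<integral>\<omega>. (emp n C \<omega>)^4 \<partial>M) \<le> F.prob C / real n + 3 * (F.prob C)\<^sup>2"
proof -
  let ?p = "F.prob C"
  have [measurable]: "(\<lambda>x. indicator C x - ?p) \<in> borel_measurable borel" by measurable
  note m = moments_sum[OF \<open>(\<lambda>x. indicator C x - ?p) \<in> _\<close> centred_indicator(3)[OF C] centred_indicator(1)[OF C],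
      unfolded centred_indicator(2)[OF C]]
  show "integrable M (\<lambda>\<omega>. (emp n C \<omega>)^k)" for k
    unfolding emp_def power_divide by (intro integrable_divide m(1))
  have "(\<integral>\<omega>. (emp n C \<omega>)\<^sup>2 \<partial>M) = real n * (?p * (1 - ?p)) / (sqrt (real n))\<^sup>2"
    unfolding emp_def power_divide using m(2) by simp
  then show "(\<integral>\<omega>. (emp n C \<omega>)\<^sup>2 \<partial>M) = ?p * (1 - ?p)" using n by simp
  have v: "?p * (1 - ?p) \<le> ?p" "0 \<le> ?p * (1 - ?p)" by (simp_all add: mult_left_le)
  have "(\<integral>\<omega>. (emp n C \<omega>)^4 \<partial>M) = (\<integral>\<omega>. (\<Sum>i<n. indicator C (X i \<omega>) - ?p)^4 \<partial>M) / (sqrt (real n))^4"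
    unfolding emp_def power_divide by simp
  also have "\<dots> \<le> (real n * (?p * (1 - ?p)) + 3 * (real n)\<^sup>2 * (?p * (1 - ?p))\<^sup>2) / (sqrt (real n))^4"
    by (intro divide_right_mono m(3)) simp
  also have "\<dots> \<le> (real n * ?p + 3 * (real n)\<^sup>2 * ?p\<^sup>2) / (sqrt (real n))^4"
    using v by (intro divide_right_mono add_mono mult_left_mono power_mono) auto
  also have "(sqrt (real n))^4 = (real n)\<^sup>2"
    using power_mult[of "sqrt (real n)" 2 2] by simp
  also have "(real n * ?p + 3 * (real n)\<^sup>2 * ?p\<^sup>2) / (real n)\<^sup>2 = ?p / real n + 3 * ?p\<^sup>2"
    using n by (simp add: field_simps power2_eq_square)
  finally show "(\<integral>\<omega>. (emp n C \<omega>)^4 \<partial>M) \<le> ?p / real n + 3 * ?p\<^sup>2" .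
qed

lemma emp_abs_moment:
  assumes C[measurable]: "C \<in> sets borel" and n: "n > 0"
  shows "(\<integral>\<omega>. \<bar>emp n C \<omega>\<bar> \<partial>M) \<le> sqrt (F.prob C * (1 - F.prob C))" "integrable M (\<lambda>\<omega>. \<bar>emp n C \<omega>\<bar>)"
proof -
  have i: "integrable M (emp n C)" using emp_moments(1)[OF C n, of 1] by simp
  then show "integrable M (\<lambda>\<omega>. \<bar>emp n C \<omega>\<bar>)" by simp
  have "(\<integral>\<omega>. \<bar>emp n C \<omega>\<bar> \<partial>M)\<^sup>2 \<le> (\<integral>\<omega>. \<bar>emp n C \<omega>\<bar>\<^sup>2 \<partial>M)"
  proof -
    have "0 \<le> P.variance (\<lambda>\<omega>. \<bar>emp n C \<omega>\<bar>)" by (rule P.variance_positive)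
    also have "\<dots> = (\<integral>\<omega>. \<bar>emp n C \<omega>\<bar>\<^sup>2 \<partial>M) - (\<integral>\<omega>. \<bar>emp n C \<omega>\<bar> \<partial>M)\<^sup>2"
      using i emp_moments(1)[OF C n, of 2] by (intro P.variance_eq) auto
    finally show ?thesis by simp
  qed
  then show "(\<integral>\<omega>. \<bar>emp n C \<omega>\<bar> \<partial>M) \<le> sqrt (F.prob C * (1 - F.prob C))"
    using emp_moments(2)[OF C n] by (intro real_le_rsqrt) simp
qed

section \<open>Dyadic quantiles and chaining\<close>

definition dyadic_index :: "nat \<Rightarrow> real \<Rightarrow> nat" where
  "dyadic_index b x = nat \<lfloor>2^b * cdf F x\<rfloor>"

definition dyadic_set :: "nat \<Rightarrow> nat \<Rightarrow> real set" where
  "dyadic_set b j = quantile_set F (real j / 2^b)"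

text \<open>One cell covers the part of \<open>{..x}\<close> beyond the quantile set for all
  \<open>x\<close> of index \<open>j\<close> at once. The index \<open>j = 2^b\<close> also occurs,
  namely when \<open>cdf F x = 1\<close>.\<close>

definition dyadic_cell :: "nat \<Rightarrow> nat \<Rightarrow> real set" where
  "dyadic_cell b j = {y. cdf F y < real (j + 1) / 2^b} - dyadic_set b j"

lemma sets_dyadic [measurable]: "dyadic_set b j \<in> sets borel" "dyadic_cell b j \<in> sets borel"
  unfolding dyadic_set_def dyadic_cell_def by measurable

lemma dyadic_index:
  "real (dyadic_index b x) / 2^b \<le> cdf F x" "cdf F x < real (dyadic_index b x + 1) / 2^b"
  "dyadic_index b x \<le> 2^b"
proof -
  have 0: "0 \<le> 2^b * cdf F x" by (simp add: F.cdf_nonneg)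
  then have "real (dyadic_index b x) \<le> 2^b * cdf F x" "2^b * cdf F x < real (dyadic_index b x) + 1"
    unfolding dyadic_index_def by linarith+
  then show "real (dyadic_index b x) / 2^b \<le> cdf F x" "cdf F x < real (dyadic_index b x + 1) / 2^b"
    by (simp_all add: field_simps)
  note \<open>real (dyadic_index b x) \<le> 2^b * cdf F x\<close>
  also have "2^b * cdf F x \<le> 2^b * 1" by (intro mult_left_mono F.cdf_bounded_prob) auto
  also have "\<dots> = real (2^b)" by simp
  finally show "dyadic_index b x \<le> 2^b" by (simp only: of_nat_le_iff)
qed

lemma dyadic_index_Suc: "dyadic_index (Suc b) x = 2 * dyadic_index b x \<or> dyadic_index (Suc b) x = 2 * dyadic_index b x + 1"
proof -
  have "0 \<le> 2^b * cdf F x" by (simp add: F.cdf_nonneg)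
  moreover have "2 ^ Suc b * cdf F x = 2 * (2^b * cdf F x)" by simp
  ultimately show ?thesis unfolding dyadic_index_def by linarith
qed

lemma dyadic_set_subset: "dyadic_set b (dyadic_index b x) \<subseteq> {..x}"
  unfolding dyadic_set_def by (rule quantile_set_subset_atMost[OF dyadic_index(1)])

lemma atMost_minus_dyadic_set: "{..x} - dyadic_set b (dyadic_index b x) \<subseteq> dyadic_cell b (dyadic_index b x)"
  unfolding dyadic_cell_def
  using dyadic_index(2)[of x b] by (auto intro: le_less_trans[OF F.cdf_nondecreasing])

lemma prob_dyadic_cell_le:
  assumes "j \<le> 2^b"
  shows "F.prob (dyadic_cell b j) \<le> 1 / 2^b"
proof -
  have "real j \<le> real (2^b)" using assms by (simp only: of_nat_le_iff)
  then have "F.prob (dyadic_cell b j) \<le> real (j + 1) / 2^b - real j / 2^b"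
    unfolding dyadic_cell_def dyadic_set_def
    by (intro F.prob_cell_le) (auto simp: divide_right_mono)
  then show ?thesis by (simp add: add_divide_distrib)
qed

text \<open>The inequality \<open>\<bar>x\<bar> \<le> l + x^4 / l^3\<close> with \<open>l = (9/10)^b\<close> replaces the maximum over the
  \<open>2^b\<close> sets of a level by a sum. Since \<open>emp\<close> of a set of probability at most \<open>2^-b\<close> has fourth moment
  of order \<open>4^-b\<close> as long as \<open>2^b \<le> n\<close>, the expected bounds are summable over the levels.\<close>

definition level_bound :: "nat \<Rightarrow> (nat \<Rightarrow> real set) \<Rightarrow> nat \<Rightarrow> 'w \<Rightarrow> real" where
  "level_bound n C b \<omega> = (9/10)^b + (\<Sum>j\<le>2^b. (emp n (C j) \<omega>)^4) / (729/1000)^b"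

lemma abs_emp_le_level_bound:
  assumes "j \<le> 2^b"
  shows "\<bar>emp n (C j) \<omega>\<bar> \<le> level_bound n C b \<omega>"
proof -
  have "\<bar>emp n (C j) \<omega>\<bar> \<le> (9/10)^b + (emp n (C j) \<omega>)^4 / ((9/10)^b)^3"
    by (rule abs_le_add_power4_div) simp
  also have "((9/10)^b)^3 = (729/1000 :: real)^b"
    unfolding power_mult[symmetric] mult.commute[of b] unfolding power_mult by (simp add: power3_eq_cube)
  also have "(emp n (C j) \<omega>)^4 \<le> (\<Sum>j\<le>2^b. (emp n (C j) \<omega>)^4)"
    using assms by (intro member_le_sum[of j "{..2^b}" "\<lambda>j. (emp n (C j) \<omega>)^4"]) auto
  finally show ?thesis unfolding level_bound_def by (simp add: divide_right_mono)
qed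

lemma level_bound_integral:
  assumes C[measurable]: "\<And>j. C j \<in> sets borel" and p: "\<And>j. j \<le> 2^b \<Longrightarrow> F.prob (C j) \<le> 1 / 2^b"
    and n: "2^b \<le> n"
  shows "integrable M (level_bound n C b)" "(\<integral>\<omega>. level_bound n C b \<omega> \<partial>M) \<le> 9 * (9/10)^b"
proof -
  have n0: "n > 0" using n by (meson less_le_trans zero_less_numeral zero_less_power)
  have nb: "(2::real)^b \<le> real n" using n by (metis of_nat_le_iff of_nat_numeral of_nat_power)
  show "integrable M (level_bound n C b)"
    unfolding level_bound_def[abs_def]
    by (intro Bochner_Integration.integrable_add integrable_divide Bochner_Integration.integrable_sum
        emp_moments(1)[OF C n0] P.integrable_const)
  have m4: "(\<integral>\<omega>. (emp n (C j) \<omega>)^4 \<partial>M) \<le> 4 / 4^b" if "j \<le> 2^b" for j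
  proof -
    have "(\<integral>\<omega>. (emp n (C j) \<omega>)^4 \<partial>M) \<le> F.prob (C j) / real n + 3 * (F.prob (C j))\<^sup>2"
      by (rule emp_moments(3)[OF C n0])
    \<comment> \<open>Here \<open>2^b \<le> n\<close> brings the term \<open>p / n\<close> down to
      the order \<open>4^-b\<close> of the main term.\<close>
    also have "\<dots> \<le> (1/2^b) / 2^b + 3 * (1/2^b)\<^sup>2"
      using p[OF that] nb by (intro add_mono frac_le mult_left_mono power_mono) auto
    also have "\<dots> = 4 / (2^b * 2^b)" by (simp add: power2_eq_square)
    also have "(2::real)^b * 2^b = 4^b" by (simp flip: power_mult_distrib)
    finally show ?thesis .
  qed
  have "(\<integral>\<omega>. level_bound n C b \<omega> \<partial>M) = (9/10)^b + (\<Sum>j\<le>2^b. (\<integral>\<omega>. (emp n (C j) \<omega>)^4 \<partial>M)) / (729/1000)^b"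
    unfolding level_bound_def
    by (subst Bochner_Integration.integral_add)
      (auto simp: emp_moments(1)[OF C n0] P.prob_space Bochner_Integration.integral_sum)
  also have "\<dots> \<le> (9/10)^b + (\<Sum>j\<le>(2::nat)^b. 4 / 4^b) / (729/1000)^b"
    by (intro add_left_mono divide_right_mono sum_mono m4) auto
  also have "(\<Sum>j\<le>(2::nat)^b. 4 / 4^b) = (2^b + 1) * (4 / 4^b :: real)" by simp
  \<comment> \<open>Counting the \<open>2^b + 1\<close> sets as \<open>2 * 2^b\<close> leads to
    \<open>8 * (500/729)^b\<close>; as 500/729 is below 9/10, the total is 9 times
    \<open>(9/10)^b\<close>.\<close>
  also have "(9/10)^b + (2^b + 1) * (4 / 4^b) / (729/1000)^b \<le> (9/10)^b + (2 * 2^b) * (4 / 4^b) / (729/1000 :: real)^b"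
    by (intro add_left_mono divide_right_mono mult_right_mono) auto
  also have "(2 * 2^b) * (4 / 4^b) / (729/1000)^b = 8 * ((2/4/(729/1000))^b :: real)"
    unfolding power_divide by simp
  also have "(2/4/(729/1000) :: real)^b \<le> (9/10)^b" by (intro power_mono) auto
  finally show "(\<integral>\<omega>. level_bound n C b \<omega> \<partial>M) \<le> 9 * (9/10)^b" by simp
qed

text \<open>A refinement sends the index \<open>j\<close> of \<open>x\<close> to
  \<open>2 * j\<close>, which leaves the quantile set as it is, or to \<open>2 * j + 1\<close>,
  which enlarges it by exactly this set. Intersecting with the cell keeps the probability at most
  \<open>1 / 2^b\<close>.\<close>

definition half_cell :: "nat \<Rightarrow> nat \<Rightarrow> real set" where
  "half_cell b j = dyadic_set (Suc b) (2 * j + 1) \<inter> dyadic_cell b j"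

lemma sets_half_cell [measurable]: "half_cell b j \<in> sets borel"
  unfolding half_cell_def by measurable

lemma emp_refine:
  "\<bar>emp n (dyadic_set (Suc b) (dyadic_index (Suc b) x)) \<omega> - emp n (dyadic_set b (dyadic_index b x)) \<omega>\<bar>
    \<le> level_bound n (half_cell b) b \<omega>"
proof -
  let ?j = "dyadic_index b x"
  consider "dyadic_index (Suc b) x = 2 * ?j" | "dyadic_index (Suc b) x = 2 * ?j + 1"
    using dyadic_index_Suc by blast
  then show ?thesis
  proof cases
    case 1
    have "\<bar>emp n (half_cell b 0) \<omega>\<bar> \<le> level_bound n (half_cell b) b \<omega>" by (rule abs_emp_le_level_bound) simp
    then have "0 \<le> level_bound n (half_cell b) b \<omega>" by linarith
    then show ?thesis by (simp add: 1 dyadic_set_def)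
  next
    case 2
    have sub: "dyadic_set b ?j \<subseteq> dyadic_set (Suc b) (2 * ?j + 1)"
      unfolding dyadic_set_def by (rule quantile_set_mono) (simp add: field_simps)
    have "dyadic_set (Suc b) (2 * ?j + 1) \<subseteq> {..x}" using dyadic_set_subset[of "Suc b" x] 2 by simp
    then have "dyadic_set (Suc b) (2 * ?j + 1) - dyadic_set b ?j = half_cell b ?j"
      using atMost_minus_dyadic_set[of x b] by (auto simp: half_cell_def dyadic_cell_def)
    then have "emp n (dyadic_set (Suc b) (2 * ?j + 1)) \<omega> - emp n (dyadic_set b ?j) \<omega> = emp n (half_cell b ?j) \<omega>"
      using emp_Diff[OF sub, of n \<omega>] by simp
    then show ?thesis using abs_emp_le_level_bound[OF dyadic_index(3)[of b x], of n "half_cell b" \<omega>] 2 by simp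
  qed
qed

lemma emp_chain:
  assumes "a \<le> b"
  shows "\<bar>emp n (dyadic_set b (dyadic_index b x)) \<omega> - emp n (dyadic_set a (dyadic_index a x)) \<omega>\<bar>
    \<le> (\<Sum>i=a..<b. level_bound n (half_cell i) i \<omega>)"
  using assms
proof (induction b rule: dec_induct)
  case (step b)
  then show ?case using emp_refine[of n b x \<omega>] by simp
qed simp

text \<open>The chain runs up to the last level \<open>b\<close> with \<open>2^b \<le> n\<close>;
  what lies beyond costs one more maximum over cells and a centring of at most
  \<open>sqrt n / 2^b \<le> 2 / sqrt n\<close>. The constant 90 is the sum of the geometric series
  with terms \<open>9 * (9/10)^i\<close>. One measurable \<open>R\<close> serves all
  \<open>x\<close>.\<close>

theorem emp_oscillation:
  assumes a: "2^a \<le> n"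
  obtains R where "integrable M R" "(\<integral>\<omega>. R \<omega> \<partial>M) \<le> 90 * (9/10)^a + 2 / sqrt (real n)"
    "\<And>\<omega> x. \<bar>emp n {..x} \<omega> - emp n (dyadic_set a (dyadic_index a x)) \<omega>\<bar> \<le> R \<omega>"
proof -
  have n0: "n > 0" using a by (meson less_le_trans zero_less_numeral zero_less_power)
  obtain b where b: "2^b \<le> n" "n < 2^(b + 1)"
    using ex_power_ivl1[of 2 n] n0 by auto
  have ab: "a \<le> b"
  proof (rule ccontr)
    assume "\<not> a \<le> b"
    then have "(2::nat)^(b+1) \<le> 2^a" by (intro power_increasing) auto
    then show False using a b by simp
  qed
  let ?R = "\<lambda>\<omega>. (\<Sum>i=a..<b. level_bound n (half_cell i) i \<omega>) + level_bound n (dyadic_cell b) b \<omega> + sqrt (real n) / 2^b"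
  have osc: "\<bar>emp n {..x} \<omega> - emp n (dyadic_set a (dyadic_index a x)) \<omega>\<bar> \<le> ?R \<omega>" for \<omega> x
  proof -
    let ?j = "dyadic_index b x"
    have "emp n {..x} \<omega> - emp n (dyadic_set b ?j) \<omega> = emp n ({..x} - dyadic_set b ?j) \<omega>"
      using emp_Diff[OF dyadic_set_subset[of b x], of n \<omega>] by simp
    also have "\<bar>\<dots>\<bar> \<le> \<bar>emp n (dyadic_cell b ?j) \<omega>\<bar> + sqrt (real n) * F.prob (dyadic_cell b ?j)"
      by (rule abs_emp_subset_le[OF atMost_minus_dyadic_set]) auto
    also have "\<dots> \<le> level_bound n (dyadic_cell b) b \<omega> + sqrt (real n) * (1 / 2^b)"
      by (intro add_mono abs_emp_le_level_bound mult_left_mono prob_dyadic_cell_le dyadic_index(3)) auto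
    finally show ?thesis using emp_chain[OF ab, of n x \<omega>] by simp
  qed
  have half: "F.prob (half_cell i j) \<le> 1 / 2^i" if "j \<le> 2^i" for i j
    by (rule order_trans[OF F.finite_measure_mono prob_dyadic_cell_le[OF that]]) (auto simp: half_cell_def)
  have pow: "2^i \<le> n" if "i \<le> b" for i
    by (rule order_trans[OF power_increasing b(1)]) (use that in auto)
  have int1: "integrable M (level_bound n (half_cell i) i)" "(\<integral>\<omega>. level_bound n (half_cell i) i \<omega> \<partial>M) \<le> 9 * (9/10)^i"
    if "i < b" for i
    using that by (intro level_bound_integral half pow; simp)+
  have int2: "integrable M (level_bound n (dyadic_cell b) b)" "(\<integral>\<omega>. level_bound n (dyadic_cell b) b \<omega> \<partial>M) \<le> 9 * (9/10)^b"
    by (intro level_bound_integral prob_dyadic_cell_le b(1); simp)+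
  have int3: "integrable M (\<lambda>\<omega>. \<Sum>i=a..<b. level_bound n (half_cell i) i \<omega>)"
    using int1(1) by (intro Bochner_Integration.integrable_sum) auto
  have int: "integrable M ?R" by (intro Bochner_Integration.integrable_add int2 int3 P.integrable_const)
  have "(\<integral>\<omega>. ?R \<omega> \<partial>M) = (\<Sum>i=a..<b. \<integral>\<omega>. level_bound n (half_cell i) i \<omega> \<partial>M)
      + (\<integral>\<omega>. level_bound n (dyadic_cell b) b \<omega> \<partial>M) + sqrt (real n) / 2^b"
    using int1(1) int2(1) int3 by (simp add: P.prob_space Bochner_Integration.integral_sum)
  also have "\<dots> \<le> (\<Sum>i=a..<b. 9 * (9/10)^i) + 9 * (9/10)^b + 2 / sqrt (real n)"
  proof (intro add_mono sum_mono int2(2))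
    have "real n \<le> real (2^(b + 1))" using b(2) by (simp only: of_nat_le_iff)
    then have "real n \<le> 2 * 2^b" by simp
    then have "sqrt (real n) * sqrt (real n) \<le> 2 * 2^b" by simp
    then show "sqrt (real n) / 2^b \<le> 2 / sqrt (real n)"
      using n0 by (subst pos_divide_le_eq, simp) (subst times_divide_eq_left, subst pos_le_divide_eq, auto)
  qed (use int1 in auto)
  also have "(\<Sum>i=a..<b. 9 * (9/10)^i) + 9 * (9/10)^b \<le> 90 * (9/10 :: real)^a"
  proof -
    \<comment> \<open>With 90 in place of 9 in the last term the sum telescopes, because
      \<open>9 + 90 * (9/10) = 90\<close>.\<close>
    have "(\<Sum>i=a..<b. 9 * (9/10)^i) + 90 * (9/10)^b = 90 * (9/10 :: real)^a"
      using ab by (induction b rule: dec_induct) auto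
    moreover have "9 * (9/10::real)^b \<le> 90 * (9/10)^b" by simp
    ultimately show ?thesis by linarith
  qed
  finally have "(\<integral>\<omega>. ?R \<omega> \<partial>M) \<le> 90 * (9/10)^a + 2 / sqrt (real n)" by simp
  from that[OF int this osc] show thesis .
qed

end

subsection \<open>Discretisation in \<open>L_space\<close>\<close>

lemma L_space_norm_le:
  fixes z :: "real \<Rightarrow> real"
  assumes z: "z \<in> borel_measurable borel" and c: "\<And>x. \<bar>z x\<bar> \<le> c"
    and e: "(\<integral>\<^sup>+x. ennreal \<bar>z x\<bar> \<partial>total_variation borel \<mu>) \<le> ennreal e" "0 \<le> e"
  shows "z \<in> L_space borel \<mu>" "L_norm borel \<mu> z \<le> c + e"
proof -
  have zm: "z \<in> borel_measurable (total_variation borel \<mu>)"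
    using z by (simp add: measurable_cong_sets[OF sets_total_variation refl])
  have int: "integrable (total_variation borel \<mu>) z"
    using zm e(1) by (intro integrableI_bounded) (auto intro: le_less_trans)
  then show "z \<in> L_space borel \<mu>"
    using c by (auto simp: L_space_def bounded_iff)
  have c0: "0 \<le> c" using c[of 0] by linarith
  have "(SUP x\<in>space borel. \<bar>z x\<bar>) \<le> c" using c by (intro cSUP_least) auto
  moreover have "(\<integral>x. \<bar>z x\<bar> \<partial>total_variation borel \<mu>) \<le> e"
  proof -
    have "ennreal (\<integral>x. \<bar>z x\<bar> \<partial>total_variation borel \<mu>) = (\<integral>\<^sup>+x. ennreal \<bar>z x\<bar> \<partial>total_variation borel \<mu>)"
      using int by (intro nn_integral_eq_integral[symmetric]) auto
    then show ?thesis using e by (metis ennreal_le_iff)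
  qed
  ultimately show "L_norm borel \<mu> z \<le> c + e"
    unfolding L_norm_def using c0 e(2) by simp
qed

lemma L_norm_nonneg: "0 \<le> L_norm borel \<mu> z"
  by (simp add: L_norm_def le_max_iff_disj)

lemma tendsto_ereal_if_sandwich:
  assumes "\<And>e::real. e > 0 \<Longrightarrow> \<forall>\<^sub>F n in sequentially. ereal (l - e) \<le> q n \<and> q n \<le> ereal (l + e)"
  shows "q \<longlonglongrightarrow> ereal l"
proof (rule order_tendstoI)
  fix a assume a: "a < ereal l"
  obtain e where e: "e > 0" "a < ereal (l - e)"
  proof (cases a)
    case (real r)
    then show ?thesis using a by (intro that[of "(l - r) / 2"]) (auto simp: field_simps)
  qed (use a that[of 1] in auto)
  show "\<forall>\<^sub>F n in sequentially. a < q n"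
    using assms[OF e(1)] by eventually_elim (use e(2) in \<open>auto intro: less_le_trans\<close>)
next
  fix a assume a: "ereal l < a"
  obtain e where e: "e > 0" "ereal (l + e) < a"
  proof (cases a)
    case (real r)
    then show ?thesis using a by (intro that[of "(r - l) / 2"]) (auto simp: field_simps)
  qed (use a that[of 1] in auto)
  show "\<forall>\<^sub>F n in sequentially. q n < a"
    using assms[OF e(1)] by eventually_elim (use e(2) in \<open>auto intro: le_less_trans\<close>)
qed

locale L_sample = iid_sample F M X
  for F :: "real measure" and M :: "'w measure" and X :: "nat \<Rightarrow> 'w \<Rightarrow> real" +
  fixes \<mu> :: "real set \<Rightarrow> ereal"
  assumes finite_weight: "(\<integral>\<^sup>+x. ennreal (sqrt (cdf F x * (1 - cdf F x))) \<partial>total_variation borel \<mu>) < \<infinity>"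
begin

abbreviation V :: "real measure" where "V \<equiv> total_variation borel \<mu>"

abbreviation weight :: "real \<Rightarrow> real" where "weight x \<equiv> sqrt (cdf F x * (1 - cdf F x))"

sublocale L: Metric_space "L_space borel \<mu>" "\<lambda>z w. L_norm borel \<mu> (\<lambda>x. z x - w x)"
  by (rule Metric_space_L)

lemma cdf_bounds: "0 \<le> cdf F x" "cdf F x \<le> 1"
  by (rule F.cdf_nonneg, rule F.cdf_bounded_prob)

lemma measurable_V: "f \<in> borel_measurable V \<longleftrightarrow> f \<in> borel_measurable borel"
  for f :: "real \<Rightarrow> 'b::topological_space"
  by (simp add: measurable_cong_sets[OF sets_total_variation refl])

section \<open>Central regions of finite variation\<close>

definition J :: "real set" where "J = {x. 0 < cdf F x \<and> cdf F x < 1}"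

lemma sets_J [measurable]: "J \<in> sets borel"
  unfolding J_def by measurable

text \<open>Markov's inequality for the integrable function \<open>weight\<close> makes the restriction of \<open>V\<close> to \<open>J\<close>
  sigma-finite, which gives Tonelli's theorem; off \<open>J\<close> all the processes vanish almost surely.\<close>

definition VJ :: "real measure" where "VJ = density V (indicator J)"

lemma sets_VJ [simp, measurable_cong]: "sets VJ = sets borel"
  by (simp add: VJ_def)

lemma nn_integral_VJ:
  assumes "f \<in> borel_measurable borel" "\<And>x. x \<notin> J \<Longrightarrow> f x = 0"
  shows "(\<integral>\<^sup>+x. f x \<partial>VJ) = (\<integral>\<^sup>+x. f x \<partial>V)"
proof -
  have "(\<integral>\<^sup>+x. f x \<partial>VJ) = (\<integral>\<^sup>+x. indicator J x * f x \<partial>V)"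
    unfolding VJ_def using assms(1) by (intro nn_integral_density) (auto simp: measurable_V)
  also have "\<dots> = (\<integral>\<^sup>+x. f x \<partial>V)"
    using assms(2) by (intro nn_integral_cong) (auto simp: indicator_def)
  finally show ?thesis .
qed

lemma emeasure_weight_ge_finite:
  assumes "c > 0"
  shows "emeasure V {x. c \<le> weight x} < \<infinity>"
proof -
  have "emeasure V {x\<in>space V. 1 \<le> ennreal (1/c) * ennreal (weight x)}
      \<le> ennreal (1/c) * (\<integral>\<^sup>+x\<in>space V. ennreal (weight x) \<partial>V)"
  proof (rule order_trans[OF nn_integral_Markov_inequality])
    show "(\<lambda>x. ennreal (weight x) * indicator (space V) x) \<in> borel_measurable V"
      unfolding measurable_V by simp
  qed auto
  also have "\<dots> < \<infinity>"
    using finite_weight by (simp add: ennreal_mult_less_top)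
  also have "{x\<in>space V. 1 \<le> ennreal (1/c) * ennreal (weight x)} = {x. c \<le> weight x}"
    using assms by (auto simp: ennreal_mult'[symmetric] le_divide_eq)
  finally show ?thesis .
qed

lemma sigma_finite_VJ: "sigma_finite_measure VJ"
proof
  let ?A = "\<lambda>k::nat. {x. 1 / real (Suc k) \<le> weight x} \<union> - J"
  show "\<exists>A. countable A \<and> A \<subseteq> sets VJ \<and> \<Union> A = space VJ \<and> (\<forall>a\<in>A. emeasure VJ a \<noteq> \<infinity>)"
  proof (intro exI[of _ "range ?A"] conjI ballI)
    show "range ?A \<subseteq> sets VJ" by auto
    have "\<exists>k. x \<in> ?A k" for x
    proof (cases "x \<in> J")
      case True
      then have "0 < weight x" by (simp add: J_def)
      then obtain k where "inverse (real (Suc k)) < weight x" using reals_Archimedean by blast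
      then show ?thesis by (intro exI[of _ k]) (simp add: inverse_eq_divide)
    qed auto
    then show "\<Union> (range ?A) = space VJ" by (auto simp: VJ_def)
    fix a assume "a \<in> range ?A"
    then obtain k where a: "a = ?A k" by auto
    have "emeasure VJ a = (\<integral>\<^sup>+x. indicator J x * indicator a x \<partial>V)"
      unfolding VJ_def a by (intro emeasure_density) (auto simp: measurable_V)
    also have "\<dots> \<le> (\<integral>\<^sup>+x. indicator {x. 1 / real (Suc k) \<le> weight x} x \<partial>V)"
      unfolding a by (intro nn_integral_mono) (auto simp: indicator_def)
    also have "\<dots> < \<infinity>"
      using emeasure_weight_ge_finite[of "1 / real (Suc k)"] by (subst nn_integral_indicator) auto
    finally show "emeasure VJ a \<noteq> \<infinity>" by simp
  qed auto
qed

sublocale VJ: sigma_finite_measure VJ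
  by (rule sigma_finite_VJ)

text \<open>The cuts fit the dyadic grid of level \<open>m\<close>: outside,
  \<open>dyadic_index m x\<close> can only be 0, \<open>2^m - 1\<close> or \<open>2^m\<close>. As
  \<open>K 0\<close> is empty, estimates on the complement at \<open>m = 0\<close> concern the whole
  line.\<close>

definition K :: "nat \<Rightarrow> real set" where
  "K m = {x. 1/2^m \<le> cdf F x \<and> cdf F x < 1 - 1/2^m}"

lemma sets_K [measurable]: "K m \<in> sets borel"
  unfolding K_def by measurable

lemma eventually_K: "x \<in> J \<Longrightarrow> \<forall>\<^sub>F m in sequentially. x \<in> K m"
proof -
  assume x: "x \<in> J"
  have lim: "(\<lambda>m. (1/2)^m :: real) \<longlonglongrightarrow> 0" by (rule LIMSEQ_realpow_zero) auto
  have "\<forall>\<^sub>F m in sequentially. (1/2::real)^m < min (cdf F x) (1 - cdf F x)"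
    using x by (intro order_tendstoD(2)[OF lim]) (auto simp: J_def)
  then show ?thesis
    by (rule eventually_mono) (auto simp: K_def power_one_over)
qed

text \<open>Both factors under the root in \<open>weight\<close> are at least \<open>1/2^m\<close>
  on \<open>K m\<close>, hence so is \<open>weight\<close>, and Markov's inequality applies.\<close>

lemma emeasure_K_finite: "emeasure V (K m) < \<infinity>"
proof -
  have "K m \<subseteq> {x. 1/2^m \<le> weight x}"
  proof (intro subsetI CollectI real_le_rsqrt)
    fix x assume x: "x \<in> K m"
    have "(1/2^m)\<^sup>2 = (1/2^m) * (1/2^m :: real)" by (rule power2_eq_square)
    also have "\<dots> \<le> cdf F x * (1 - cdf F x)"
      using x by (intro mult_mono) (auto simp: K_def cdf_bounds)
    finally show "(1/2^m)\<^sup>2 \<le> cdf F x * (1 - cdf F x)" .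
  qed
  then have "emeasure V (K m) \<le> emeasure V {x. 1/2^m \<le> weight x}"
    by (intro emeasure_mono) auto
  then show ?thesis using emeasure_weight_ge_finite[of "1/2^m"] by (auto intro: le_less_trans)
qed

definition vK :: "nat \<Rightarrow> real" where "vK m = measure V (K m)"

lemma vK: "emeasure V (K m) = ennreal (vK m)" "0 \<le> vK m"
  unfolding vK_def using emeasure_K_finite[of m] by (auto simp: emeasure_eq_ennreal_measure)

definition tail :: "nat \<Rightarrow> real" where
  "tail m = enn2real (\<integral>\<^sup>+x. ennreal (weight x) * indicator (- K m) x \<partial>V)"

text \<open>Every point of \<open>J\<close> eventually enters \<open>K m\<close>, so dominated
  convergence applies. It serves both for \<open>weight\<close> and for the paths of the
  limit.\<close>

lemma nn_integral_outside_K_tendsto_0: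
  assumes f[measurable]: "f \<in> borel_measurable borel" and fin: "(\<integral>\<^sup>+x. f x \<partial>V) < \<infinity>"
    and 0: "\<And>x. x \<notin> J \<Longrightarrow> f x = 0"
  shows "(\<lambda>m. \<integral>\<^sup>+x. f x * indicator (- K m) x \<partial>V) \<longlonglongrightarrow> 0"
proof -
  have "(\<lambda>m. \<integral>\<^sup>+x. f x * indicator (- K m) x \<partial>V) \<longlonglongrightarrow> (\<integral>\<^sup>+x. 0 \<partial>V)"
  proof (rule nn_integral_dominated_convergence[where w=f])
    show "(\<lambda>x. f x * indicator (- K m) x) \<in> borel_measurable V" "f \<in> borel_measurable V" for m
      unfolding measurable_V by measurable
    show "AE x in V. f x * indicator (- K m) x \<le> f x" for m by (auto simp: indicator_def)
    show "AE x in V. (\<lambda>m. f x * indicator (- K m) x) \<longlonglongrightarrow> 0"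
    proof (rule AE_I2)
      fix x
      show "(\<lambda>m. f x * indicator (- K m) x) \<longlonglongrightarrow> 0"
      proof (cases "x \<in> J")
        case True
        from eventually_K[OF this] have "\<forall>\<^sub>F m in sequentially. f x * indicator (- K m) x = 0"
          by eventually_elim simp
        then show ?thesis by (rule tendsto_eventually)
      qed (simp add: 0)
    qed
  qed (use fin in auto)
  then show ?thesis by simp
qed

lemma weight_outside_J: "x \<notin> J \<Longrightarrow> weight x = 0"
  using cdf_bounds[of x] by (auto simp: J_def not_less)

lemma tail: "(\<integral>\<^sup>+x. ennreal (weight x) * indicator (- K m) x \<partial>V) = ennreal (tail m)" "0 \<le> tail m"
  "tail \<longlonglongrightarrow> 0"
proof -
  have "(\<integral>\<^sup>+x. ennreal (weight x) * indicator (- K m) x \<partial>V) \<le> (\<integral>\<^sup>+x. ennreal (weight x) \<partial>V)" for m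
    by (intro nn_integral_mono) (auto simp: indicator_def)
  then have "(\<integral>\<^sup>+x. ennreal (weight x) * indicator (- K m) x \<partial>V) < \<infinity>" for m
    using finite_weight by (rule le_less_trans)
  then show eq: "(\<integral>\<^sup>+x. ennreal (weight x) * indicator (- K m) x \<partial>V) = ennreal (tail m)" for m
    unfolding tail_def by simp
  show "0 \<le> tail m" for m by (simp add: tail_def)
  have "(\<lambda>m. ennreal (tail m)) \<longlonglongrightarrow> ennreal 0"
    unfolding eq[symmetric] ennreal_0
    by (rule nn_integral_outside_K_tendsto_0[OF _ finite_weight]) (auto simp: weight_outside_J)
  then show "tail \<longlonglongrightarrow> 0" by (rule tendsto_ennrealD) (auto simp: tail_def)
qed

section \<open>Step functions on the central region\<close>

definition step :: "nat \<Rightarrow> nat \<Rightarrow> (nat \<Rightarrow> real) \<Rightarrow> real \<Rightarrow> real" where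
  "step m a v x = (if x \<in> K m then v (dyadic_index a x) else 0)"

lemma measurable_dyadic_index [measurable]: "dyadic_index a \<in> borel \<rightarrow>\<^sub>M count_space UNIV"
  unfolding dyadic_index_def[abs_def] by measurable

lemma measurable_step [measurable]: "step m a v \<in> borel_measurable borel"
  unfolding step_def[abs_def] by measurable

lemma nn_integral_K_le:
  assumes "\<And>x. x \<in> K m \<Longrightarrow> \<bar>f x\<bar> \<le> c" "0 \<le> c"
  shows "(\<integral>\<^sup>+x. ennreal \<bar>f x\<bar> * indicator (K m) x \<partial>V) \<le> ennreal (vK m * c)"
proof -
  have "(\<integral>\<^sup>+x. ennreal \<bar>f x\<bar> * indicator (K m) x \<partial>V) \<le> (\<integral>\<^sup>+x. ennreal c * indicator (K m) x \<partial>V)"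
    using assms by (intro nn_integral_mono) (auto simp: indicator_def intro!: ennreal_leI)
  also have "\<dots> = ennreal c * emeasure V (K m)" by (subst nn_integral_cmult_indicator) auto
  also have "\<dots> = ennreal (vK m * c)" using vK assms(2) by (simp add: ennreal_mult'' mult.commute)
  finally show ?thesis .
qed

lemma L_norm_supported_in_K:
  assumes f: "f \<in> borel_measurable borel" and c: "\<And>x. x \<in> K m \<Longrightarrow> \<bar>f x\<bar> \<le> c" "0 \<le> c"
    and 0: "\<And>x. x \<notin> K m \<Longrightarrow> f x = 0"
  shows "f \<in> L_space borel \<mu>" "L_norm borel \<mu> f \<le> (1 + vK m) * c"
proof -
  have "(\<integral>\<^sup>+x. ennreal \<bar>f x\<bar> \<partial>V) = (\<integral>\<^sup>+x. ennreal \<bar>f x\<bar> * indicator (K m) x \<partial>V)"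
    using 0 by (intro nn_integral_cong) (auto simp: indicator_def)
  also have "\<dots> \<le> ennreal (vK m * c)" by (rule nn_integral_K_le[OF c])
  finally have *: "(\<integral>\<^sup>+x. ennreal \<bar>f x\<bar> \<partial>V) \<le> ennreal (vK m * c)" .
  have "\<bar>f x\<bar> \<le> c" for x using c 0 by (cases "x \<in> K m") auto
  note L_space_norm_le[OF f this *]
  then show "f \<in> L_space borel \<mu>" "L_norm borel \<mu> f \<le> (1 + vK m) * c"
    using vK(2)[of m] c(2) by (auto simp: algebra_simps)
qed

lemma step_in_L: "step m a v \<in> L_space borel \<mu>"
proof (rule L_norm_supported_in_K(1)[where m=m and c="\<Sum>j\<le>2^a. \<bar>v j\<bar>"])
  show "\<bar>step m a v x\<bar> \<le> (\<Sum>j\<le>2^a. \<bar>v j\<bar>)" if "x \<in> K m" for x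
    using that dyadic_index(3)[of a x] by (auto simp: step_def intro!: member_le_sum[of _ _ "\<lambda>j. \<bar>v j\<bar>"])
qed (auto simp: step_def sum_nonneg)

lemma step_Lipschitz:
  "L_norm borel \<mu> (\<lambda>x. step m a v x - step m a w x) \<le> (1 + vK m) * (\<Sum>j<2^a + 1. \<bar>v j - w j\<bar>)"
proof (rule L_norm_supported_in_K(2))
  show "\<bar>step m a v x - step m a w x\<bar> \<le> (\<Sum>j<2^a+1. \<bar>v j - w j\<bar>)" if "x \<in> K m" for x
  proof -
    have "dyadic_index a x \<in> {..<2^a + 1}" using dyadic_index(3)[of a x] by auto
    from member_le_sum[OF this, of "\<lambda>j. \<bar>v j - w j\<bar>"] show ?thesis
      using that by (simp only: step_def if_True abs_ge_zero finite_lessThan)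
  qed
qed (auto simp: step_def sum_nonneg)

lemma step_function_Lipschitz:
  assumes L: "0 \<le> L" and h: "\<And>x y. \<lbrakk>x \<in> L_space borel \<mu>; y \<in> L_space borel \<mu>\<rbrakk>
      \<Longrightarrow> \<bar>h x - h y\<bar> \<le> L * L_norm borel \<mu> (\<lambda>t. x t - y t)"
  shows "\<bar>h (step m a v) - h (step m a w)\<bar> \<le> (L * (1 + vK m)) * (\<Sum>j<2^a + 1. \<bar>v j - w j\<bar>)"
proof -
  have "\<bar>h (step m a v) - h (step m a w)\<bar> \<le> L * L_norm borel \<mu> (\<lambda>t. step m a v t - step m a w t)"
    by (rule h[OF step_in_L step_in_L])
  also have "\<dots> \<le> L * ((1 + vK m) * (\<Sum>j<2^a + 1. \<bar>v j - w j\<bar>))"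
    by (intro mult_left_mono step_Lipschitz L)
  finally show ?thesis by (simp add: mult.assoc)
qed

abbreviation q :: "nat \<Rightarrow> nat \<Rightarrow> real" where "q a j \<equiv> F.prob (dyadic_set a j)"

text \<open>For the index \<open>j\<close> of \<open>x\<close> the chain
  \<open>j / 2^a \<le> q a j \<le> cdf F x < (j + 1) / 2^a\<close> holds even if \<open>F\<close>
  jumps. Hence the times \<open>q a j\<close> at which the bridge is read tend to
  \<open>cdf F x\<close>, uniformly in \<open>x\<close>.\<close>

lemma prob_dyadic_set_index:
  "real (dyadic_index a x) / 2^a \<le> q a (dyadic_index a x)" "q a (dyadic_index a x) \<le> cdf F x"
  "\<bar>cdf F x - q a (dyadic_index a x)\<bar> \<le> 1 / 2^a"
proof -
  have "real (dyadic_index a x) / 2^a \<le> 1"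
    using dyadic_index(1)[where b=a and x=x] cdf_bounds(2)[of x] by linarith
  then show 1: "real (dyadic_index a x) / 2^a \<le> q a (dyadic_index a x)"
    unfolding dyadic_set_def by (rule F.prob_quantile_set_ge)
  show 2: "q a (dyadic_index a x) \<le> cdf F x"
    unfolding cdf_def by (intro F.finite_measure_mono dyadic_set_subset) auto
  show "\<bar>cdf F x - q a (dyadic_index a x)\<bar> \<le> 1 / 2^a"
    using 1 2 dyadic_index(2)[where b=a and x=x] by (simp add: add_divide_distrib)
qed

section \<open>Convergence of the discretised process\<close>

lemma centred_indicator_product:
  assumes [measurable]: "A \<in> sets borel" "B \<in> sets borel"
  shows "(\<integral>x. (indicator A x - F.prob A) * (indicator B x - F.prob B) \<partial>F) = F.prob (A \<inter> B) - F.prob A * F.prob B"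
proof -
  have one [simp]: "F.prob UNIV = 1" using F.prob_space by simp
  have [simp]: "integrable F (indicator C :: real \<Rightarrow> real)" if [measurable]: "C \<in> sets borel" for C
    by (intro F.integrable_const_bound[where B=1]) (auto simp: indicator_def)
  have "(indicator A x - F.prob A) * (indicator B x - F.prob B)
      = indicator (A \<inter> B) x - indicator A x * F.prob B - indicator B x * F.prob A + F.prob A * F.prob B" for x :: real
    by (simp add: indicator_inter_arith algebra_simps)
  then show ?thesis by (simp add: mult.commute)
qed

text \<open>A linear combination of values of \<open>emp n\<close> is the normalised sum of one
  bounded function \<open>f\<close> of the sample. Its variance is that of the same combination of
  bridge values: the dyadic sets are nested, so the probability of an intersection is the minimum of
  the two probabilities.\<close>

lemma iexp_emp_tendsto:
  "(\<lambda>n. CLINT \<omega>|M. iexp (\<Sum>j<k. c j * emp n (dyadic_set a j) \<omega>)) \<longlonglongrightarrow>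
    (CLINT z|gauss_noise. iexp (\<Sum>j<k. c j * bridge (noise_coeff z) (q a j)))"
proof -
  define f where "f x = (\<Sum>j<k. c j * (indicator (dyadic_set a j) x - q a j))" for x
  have f[measurable]: "f \<in> borel_measurable borel" unfolding f_def by measurable
  have fB: "\<bar>f x\<bar> \<le> (\<Sum>j<k. \<bar>c j\<bar>)" for x
    unfolding f_def
    by (rule order_trans[OF sum_abs]) (intro sum_mono, simp add: abs_mult mult_left_le centred_indicator(3))
  have ib: "integrable F (\<lambda>x. indicator (dyadic_set a j) x - q a j)" for j
    by (intro F.integrable_const_bound[where B=1]) (auto simp: centred_indicator(3))
  have mean: "(\<integral>x. f x \<partial>F) = 0"
    unfolding f_def using ib by (simp add: Bochner_Integration.integral_sum centred_indicator(1))
  have ibb: "integrable F (\<lambda>x. (indicator (dyadic_set a i) x - q a i) * (indicator (dyadic_set a j) x - q a j))" for i j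
    by (intro F.integrable_const_bound[where B=1])
      (auto simp: abs_mult intro!: AE_I2 mult_le_one centred_indicator(3))
  have "(\<integral>x. (f x)\<^sup>2 \<partial>F) = (\<integral>x. (\<Sum>i<k. \<Sum>j<k. c i * c j *
      ((indicator (dyadic_set a i) x - q a i) * (indicator (dyadic_set a j) x - q a j))) \<partial>F)"
    unfolding f_def power2_eq_square sum_product by (simp add: mult_ac)
  also have "\<dots> = (\<Sum>i<k. \<Sum>j<k. c i * c j * (F.prob (dyadic_set a i \<inter> dyadic_set a j) - q a i * q a j))"
    using ibb by (simp add: Bochner_Integration.integral_sum centred_indicator_product)
  also have "\<dots> = (\<Sum>i<k. \<Sum>j<k. c i * c j * (min (q a i) (q a j) - q a i * q a j))"
  proof -
    have le: "F.prob (dyadic_set a i \<inter> dyadic_set a j) = min (q a i) (q a j)" if "i \<le> j" for i j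
    proof -
      have sub: "dyadic_set a i \<subseteq> dyadic_set a j"
        unfolding dyadic_set_def using that by (intro quantile_set_mono divide_right_mono) auto
      then have "q a i \<le> q a j" by (intro F.finite_measure_mono) auto
      with sub show ?thesis by (simp add: Int_absorb2)
    qed
    have "F.prob (dyadic_set a i \<inter> dyadic_set a j) = min (q a i) (q a j)" for i j
      using le[of i j] le[of j i] by (cases "i \<le> j") (auto simp: Int_commute min.commute)
    then show ?thesis by simp
  qed
  finally have var: "(\<integral>x. (f x)\<^sup>2 \<partial>F) = (\<Sum>i<k. \<Sum>j<k. c i * c j * (min (q a i) (q a j) - q a i * q a j))" .
  have "(\<Sum>i<n. f (X i \<omega>)) / sqrt (real n) = (\<Sum>j<k. c j * emp n (dyadic_set a j) \<omega>)" for n \<omega>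
  proof -
    have "(\<Sum>i<n. f (X i \<omega>)) = (\<Sum>j<k. c j * (\<Sum>i<n. indicator (dyadic_set a j) (X i \<omega>) - q a j))"
      unfolding f_def sum_distrib_left by (rule sum.swap)
    then show ?thesis
      unfolding emp_def by (simp only: times_divide_eq_right sum_divide_distrib[of _ "{..<k}"])
  qed
  then show ?thesis
    using CLT_iexp[OF f fB mean] char_bridge[of "{..<k}" "q a" 1 c] by (simp add: var)
qed

lemma emp_Lipschitz_tendsto:
  fixes g :: "(nat \<Rightarrow> real) \<Rightarrow> real"
  assumes L: "0 \<le> L" and g: "\<And>x y. \<bar>g x - g y\<bar> \<le> L * (\<Sum>j<k. \<bar>x j - y j\<bar>)" and gB: "\<And>x. \<bar>g x\<bar> \<le> B"
  shows "(\<lambda>n. \<integral>\<omega>. g (\<lambda>j. emp n (dyadic_set a j) \<omega>) \<partial>M) \<longlonglongrightarrow>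
    (\<integral>z. g (\<lambda>j. bridge (noise_coeff z) (q a j)) \<partial>gauss_noise)"
proof (rule Cramer_Wold_Lipschitz[where k=k and C=1, OF P.prob_space_axioms prob_space_gauss_noise _ _ _ _ _ _ _ _ L g gB])
  fix n i
  \<comment> \<open>The variances \<open>p * (1 - p)\<close> supply the uniform second moment bound
    \<open>C = 1\<close>; for \<open>n = 0\<close> the process is 0.\<close>
  have pq: "p * (1 - p) \<le> 1" if "0 \<le> p" "p \<le> 1" for p :: real
    using that mult_mono[of p 1 "1 - p" 1] by simp
  show "integrable M (\<lambda>\<omega>. (emp n (dyadic_set a i) \<omega>)\<^sup>2)" "(\<integral>\<omega>. (emp n (dyadic_set a i) \<omega>)\<^sup>2 \<partial>M) \<le> 1"
    using emp_moments(1,2)[of "dyadic_set a i" n] pq[of "q a i"]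
    by (cases "n = 0"; simp add: emp_def[of 0])+
  show "integrable gauss_noise (\<lambda>z. (bridge (noise_coeff z) (q a i))\<^sup>2)"
    "(\<integral>z. (bridge (noise_coeff z) (q a i))\<^sup>2 \<partial>gauss_noise) \<le> 1"
    using bridge_moments(3,4)[of "q a i"] pq[of "q a i"] by simp_all
next
  fix c
  have int: "integrable Q (\<lambda>\<omega>. iexp (Y \<omega>))" if "prob_space Q" "Y \<in> borel_measurable Q" for Q :: "'x measure" and Y
  proof -
    interpret Q: prob_space Q by fact
    show ?thesis using that(2) by (intro Q.integrable_const_bound[where B=1]) auto
  qed
  have Re: "(\<integral>\<omega>. cos (Y \<omega>) \<partial>Q) = Re (CLINT \<omega>|Q. iexp (Y \<omega>))"
    and Im: "(\<integral>\<omega>. sin (Y \<omega>) \<partial>Q) = Im (CLINT \<omega>|Q. iexp (Y \<omega>))"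
    if "prob_space Q" "Y \<in> borel_measurable Q" for Q :: "'x measure" and Y
    using int[OF that] by (simp_all flip: integral_Re integral_Im add: Re_exp Im_exp)
  have m: "(\<lambda>\<omega>. \<Sum>i<k. c i * emp n (dyadic_set a i) \<omega>) \<in> borel_measurable M"
    "(\<lambda>z. \<Sum>i<k. c i * bridge (noise_coeff z) (q a i)) \<in> borel_measurable gauss_noise" for n
    by measurable
  show "(\<lambda>n. \<integral>\<omega>. cos (\<Sum>i<k. c i * emp n (dyadic_set a i) \<omega>) \<partial>M) \<longlonglongrightarrow>
      (\<integral>z. cos (\<Sum>i<k. c i * bridge (noise_coeff z) (q a i)) \<partial>gauss_noise)"
    unfolding Re[OF P.prob_space_axioms m(1)] Re[OF prob_space_gauss_noise m(2)]
    by (rule tendsto_Re[OF iexp_emp_tendsto])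
  show "(\<lambda>n. \<integral>\<omega>. sin (\<Sum>i<k. c i * emp n (dyadic_set a i) \<omega>) \<partial>M) \<longlonglongrightarrow>
      (\<integral>z. sin (\<Sum>i<k. c i * bridge (noise_coeff z) (q a i)) \<partial>gauss_noise)"
    unfolding Im[OF P.prob_space_axioms m(1)] Im[OF prob_space_gauss_noise m(2)]
    by (rule tendsto_Im[OF iexp_emp_tendsto])
qed auto

section \<open>The limit process\<close>

definition good :: "(real \<Rightarrow> real) \<Rightarrow> bool" where
  "good z \<longleftrightarrow> (\<Sum>j. ennreal (schauder_bound (noise_coeff z) j)) < \<infinity> \<and>
    (\<integral>\<^sup>+x. ennreal \<bar>bridge (noise_coeff z) (cdf F x)\<bar> \<partial>VJ) < \<infinity>"

text \<open>Paths are set to 0 off the almost sure event \<open>good\<close>, because the limit must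
  lie in the space for every noise and not merely for almost every one. Integrability in
  \<open>good\<close> refers to \<open>VJ\<close>, where Tonelli's theorem makes it a measurable
  event.\<close>

definition W :: "(real \<Rightarrow> real) \<Rightarrow> real \<Rightarrow> real" where
  "W z t = (if good z then bridge (noise_coeff z) t else 0)"

definition G :: "(real \<Rightarrow> real) \<Rightarrow> real \<Rightarrow> real" where
  "G z x = W z (cdf F x)"

lemma measurable_good [measurable]: "Measurable.pred gauss_noise good"
proof -
  have [measurable]: "(\<lambda>p. bridge (noise_coeff (fst p)) (cdf F (snd p))) \<in> borel_measurable (gauss_noise \<Otimes>\<^sub>M VJ)"
    by (rule measurable_bridge_pair) simp
  have "(\<lambda>z. \<integral>\<^sup>+x. ennreal \<bar>bridge (noise_coeff z) (cdf F x)\<bar> \<partial>VJ) \<in> borel_measurable gauss_noise"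
    using VJ.borel_measurable_nn_integral_fst[of "\<lambda>p. ennreal \<bar>bridge (noise_coeff (fst p)) (cdf F (snd p))\<bar>" gauss_noise]
    by simp
  then show ?thesis unfolding good_def[abs_def] by measurable
qed

text \<open>By Tonelli the expected integral of the absolute value of the bridge along
  \<open>cdf F\<close> is at most the integral of its standard deviation \<open>weight\<close>,
  which is finite.\<close>

lemma AE_good: "AE z in gauss_noise. good z"
proof -
  interpret pair_sigma_finite gauss_noise VJ by unfold_locales
  have [measurable]: "(\<lambda>p. bridge (noise_coeff (fst p)) (cdf F (snd p))) \<in> borel_measurable (gauss_noise \<Otimes>\<^sub>M VJ)"
    by (rule measurable_bridge_pair) simp
  have "(\<integral>\<^sup>+z. \<integral>\<^sup>+x. ennreal \<bar>bridge (noise_coeff z) (cdf F x)\<bar> \<partial>VJ \<partial>gauss_noise)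
      = (\<integral>\<^sup>+x. \<integral>\<^sup>+z. ennreal \<bar>bridge (noise_coeff z) (cdf F x)\<bar> \<partial>gauss_noise \<partial>VJ)"
    using Fubini[of "\<lambda>p. ennreal \<bar>bridge (noise_coeff (fst p)) (cdf F (snd p))\<bar>"] by simp
  also have "\<dots> \<le> (\<integral>\<^sup>+x. ennreal (weight x) \<partial>VJ)"
  proof (rule nn_integral_mono)
    fix x
    have "(\<integral>\<^sup>+z. ennreal \<bar>bridge (noise_coeff z) (cdf F x)\<bar> \<partial>gauss_noise)
        = ennreal (\<integral>z. \<bar>bridge (noise_coeff z) (cdf F x)\<bar> \<partial>gauss_noise)"
      using bridge_moments(2)[OF cdf_bounds[of x]] by (intro nn_integral_eq_integral) auto
    then show "(\<integral>\<^sup>+z. ennreal \<bar>bridge (noise_coeff z) (cdf F x)\<bar> \<partial>gauss_noise) \<le> ennreal (weight x)"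
      using bridge_moments(5)[OF cdf_bounds[of x]] by (simp add: ennreal_leI)
  qed
  also have "\<dots> = (\<integral>\<^sup>+x. ennreal (weight x) \<partial>V)"
    by (rule nn_integral_VJ) (auto simp: weight_outside_J)
  finally have "(\<integral>\<^sup>+z. \<integral>\<^sup>+x. ennreal \<bar>bridge (noise_coeff z) (cdf F x)\<bar> \<partial>VJ \<partial>gauss_noise) \<noteq> \<infinity>"
    using finite_weight by auto
  then have "AE z in gauss_noise. (\<integral>\<^sup>+x. ennreal \<bar>bridge (noise_coeff z) (cdf F x)\<bar> \<partial>VJ) \<noteq> \<infinity>"
    using VJ.borel_measurable_nn_integral_fst[of "\<lambda>p. ennreal \<bar>bridge (noise_coeff (fst p)) (cdf F (snd p))\<bar>" gauss_noise]
    by (intro nn_integral_PInf_AE) auto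
  then show ?thesis
    using AE_suminf_schauder_bound by eventually_elim (auto simp: good_def less_top)
qed

lemma continuous_W: "continuous_on S (W z)"
  unfolding W_def[abs_def]
  by (cases "good z") (auto simp: good_def intro!: continuous_on_bridge summable_schauder_bound)

lemma measurable_W [measurable]: "(\<lambda>z. W z t) \<in> borel_measurable gauss_noise"
  unfolding W_def by measurable

lemma measurable_G: "(\<lambda>z. G z x) \<in> borel_measurable gauss_noise"
  unfolding G_def by (rule measurable_W)

lemma measurable_G_path [measurable]: "G z \<in> borel_measurable borel"
  unfolding G_def[abs_def]
  by (rule measurable_compose[OF F.borel_measurable_cdf borel_measurable_continuous_onI[OF continuous_W]])

lemma AE_W: "AE z in gauss_noise. \<forall>t. W z t = bridge (noise_coeff z) t"
  using AE_good by eventually_elim (simp add: W_def)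

lemma G_outside_J: "x \<notin> J \<Longrightarrow> G z x = 0"
proof -
  assume "x \<notin> J"
  then have "cdf F x = 0 \<or> cdf F x = 1" using cdf_bounds[of x] by (auto simp: J_def)
  then show ?thesis by (auto simp: G_def W_def)
qed

lemma nn_integral_G_finite: "(\<integral>\<^sup>+x. ennreal \<bar>G z x\<bar> \<partial>V) < \<infinity>"
proof -
  have "(\<integral>\<^sup>+x. ennreal \<bar>G z x\<bar> \<partial>V) = (\<integral>\<^sup>+x. ennreal \<bar>G z x\<bar> \<partial>VJ)"
    by (rule nn_integral_VJ[symmetric]) (auto simp: G_outside_J)
  also have "\<dots> < \<infinity>"
  proof (cases "good z")
    case True
    then have "(\<integral>\<^sup>+x. ennreal \<bar>bridge (noise_coeff z) (cdf F x)\<bar> \<partial>VJ) < \<infinity>" by (simp add: good_def)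
    then show ?thesis using True by (simp add: G_def W_def)
  qed (simp add: G_def W_def)
  finally show ?thesis .
qed

lemma G_bounded: obtains c where "\<And>x. \<bar>G z x\<bar> \<le> c"
proof -
  have "compact (W z ` {0..1})" by (intro compact_continuous_image continuous_W) simp
  then have "bounded (W z ` {0..1})" by (rule compact_imp_bounded)
  then obtain c where "\<forall>t\<in>{0..1}. \<bar>W z t\<bar> \<le> c" by (auto simp: bounded_iff)
  then show thesis by (intro that[of c]) (simp add: G_def cdf_bounds)
qed

lemma G_in_L: "G z \<in> L_space borel \<mu>"
proof -
  obtain c where c: "\<And>x. \<bar>G z x\<bar> \<le> c" using G_bounded by blast
  have "(\<integral>\<^sup>+x. ennreal \<bar>G z x\<bar> \<partial>V) = ennreal (enn2real (\<integral>\<^sup>+x. ennreal \<bar>G z x\<bar> \<partial>V))"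
    using nn_integral_G_finite[of z] by simp
  then show ?thesis by (intro L_space_norm_le(1)[OF measurable_G_path c, where e="enn2real (\<integral>\<^sup>+x. ennreal \<bar>G z x\<bar> \<partial>V)"]) auto
qed

lemma G_AE_sum: "AE z in gauss_noise. (\<Sum>i\<in>I. c i * G z (t i)) = (\<Sum>i\<in>I. c i * bridge (noise_coeff z) (cdf F (t i)))"
  using AE_W by eventually_elim (simp add: G_def)

lemma gaussian_process_G: "gaussian_process gauss_noise G"
  unfolding gaussian_process_def
proof (intro conjI allI impI measurable_G)
  fix I :: "real set" and c :: "real \<Rightarrow> real" assume I: "finite I"
  let ?Y = "\<lambda>z. \<Sum>t\<in>I. c t * bridge (noise_coeff z) (cdf F t)"
  have Y: "?Y \<in> borel_measurable gauss_noise" by measurable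
  have "distr gauss_noise borel (\<lambda>z. \<Sum>t\<in>I. c t * G z t) = distr gauss_noise borel ?Y"
    using G_AE_sum measurable_G by (intro distr_cong_AE) auto
  moreover note n = normal_if_char(1,2)[OF prob_space_gauss_noise Y char_bridge[OF I, of "cdf F"]]
  ultimately have "distr gauss_noise borel (\<lambda>z. \<Sum>t\<in>I. c t * G z t) = normal_distribution 0
      (sqrt (\<Sum>s\<in>I. \<Sum>t\<in>I. c s * c t * (min (cdf F s) (cdf F t) - cdf F s * cdf F t)))"
    using cdf_bounds by simp
  then show "\<exists>m \<sigma>. 0 \<le> \<sigma> \<and> distr gauss_noise borel (\<lambda>z. \<Sum>t\<in>I. c t * G z t) = normal_distribution m \<sigma>"
    using n(1) cdf_bounds by (blast intro: real_sqrt_ge_zero)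
qed

lemma mean_G: "(\<integral>z. G z x \<partial>gauss_noise) = 0"
proof -
  have "(\<integral>z. G z x \<partial>gauss_noise) = (\<integral>z. bridge (noise_coeff z) (cdf F x) \<partial>gauss_noise)"
    using AE_W by (intro integral_cong_AE measurable_G) (auto simp: G_def elim: eventually_mono)
  then show ?thesis using bridge_moments(1)[OF cdf_bounds[of x]] by simp
qed

lemma covariance_G: "covariance gauss_noise (\<lambda>z. G z x) (\<lambda>z. G z y) = cdf F (min x y) - cdf F x * cdf F y"
proof -
  have [measurable]: "(\<lambda>z. G z x) \<in> borel_measurable gauss_noise" for x by (rule measurable_G)
  have "covariance gauss_noise (\<lambda>z. G z x) (\<lambda>z. G z y) = (\<integral>z. G z x * G z y \<partial>gauss_noise)"
    by (simp add: covariance_def mean_G)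
  also have "\<dots> = (\<integral>z. bridge (noise_coeff z) (cdf F x) * bridge (noise_coeff z) (cdf F y) \<partial>gauss_noise)"
    using AE_W by (intro integral_cong_AE) (auto simp: G_def elim: eventually_mono)
  also have "\<dots> = min (cdf F x) (cdf F y) - cdf F x * cdf F y"
    by (intro bridge_covariance cdf_bounds)
  also have "min (cdf F x) (cdf F y) = cdf F (min x y)"
    using F.cdf_nondecreasing[of x y] F.cdf_nondecreasing[of y x] by (auto simp: min_def)
  finally show ?thesis .
qed

section \<open>Approximation and Borel measurability of the limit\<close>

definition GK :: "nat \<Rightarrow> (real \<Rightarrow> real) \<Rightarrow> real \<Rightarrow> real" where
  "GK m z x = (if x \<in> K m then G z x else 0)"

lemma measurable_GK [measurable]: "GK m z \<in> borel_measurable borel"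
  unfolding GK_def[abs_def] by measurable

lemma GK_in_L: "GK m z \<in> L_space borel \<mu>"
proof -
  obtain c where c: "\<And>x. \<bar>G z x\<bar> \<le> c" using G_bounded by blast
  have "0 \<le> c" using c[of 0] by linarith
  then show ?thesis by (intro L_norm_supported_in_K(1)[where m=m and c=c]) (auto simp: GK_def c)
qed

lemma W_uniform:
  assumes "e > 0"
  obtains d where "d > 0" "\<And>s t. \<lbrakk>0 \<le> s; s \<le> 1; 0 \<le> t; t \<le> 1; \<bar>s - t\<bar> < d\<rbrakk> \<Longrightarrow> \<bar>W z s - W z t\<bar> < e"
proof -
  have "uniformly_continuous_on {0..1} (W z)"
    by (intro compact_uniformly_continuous continuous_W) simp
  then obtain d where "d > 0" "\<And>s t. \<lbrakk>s \<in> {0..1}; t \<in> {0..1}; dist t s < d\<rbrakk> \<Longrightarrow> dist (W z t) (W z s) < e"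
    using assms unfolding uniformly_continuous_on_def by blast
  then show thesis by (intro that[of d]) (auto simp: dist_real_def abs_minus_commute)
qed

lemma eventually_pow_half: "d > 0 \<Longrightarrow> \<forall>\<^sub>F a in sequentially. 1 / 2^a < (d::real)"
  using order_tendstoD(2)[OF LIMSEQ_realpow_zero[of "1/2::real"], of d] by (simp add: power_one_over)

text \<open>Uniform continuity of \<open>W z\<close> on \<open>[0, 1]\<close> makes the error
  uniformly small on \<open>K m\<close>, since \<open>q a j\<close> is within \<open>1/2^a\<close>
  of \<open>cdf F x\<close>; finiteness of \<open>vK m\<close> carries this over to the integral
  norm.\<close>

lemma step_tendsto_GK:
  "(\<lambda>a. L_norm borel \<mu> (\<lambda>x. step m a (\<lambda>j. W z (q a j)) x - GK m z x)) \<longlonglongrightarrow> 0"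
proof (rule LIMSEQ_I)
  fix r :: real assume r: "r > 0"
  define e where "e = (r / 2) / (1 + vK m)"
  have v: "0 < 1 + vK m" using vK(2)[of m] by linarith
  then have e: "e > 0" using r by (simp add: e_def)
  obtain d where d: "d > 0" "\<And>s t. \<lbrakk>0 \<le> s; s \<le> 1; 0 \<le> t; t \<le> 1; \<bar>s - t\<bar> < d\<rbrakk> \<Longrightarrow> \<bar>W z s - W z t\<bar> < e"
    using W_uniform[OF e] by blast
  obtain a0 where a0: "\<And>a. a \<ge> a0 \<Longrightarrow> 1 / 2^a < d"
    using eventually_pow_half[OF d(1)] by (auto simp: eventually_sequentially)
  have "norm (L_norm borel \<mu> (\<lambda>x. step m a (\<lambda>j. W z (q a j)) x - GK m z x) - 0) < r" if a: "a \<ge> a0" for a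
  proof -
    have "L_norm borel \<mu> (\<lambda>x. step m a (\<lambda>j. W z (q a j)) x - GK m z x) \<le> (1 + vK m) * e"
    proof (rule L_norm_supported_in_K(2))
      fix x assume x: "x \<in> K m"
      have "\<bar>q a (dyadic_index a x) - cdf F x\<bar> < d"
        using prob_dyadic_set_index(3)[where a=a and x=x] a0[OF a] by (simp add: abs_minus_commute)
      then have "\<bar>W z (q a (dyadic_index a x)) - W z (cdf F x)\<bar> < e"
        by (intro d(2)) (auto simp: cdf_bounds)
      then show "\<bar>step m a (\<lambda>j. W z (q a j)) x - GK m z x\<bar> \<le> e"
        using x by (simp add: step_def GK_def G_def)
    qed (use e in \<open>auto simp: step_def GK_def\<close>)
    also have "(1 + vK m) * e = r / 2"
    proof -
      have cancel: "w * (c / w) = c" if "w \<noteq> 0" for w c :: real using that by simp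
      show ?thesis unfolding e_def by (rule cancel) (use v in simp)
    qed
    finally show ?thesis using r L_norm_nonneg[of \<mu>] by simp
  qed
  then show "\<exists>a0. \<forall>a\<ge>a0. norm (L_norm borel \<mu> (\<lambda>x. step m a (\<lambda>j. W z (q a j)) x - GK m z x) - 0) < r" by blast
qed

text \<open>Outside \<open>K m\<close> the value \<open>cdf F x\<close> is within
  \<open>1/2^m\<close> of 0 or 1, where the continuous path \<open>W z\<close> vanishes; the
  integral part is the tail of a convergent integral.\<close>

lemma GK_tendsto_G: "(\<lambda>m. L_norm borel \<mu> (\<lambda>x. GK m z x - G z x)) \<longlonglongrightarrow> 0"
proof (rule LIMSEQ_I)
  fix r :: real assume r: "r > 0"
  then have r3: "r / 3 > 0" by simp
  obtain d where d: "d > 0" "\<And>s t. \<lbrakk>0 \<le> s; s \<le> 1; 0 \<le> t; t \<le> 1; \<bar>s - t\<bar> < d\<rbrakk> \<Longrightarrow> \<bar>W z s - W z t\<bar> < r/3"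
    using W_uniform[OF r3] by blast
  have W01: "W z 0 = 0" "W z 1 = 0" by (auto simp: W_def)
  let ?I = "\<lambda>m. \<integral>\<^sup>+x. ennreal \<bar>G z x\<bar> * indicator (- K m) x \<partial>V"
  have "?I \<longlonglongrightarrow> 0"
    by (rule nn_integral_outside_K_tendsto_0[OF _ nn_integral_G_finite]) (auto simp: G_outside_J)
  from order_tendstoD(2)[OF this, of "ennreal (r/3)"] r
  have "\<forall>\<^sub>F m in sequentially. ?I m < ennreal (r/3)" by simp
  with eventually_pow_half[OF d(1)]
  have "\<forall>\<^sub>F m in sequentially. norm (L_norm borel \<mu> (\<lambda>x. GK m z x - G z x) - 0) < r"
  proof eventually_elim
    case (elim m)
    have "L_norm borel \<mu> (\<lambda>x. GK m z x - G z x) \<le> r/3 + r/3"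
    proof (rule L_space_norm_le(2))
      fix x
      show "\<bar>GK m z x - G z x\<bar> \<le> r/3"
      proof (cases "x \<in> K m")
        case False
        then have "\<bar>cdf F x - 0\<bar> < d \<or> \<bar>cdf F x - 1\<bar> < d"
          using elim(1) cdf_bounds[of x] by (auto simp: K_def)
        then have "\<bar>W z (cdf F x) - W z 0\<bar> < r/3 \<or> \<bar>W z (cdf F x) - W z 1\<bar> < r/3"
          using d(2)[of "cdf F x" 0] d(2)[of "cdf F x" 1] cdf_bounds[of x] by auto
        then show ?thesis using False by (auto simp: GK_def G_def W01)
      qed (use r in \<open>simp add: GK_def\<close>)
    next
      have "(\<integral>\<^sup>+x. ennreal \<bar>GK m z x - G z x\<bar> \<partial>V) = ?I m"
        by (intro nn_integral_cong) (auto simp: GK_def indicator_def)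
      with elim(2) show "(\<integral>\<^sup>+x. ennreal \<bar>GK m z x - G z x\<bar> \<partial>V) \<le> ennreal (r/3)" by simp
    qed (use r in auto)
    then show ?case using r L_norm_nonneg[of \<mu>] by simp
  qed
  then show "\<exists>m0. \<forall>m\<ge>m0. norm (L_norm borel \<mu> (\<lambda>x. GK m z x - G z x) - 0) < r"
    by (simp add: eventually_sequentially)
qed

lemma Lipschitz_tendsto:
  assumes h: "\<And>x y. \<lbrakk>x \<in> L_space borel \<mu>; y \<in> L_space borel \<mu>\<rbrakk>
      \<Longrightarrow> \<bar>h x - h y\<bar> \<le> L * L_norm borel \<mu> (\<lambda>t. x t - y t)"
    and x: "\<And>n. x n \<in> L_space borel \<mu>" and y: "y \<in> L_space borel \<mu>"
    and lim: "(\<lambda>n. L_norm borel \<mu> (\<lambda>t. x n t - y t)) \<longlonglongrightarrow> 0"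
  shows "(\<lambda>n. h (x n)) \<longlonglongrightarrow> h y"
proof (rule LIM_zero_cancel, rule Lim_null_comparison)
  show "\<forall>\<^sub>F n in sequentially. norm (h (x n) - h y) \<le> L * L_norm borel \<mu> (\<lambda>t. x n t - y t)"
    using h[OF x y] by (intro always_eventually) simp
  show "(\<lambda>n. L * L_norm borel \<mu> (\<lambda>t. x n t - y t)) \<longlonglongrightarrow> 0"
    using tendsto_mult_left[OF lim, of L] by simp
qed

lemma measurable_Lipschitz_step:
  assumes L: "0 \<le> L" and h: "\<And>x y. \<lbrakk>x \<in> L_space borel \<mu>; y \<in> L_space borel \<mu>\<rbrakk>
      \<Longrightarrow> \<bar>h x - h y\<bar> \<le> L * L_norm borel \<mu> (\<lambda>t. x t - y t)"
    and v: "\<And>j. (\<lambda>\<omega>. v \<omega> j) \<in> borel_measurable Q"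
  shows "(\<lambda>\<omega>. h (step m a (v \<omega>))) \<in> borel_measurable Q"
proof (rule measurable_trunc_Lipschitz[where V=v])
  show "0 \<le> L * (1 + vK m)" using L vK(2)[of m] by simp
  show "\<bar>h (step m a v) - h (step m a w)\<bar> \<le> (L * (1 + vK m)) * (\<Sum>j<2^a + 1. \<bar>v j - w j\<bar>)" for v w
    by (rule step_function_Lipschitz[OF L h])
qed (rule v)

text \<open>Step functions depend on finitely many values of \<open>W\<close>, so \<open>h\<close>
  of them is measurable; \<open>h (GK m z)\<close> and then \<open>h (G z)\<close> are pointwise
  limits. Borel measurability of \<open>G\<close> is deduced from this, not the other way
  round.\<close>

lemma measurable_Lipschitz_G:
  assumes L: "0 \<le> L" and h: "\<And>x y. \<lbrakk>x \<in> L_space borel \<mu>; y \<in> L_space borel \<mu>\<rbrakk>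
      \<Longrightarrow> \<bar>h x - h y\<bar> \<le> L * L_norm borel \<mu> (\<lambda>t. x t - y t)"
  shows "(\<lambda>z. h (GK m z)) \<in> borel_measurable gauss_noise" "(\<lambda>z. h (G z)) \<in> borel_measurable gauss_noise"
proof -
  show 1: "(\<lambda>z. h (GK m z)) \<in> borel_measurable gauss_noise" for m
  proof (rule borel_measurable_LIMSEQ_real)
    show "(\<lambda>a. h (step m a (\<lambda>j. W z (q a j)))) \<longlonglongrightarrow> h (GK m z)" for z
      by (rule Lipschitz_tendsto[OF h step_in_L GK_in_L step_tendsto_GK])
    show "(\<lambda>z. h (step m a (\<lambda>j. W z (q a j)))) \<in> borel_measurable gauss_noise" for a
      by (rule measurable_Lipschitz_step[OF L h]) measurable
  qed
  show "(\<lambda>z. h (G z)) \<in> borel_measurable gauss_noise"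
  proof (rule borel_measurable_LIMSEQ_real)
    show "(\<lambda>m. h (GK m z)) \<longlonglongrightarrow> h (G z)" for z
      by (rule Lipschitz_tendsto[OF h GK_in_L G_in_L GK_tendsto_G])
  qed (rule 1)
qed

text \<open>Without separability, measurability with respect to balls or coordinates need not yield
  Borel measurability. An open \<open>U\<close> is instead the set where the distance
  \<open>u\<close> to its complement is positive, and \<open>u\<close> is Lipschitz with constant
  1.\<close>

lemma G_Borel: "G \<in> gauss_noise \<rightarrow>\<^sub>M sigma (L_space borel \<mu>) {U. openin L.mtopology U}"
proof (rule measurable_measure_of)
  show "{U. openin L.mtopology U} \<subseteq> Pow (L_space borel \<mu>)"
    using openin_subset[where U=L.mtopology] by auto
  show "G \<in> space gauss_noise \<rightarrow> L_space borel \<mu>" by (auto intro: G_in_L)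
  fix U assume "U \<in> {U. openin L.mtopology U}"
  then have U: "openin L.mtopology U" by simp
  show "G -` U \<inter> space gauss_noise \<in> sets gauss_noise"
  \<comment> \<open>The infimum that defines the distance requires a nonempty complement.\<close>
  proof (cases "L_space borel \<mu> - U = {}")
    case True
    then have "G -` U \<inter> space gauss_noise = space gauss_noise" using G_in_L by auto
    then show ?thesis by simp
  next
    case ne: False
    let ?C = "L_space borel \<mu> - U"
    define u where "u x = (INF y\<in>?C. L_norm borel \<mu> (\<lambda>t. x t - y t))" for x
    have bdd: "bdd_below ((\<lambda>y. L_norm borel \<mu> (\<lambda>t. x t - y t)) ` ?C)" for x
      by (rule bdd_belowI2[where m=0]) (rule L_norm_nonneg)
    have half: "u x \<le> u y + L_norm borel \<mu> (\<lambda>t. x t - y t)" if "x \<in> L_space borel \<mu>" "y \<in> L_space borel \<mu>" for x y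
    proof -
      have "u x - L_norm borel \<mu> (\<lambda>t. x t - y t) \<le> u y"
        unfolding u_def[of y]
      proof (rule cINF_greatest[OF ne])
        fix w assume w: "w \<in> ?C"
        have "u x \<le> L_norm borel \<mu> (\<lambda>t. x t - w t)" unfolding u_def by (rule cINF_lower[OF bdd w])
        also have "\<dots> \<le> L_norm borel \<mu> (\<lambda>t. x t - y t) + L_norm borel \<mu> (\<lambda>t. y t - w t)"
          by (rule L.triangle) (use that w in auto)
        finally show "u x - L_norm borel \<mu> (\<lambda>t. x t - y t) \<le> L_norm borel \<mu> (\<lambda>t. y t - w t)" by simp
      qed
      then show ?thesis by simp
    qed
    have lip: "\<bar>u x - u y\<bar> \<le> 1 * L_norm borel \<mu> (\<lambda>t. x t - y t)" if "x \<in> L_space borel \<mu>" "y \<in> L_space borel \<mu>" for x y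
      using half[OF that] half[OF that(2,1)] L.commute[of x y] by simp
    have pos: "0 < u x \<longleftrightarrow> x \<in> U" if x: "x \<in> L_space borel \<mu>" for x
    proof
      assume "0 < u x"
      show "x \<in> U"
      proof (rule ccontr)
        assume "x \<notin> U"
        then have "u x \<le> L_norm borel \<mu> (\<lambda>t. x t - x t)"
          unfolding u_def using x by (intro cINF_lower[OF bdd]) auto
        also have "\<dots> = 0" by (simp add: L_norm_def)
        finally show False using \<open>0 < u x\<close> by simp
      qed
    next
      assume "x \<in> U"
      then obtain r where r: "r > 0" "L.mball x r \<subseteq> U" using U unfolding L.openin_mtopology by auto
      have "r \<le> u x" unfolding u_def
      proof (rule cINF_greatest[OF ne])
        fix y assume y: "y \<in> ?C"
        then have "y \<notin> L.mball x r" using r(2) by auto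
        then show "r \<le> L_norm borel \<mu> (\<lambda>t. x t - y t)" using x y by (auto simp: not_less)
      qed
      with r(1) show "0 < u x" by simp
    qed
    have [measurable]: "(\<lambda>z. u (G z)) \<in> borel_measurable gauss_noise"
      by (rule measurable_Lipschitz_G(2)[OF _ lip]) auto
    have "G -` U \<inter> space gauss_noise = {z\<in>space gauss_noise. 0 < u (G z)}"
      using pos[OF G_in_L] by auto
    also have "\<dots> \<in> sets gauss_noise" by measurable
    finally show ?thesis .
  qed
qed

section \<open>Paths of the empirical process off the central region\<close>

lemma AE_emp_outside_J: "AE \<omega> in M. \<forall>n x. x \<notin> J \<longrightarrow> emp n {..x} \<omega> = 0"
proof -
  \<comment> \<open>Almost surely no observation falls where \<open>cdf F\<close> is 0: this set has
    probability at most \<open>s\<close> for every positive \<open>s\<close>.\<close>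
  have "F.prob {y. cdf F y \<le> 0} \<le> s" if "0 < s" for s
    by (rule order_trans[OF F.finite_measure_mono F.prob_cdf_less_le[of s]]) (use that in auto)
  then have "F.prob {y. cdf F y \<le> 0} \<le> 0" by (rule field_le_epsilon) simp
  then have "F.prob {y. cdf F y \<le> 0} = 0" by (simp add: measure_le_0_iff)
  then have pos: "AE y in F. 0 < cdf F y"
    by (intro AE_I[where N="{y. cdf F y \<le> 0}"]) (auto simp: F.emeasure_eq_measure)
  \<comment> \<open>Almost surely no observation exceeds the point where \<open>cdf F\<close> first
    reaches 1; if it never does, the quantile set is the whole line.\<close>
  have "F.prob (quantile_set F 1) = 1"
    using F.prob_quantile_set_ge[of 1] F.prob_le_1[of "quantile_set F 1"] by simp
  then have one: "AE y in F. y \<in> quantile_set F 1"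
    by (subst F.AE_in_set_eq_1) auto
  have "AE y in F. 0 < cdf F y \<and> y \<in> quantile_set F 1" using pos one by eventually_elim simp
  then have "AE \<omega> in M. 0 < cdf F (X i \<omega>) \<and> X i \<omega> \<in> quantile_set F 1" for i
    unfolding distr_X[of i, symmetric] by (subst (asm) AE_distr_iff) (auto simp: distr_X)
  then have "AE \<omega> in M. \<forall>i. 0 < cdf F (X i \<omega>) \<and> X i \<omega> \<in> quantile_set F 1"
    by (simp add: AE_all_countable)
  then show ?thesis
  proof eventually_elim
    \<comment> \<open>The null set is now fixed, the same for all \<open>n\<close> and
      \<open>x\<close>. Where \<open>cdf F x\<close> is 0 or 1, the number of observations up to
      \<open>x\<close> is 0 or \<open>n\<close>, which is exactly the centring.\<close>
    case (elim \<omega>)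
    show ?case
    proof (intro allI impI)
      fix n x assume "x \<notin> J"
      then consider "cdf F x = 0" | "cdf F x = 1" using cdf_bounds[of x] by (auto simp: J_def)
      then show "emp n {..x} \<omega> = 0"
      proof cases
        case 1
        have "\<not> X i \<omega> \<le> x" for i
          using F.cdf_nondecreasing[of "X i \<omega>" x] elim 1 by (auto simp: not_le[symmetric])
        then show ?thesis using 1 by (simp add: emp_def cdf_def)
      next
        case 2
        have "X i \<omega> \<le> x" for i using elim 2 by (auto simp: quantile_set_def)
        then show ?thesis using 2 by (simp add: emp_def cdf_def)
      qed
    qed
  qed
qed

text \<open>With the indicator written as a comparison of \<open>X i \<omega>\<close> and
  \<open>x\<close>, measurability in \<open>x\<close> and jointly in both variables becomes
  automatic.\<close>

lemma emp_atMost: "emp n {..x} \<omega> = (\<Sum>i<n. (if X i \<omega> \<le> x then 1 else 0) - cdf F x) / sqrt (real n)"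
  by (simp add: emp_def cdf_def indicator_def of_bool_def)

lemma measurable_emp_path [measurable]: "(\<lambda>x. emp n {..x} \<omega>) \<in> borel_measurable borel"
  unfolding emp_atMost by measurable

lemma measurable_emp_pair [measurable]:
  "(\<lambda>p. emp n {..snd p} (fst p)) \<in> borel_measurable (M \<Otimes>\<^sub>M VJ)"
  unfolding emp_atMost by measurable

text \<open>Taken against \<open>VJ\<close> rather than \<open>V\<close> so that it is measurable in
  \<open>\<omega>\<close>; almost surely both integrals agree, because the process vanishes off
  \<open>J\<close>.\<close>

definition outside :: "nat \<Rightarrow> nat \<Rightarrow> 'w \<Rightarrow> ennreal" where
  "outside n m \<omega> = (\<integral>\<^sup>+x. ennreal \<bar>emp n {..x} \<omega>\<bar> * indicator (- K m) x \<partial>VJ)"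

lemma measurable_outside [measurable]: "outside n m \<in> borel_measurable M"
  unfolding outside_def[abs_def]
  using VJ.borel_measurable_nn_integral_fst[of "\<lambda>p. ennreal \<bar>emp n {..snd p} (fst p)\<bar> * indicator (- K m) (snd p)" M]
  by simp

lemma nn_integral_outside_le:
  assumes n: "n > 0"
  shows "(\<integral>\<^sup>+\<omega>. outside n m \<omega> \<partial>M) \<le> ennreal (tail m)"
proof -
  interpret pair_sigma_finite M VJ by unfold_locales
  have "(\<integral>\<^sup>+\<omega>. outside n m \<omega> \<partial>M) = (\<integral>\<^sup>+x. \<integral>\<^sup>+\<omega>. ennreal \<bar>emp n {..x} \<omega>\<bar> * indicator (- K m) x \<partial>M \<partial>VJ)"
    unfolding outside_def
    using Fubini[of "\<lambda>p. ennreal \<bar>emp n {..snd p} (fst p)\<bar> * indicator (- K m) (snd p)"] by simp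
  also have "\<dots> \<le> (\<integral>\<^sup>+x. ennreal (weight x) * indicator (- K m) x \<partial>VJ)"
  proof (rule nn_integral_mono)
    fix x :: real
    have C: "{..x} \<in> sets borel" by simp
    have "(\<integral>\<^sup>+\<omega>. ennreal \<bar>emp n {..x} \<omega>\<bar> \<partial>M) = ennreal (\<integral>\<omega>. \<bar>emp n {..x} \<omega>\<bar> \<partial>M)"
      using emp_abs_moment(2)[OF C n] by (intro nn_integral_eq_integral) auto
    also have "\<dots> \<le> ennreal (weight x)"
      using emp_abs_moment(1)[OF C n] by (intro ennreal_leI) (simp add: cdf_def)
    finally show "(\<integral>\<^sup>+\<omega>. ennreal \<bar>emp n {..x} \<omega>\<bar> * indicator (- K m) x \<partial>M) \<le> ennreal (weight x) * indicator (- K m) x"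
      by (subst nn_integral_multc) (auto intro!: mult_right_mono)
  qed
  also have "\<dots> = ennreal (tail m)"
    unfolding tail(1)[symmetric] by (rule nn_integral_VJ) (auto simp: weight_outside_J)
  finally show ?thesis .
qed

lemma outside_integral:
  assumes n: "n > 0"
  shows "AE \<omega> in M. outside n m \<omega> = ennreal (enn2real (outside n m \<omega>))"
    "integrable M (\<lambda>\<omega>. enn2real (outside n m \<omega>))" "(\<integral>\<omega>. enn2real (outside n m \<omega>) \<partial>M) \<le> tail m"
proof -
  have "(\<integral>\<^sup>+\<omega>. outside n m \<omega> \<partial>M) \<noteq> \<infinity>"
    using nn_integral_outside_le[OF n, of m] by (auto simp: top_unique)
  then have "AE \<omega> in M. outside n m \<omega> \<noteq> \<infinity>" by (intro nn_integral_PInf_AE) auto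
  then show ae: "AE \<omega> in M. outside n m \<omega> = ennreal (enn2real (outside n m \<omega>))"
    by eventually_elim (simp add: less_top)
  have eq: "(\<integral>\<^sup>+\<omega>. ennreal (enn2real (outside n m \<omega>)) \<partial>M) = (\<integral>\<^sup>+\<omega>. outside n m \<omega> \<partial>M)"
    using ae by (intro nn_integral_cong_AE) (auto elim!: eventually_mono)
  show int: "integrable M (\<lambda>\<omega>. enn2real (outside n m \<omega>))"
    using nn_integral_outside_le[OF n, of m] unfolding eq[symmetric]
    by (intro integrableI_nonneg) (auto intro: le_less_trans)
  have "ennreal (\<integral>\<omega>. enn2real (outside n m \<omega>) \<partial>M) \<le> ennreal (tail m)"
    using nn_integral_outside_le[OF n, of m] unfolding eq[symmetric]
    by (subst (asm) nn_integral_eq_integral[OF int]) auto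
  then show "(\<integral>\<omega>. enn2real (outside n m \<omega>) \<partial>M) \<le> tail m"
    using tail(2)[of m] by (simp add: ennreal_le_iff)
qed

lemma nn_integral_VJ_outside:
  assumes "\<And>x. x \<notin> J \<Longrightarrow> emp n {..x} \<omega> = 0"
  shows "(\<integral>\<^sup>+x. ennreal \<bar>emp n {..x} \<omega>\<bar> * indicator (- K m) x \<partial>V) = outside n m \<omega>"
  unfolding outside_def using assms by (intro nn_integral_VJ[symmetric]) auto

lemma K_0: "K 0 = {}"
  unfolding K_def by auto

text \<open>Off \<open>J\<close> nothing controls the variation measure, so integrability rests on
  the process vanishing there, which is only known almost surely. The remaining integral is
  \<open>outside n 0\<close>, as \<open>K 0\<close> is empty.\<close>

lemma empirical_process_in_L: "AE \<omega> in M. empirical_process F X n \<omega> \<in> L_space borel \<mu>"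
proof (cases "n = 0")
  case True
  have "(\<lambda>x. 0) \<in> L_space borel \<mu>" by (rule L_space_norm_le(1)[where c=0 and e=0]) auto
  then show ?thesis using True by (simp add: empirical_process_def)
next
  case False
  then have n: "n > 0" by simp
  have eq: "empirical_process F X n \<omega> = (\<lambda>x. emp n {..x} \<omega>)" for \<omega>
    by (rule ext) (rule empirical_process_eq_emp)
  have b: "\<bar>emp n {..x} \<omega>\<bar> \<le> real n / sqrt (real n)" for x \<omega>
  proof -
    have "\<bar>\<Sum>i<n. indicator {..x} (X i \<omega>) - F.prob {..x}\<bar> \<le> (\<Sum>i<n. 1)"
      by (rule order_trans[OF sum_abs]) (intro sum_mono centred_indicator(3), simp)
    then show ?thesis unfolding emp_def by (simp add: divide_right_mono)
  qed
  show ?thesis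
    using AE_emp_outside_J outside_integral(1)[OF n, of 0]
  proof eventually_elim
    case (elim \<omega>)
    have "(\<integral>\<^sup>+x. ennreal \<bar>emp n {..x} \<omega>\<bar> \<partial>V) = outside n 0 \<omega>"
      using nn_integral_VJ_outside[of n \<omega> 0] elim(1) by (simp add: K_0)
    then show ?case
      unfolding eq using elim(2)
      by (intro L_space_norm_le(1)[OF measurable_emp_path b, where e="enn2real (outside n 0 \<omega>)"]) auto
  qed
qed

text \<open>On \<open>K m\<close> the error is an oscillation at level \<open>a\<close>, counted
  once for the supremum and \<open>vK m\<close> times for the integral. Outside, the process itself
  has to be small: up to an oscillation at level \<open>m\<close> it is \<open>emp\<close> of the
  dyadic set with index 0, \<open>j0\<close> or \<open>2^m\<close>. The first set is empty, the
  others have probability at least \<open>1 - 1/2^m\<close> and hence a standard deviation of at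
  most \<open>sqrt (1/2^m)\<close>.\<close>

lemma step_approximation:
  assumes a: "2^a \<le> n" and m: "2^m \<le> n"
  obtains S where "integrable M S"
    "(\<integral>\<omega>. S \<omega> \<partial>M) \<le> (1 + vK m) * (90 * (9/10)^a + 2 / sqrt (real n))
      + (90 * (9/10)^m + 2 / sqrt (real n) + 2 * sqrt (1/2^m) + tail m)"
    "AE \<omega> in M. L_norm borel \<mu> (\<lambda>x. empirical_process F X n \<omega> x - step m a (\<lambda>j. emp n (dyadic_set a j) \<omega>) x) \<le> S \<omega>"
proof -
  have n: "n > 0" using a by (meson less_le_trans zero_less_numeral zero_less_power)
  obtain R where R: "integrable M R" "(\<integral>\<omega>. R \<omega> \<partial>M) \<le> 90 * (9/10)^a + 2 / sqrt (real n)"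
    "\<And>\<omega> x. \<bar>emp n {..x} \<omega> - emp n (dyadic_set a (dyadic_index a x)) \<omega>\<bar> \<le> R \<omega>"
    using emp_oscillation[OF a] by blast
  obtain R' where R': "integrable M R'" "(\<integral>\<omega>. R' \<omega> \<partial>M) \<le> 90 * (9/10)^m + 2 / sqrt (real n)"
    "\<And>\<omega> x. \<bar>emp n {..x} \<omega> - emp n (dyadic_set m (dyadic_index m x)) \<omega>\<bar> \<le> R' \<omega>"
    using emp_oscillation[OF m] by blast
  define E where "E j \<omega> = \<bar>emp n (dyadic_set m j) \<omega>\<bar>" for j \<omega>
  \<comment> \<open>If \<open>cdf F x\<close> is at least \<open>1 - 1/2^m\<close>, the index of
    \<open>x\<close> is this one or \<open>2^m\<close>.\<close>
  define j0 where "j0 = (2::nat)^m - 1"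
  have j0: "real j0 = 2^m - 1" by (simp add: j0_def of_nat_diff)
  have Eint: "integrable M (E j)" for j
    unfolding E_def by (rule emp_abs_moment(2)[OF sets_dyadic(1) n])
  have Ele: "(\<integral>\<omega>. E j \<omega> \<partial>M) \<le> sqrt (1/2^m)" if "1 - 1/2^m \<le> q m j" for j
  proof -
    have "(\<integral>\<omega>. E j \<omega> \<partial>M) \<le> sqrt (q m j * (1 - q m j))"
      unfolding E_def by (rule emp_abs_moment(1)[OF sets_dyadic(1) n])
    also have "\<dots> \<le> sqrt (1 * (1/2^m))"
      using that F.prob_le_1[of "dyadic_set m j"] by (intro real_sqrt_le_mono mult_mono) auto
    finally show ?thesis by simp
  qed
  have q1: "1 - 1/2^m \<le> q m j0"
  proof -
    have "1 - 1/2^m = real j0 / 2^m" by (simp add: j0 field_simps)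
    moreover have "real j0 / 2^m \<le> 1" by (simp add: j0)
    ultimately show ?thesis unfolding dyadic_set_def by (simp only: F.prob_quantile_set_ge)
  qed
  have q2: "1 - 1/2^m \<le> q m (2^m)"
  proof -
    have "1 \<le> q m (2^m)" unfolding dyadic_set_def using F.prob_quantile_set_ge[of 1] by simp
    moreover have "(0::real) \<le> 1/2^m" by simp
    ultimately show ?thesis by linarith
  qed
  define S where "S \<omega> = (1 + vK m) * R \<omega> + (R' \<omega> + E j0 \<omega> + E (2^m) \<omega> + enn2real (outside n m \<omega>))" for \<omega>
  show thesis
  proof (rule that[of S])
    note ints = R(1) R'(1) Eint outside_integral(2)[OF n]
    show "integrable M S"
      unfolding S_def using ints by (intro Bochner_Integration.integrable_add integrable_mult_right) auto
    have "(\<integral>\<omega>. S \<omega> \<partial>M) = (1 + vK m) * (\<integral>\<omega>. R \<omega> \<partial>M) + ((\<integral>\<omega>. R' \<omega> \<partial>M) + (\<integral>\<omega>. E j0 \<omega> \<partial>M)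
        + (\<integral>\<omega>. E (2^m) \<omega> \<partial>M) + (\<integral>\<omega>. enn2real (outside n m \<omega>) \<partial>M))"
      unfolding S_def using ints by simp
    also have "\<dots> \<le> (1 + vK m) * (90 * (9/10)^a + 2 / sqrt (real n))
        + ((90 * (9/10)^m + 2 / sqrt (real n)) + sqrt (1/2^m) + sqrt (1/2^m) + tail m)"
      using vK(2)[of m] by (intro add_mono mult_left_mono R(2) R'(2) Ele q1 q2 outside_integral(3)[OF n]) auto
    finally show "(\<integral>\<omega>. S \<omega> \<partial>M) \<le> (1 + vK m) * (90 * (9/10)^a + 2 / sqrt (real n))
      + (90 * (9/10)^m + 2 / sqrt (real n) + 2 * sqrt (1/2^m) + tail m)" by simp
    show "AE \<omega> in M. L_norm borel \<mu> (\<lambda>x. empirical_process F X n \<omega> x - step m a (\<lambda>j. emp n (dyadic_set a j) \<omega>) x) \<le> S \<omega>"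
      using AE_emp_outside_J outside_integral(1)[OF n, of m]
    proof eventually_elim
      case (elim \<omega>)
      let ?D = "\<lambda>x. emp n {..x} \<omega> - step m a (\<lambda>j. emp n (dyadic_set a j) \<omega>) x"
      have R0: "0 \<le> R \<omega>" "0 \<le> R' \<omega>" using R(3)[of 0 \<omega>] R'(3)[of 0 \<omega>] by linarith+
      have inK: "\<bar>?D x\<bar> \<le> R \<omega>" if "x \<in> K m" for x using R(3)[of x \<omega>] that by (simp add: step_def)
      have outK: "\<bar>?D x\<bar> \<le> R' \<omega> + E j0 \<omega> + E (2^m) \<omega>" if "x \<notin> K m" for x
      proof -
        let ?j = "dyadic_index m x"
        have "?j = 0 \<or> ?j = j0 \<or> ?j = 2^m"
        proof (cases "cdf F x < 1/2^m")
          case True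
          then have "2^m * cdf F x < 1" by (simp add: field_simps)
          moreover have "0 \<le> 2^m * cdf F x" by (simp add: cdf_bounds)
          ultimately have "\<lfloor>2^m * cdf F x\<rfloor> = 0" by linarith
          then show ?thesis by (simp add: dyadic_index_def)
        next
          case False
          then have "1 - 1/2^m \<le> cdf F x" using that by (auto simp: K_def)
          then have "1 - 1/2^m < real (?j + 1) / 2^m" using dyadic_index(2)[where b=m and x=x] by linarith
          moreover have "1 - 1/2^m = (2^m - 1) / (2::real)^m" by (simp add: diff_divide_distrib)
          ultimately have "(2^m - 1) / (2::real)^m < real (?j + 1) / 2^m" by simp
          then have "(2::real)^m < real ?j + 2" by (simp only: divide_less_cancel) simp
          then have "real (2^m) < real (?j + 2)" by simp
          then have "2^m < ?j + 2" by (simp only: of_nat_less_iff)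
          then show ?thesis using dyadic_index(3)[of m x] unfolding j0_def by linarith
        qed
        then have "\<bar>emp n (dyadic_set m ?j) \<omega>\<bar> \<le> E j0 \<omega> + E (2^m) \<omega>"
          by (auto simp: E_def dyadic_set_def F.quantile_set_0)
        then show ?thesis using R'(3)[of x \<omega>] that by (simp add: step_def abs_le_iff)
      qed
      have "L_norm borel \<mu> ?D \<le> (R \<omega> + (R' \<omega> + E j0 \<omega> + E (2^m) \<omega>)) + (vK m * R \<omega> + enn2real (outside n m \<omega>))"
      proof (rule L_space_norm_le(2))
        show "?D \<in> borel_measurable borel" by measurable
        show "\<bar>?D x\<bar> \<le> R \<omega> + (R' \<omega> + E j0 \<omega> + E (2^m) \<omega>)" for x
          using inK[of x] outK[of x] R0 by (cases "x \<in> K m") (auto simp: E_def)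
        have "(\<integral>\<^sup>+x. ennreal \<bar>?D x\<bar> \<partial>V) = (\<integral>\<^sup>+x. ennreal \<bar>?D x\<bar> * indicator (K m) x
            + ennreal \<bar>emp n {..x} \<omega>\<bar> * indicator (- K m) x \<partial>V)"
          by (intro nn_integral_cong) (auto simp: indicator_def step_def)
        also have "\<dots> = (\<integral>\<^sup>+x. ennreal \<bar>?D x\<bar> * indicator (K m) x \<partial>V) + outside n m \<omega>"
          using nn_integral_VJ_outside[of n \<omega> m] elim(1)
          by (subst nn_integral_add) (auto simp: measurable_V)
        also have "\<dots> \<le> ennreal (vK m * R \<omega>) + ennreal (enn2real (outside n m \<omega>))"
          using elim(2) by (intro add_mono nn_integral_K_le inK R0) auto
        also have "\<dots> = ennreal (vK m * R \<omega> + enn2real (outside n m \<omega>))"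
          using vK(2)[of m] R0 by (simp add: ennreal_plus)
        finally show "(\<integral>\<^sup>+x. ennreal \<bar>?D x\<bar> \<partial>V) \<le> ennreal (vK m * R \<omega> + enn2real (outside n m \<omega>))" .
        show "0 \<le> vK m * R \<omega> + enn2real (outside n m \<omega>)" using vK(2)[of m] R0 by simp
      qed
      then show ?case unfolding empirical_process_eq_emp S_def by (simp add: algebra_simps)
    qed
  qed
qed

section \<open>Combination of the error bounds\<close>

theorem empirical_process_converges:
  "converges_weakly_HJ (L_topology \<mu>) M (empirical_process F X) gauss_noise G"
  unfolding L_topology_def
proof (rule L.converges_weakly_HJ_if_Lipschitz[OF prob_space_gauss_noise empirical_process_in_L G_Borel])
  fix h :: "(real \<Rightarrow> real) \<Rightarrow> real" and L C :: real
  assume L: "0 \<le> L" and hC: "\<And>x. x \<in> L_space borel \<mu> \<Longrightarrow> \<bar>h x\<bar> \<le> C"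
    and h: "\<And>x y. \<lbrakk>x \<in> L_space borel \<mu>; y \<in> L_space borel \<mu>\<rbrakk>
      \<Longrightarrow> \<bar>h x - h y\<bar> \<le> L * L_norm borel \<mu> (\<lambda>t. x t - y t)"
  let ?EG = "\<integral>z. h (G z) \<partial>gauss_noise"
  let ?EK = "\<lambda>m. \<integral>z. h (GK m z) \<partial>gauss_noise"
  let ?EW = "\<lambda>m a. \<integral>z. h (step m a (\<lambda>j. W z (q a j))) \<partial>gauss_noise"
  let ?EY = "\<lambda>m a n. \<integral>\<omega>. h (step m a (\<lambda>j. emp n (dyadic_set a j) \<omega>)) \<partial>M"
  have limK: "?EK \<longlonglongrightarrow> ?EG"
  proof (rule integral_dominated_convergence[where w="\<lambda>_. C"])
    show "AE z in gauss_noise. (\<lambda>m. h (GK m z)) \<longlonglongrightarrow> h (G z)"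
      by (intro AE_I2 Lipschitz_tendsto[OF h GK_in_L G_in_L GK_tendsto_G])
  qed (auto intro!: measurable_Lipschitz_G[OF L h] AE_I2 simp: hC GK_in_L)
  have limW: "?EW m \<longlonglongrightarrow> ?EK m" for m
  proof (rule integral_dominated_convergence[where w="\<lambda>_. C"])
    show "AE z in gauss_noise. (\<lambda>a. h (step m a (\<lambda>j. W z (q a j)))) \<longlonglongrightarrow> h (GK m z)"
      by (intro AE_I2 Lipschitz_tendsto[OF h step_in_L GK_in_L step_tendsto_GK])
  qed (auto intro!: measurable_Lipschitz_G[OF L h] measurable_Lipschitz_step[OF L h] AE_I2 simp: hC step_in_L)
  have limY: "?EY m a \<longlonglongrightarrow> ?EW m a" for m a
  proof -
    have "?EY m a \<longlonglongrightarrow> (\<integral>z. h (step m a (\<lambda>j. bridge (noise_coeff z) (q a j))) \<partial>gauss_noise)"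
    proof (rule emp_Lipschitz_tendsto)
      show "0 \<le> L * (1 + vK m)" using L vK(2)[of m] by simp
      show "\<bar>h (step m a v) - h (step m a w)\<bar> \<le> (L * (1 + vK m)) * (\<Sum>j<2^a + 1. \<bar>v j - w j\<bar>)" for v w
        by (rule step_function_Lipschitz[OF L h])
      show "\<bar>h (step m a v)\<bar> \<le> C" for v by (rule hC[OF step_in_L])
    qed
    moreover have "?EW m a = (\<integral>z. h (step m a (\<lambda>j. bridge (noise_coeff z) (q a j))) \<partial>gauss_noise)"
      using AE_W by (intro integral_cong_AE measurable_Lipschitz_step[OF L h] measurable_W measurable_bridge)
        (auto elim!: eventually_mono)
    ultimately show ?thesis by simp
  qed
  show "(\<lambda>n. outer_expectation M (\<lambda>\<omega>. ereal (h (empirical_process F X n \<omega>)))) \<longlonglongrightarrow> ereal ?EG"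
  proof (rule tendsto_ereal_if_sandwich)
    \<comment> \<open>The budget is six times \<open>e/6\<close>: three for \<open>L\<close> times
      the expectation of \<open>S\<close>, three for the passage from \<open>?EY\<close> over
      \<open>?EW\<close> and \<open>?EK\<close> to \<open>?EG\<close>.\<close>
    fix e :: real assume e: "e > 0"
    then have e6: "e / 6 > 0" by simp
    have half: "(\<lambda>m. (1/2)^m :: real) \<longlonglongrightarrow> 0" and nine: "(\<lambda>m. (9/10)^m :: real) \<longlonglongrightarrow> 0"
      by (rule LIMSEQ_realpow_zero; simp)+
    have "(\<lambda>m. L * (90 * (9/10)^m + 2 * sqrt ((1/2)^m) + tail m)) \<longlonglongrightarrow> L * (90 * 0 + 2 * sqrt 0 + 0)"
      by (intro tendsto_intros half nine tail(3))
    then have "\<forall>\<^sub>F m in sequentially. L * (90 * (9/10)^m + 2 * sqrt ((1/2)^m) + tail m) < e/6"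
      using e6 by (intro order_tendstoD(2)) auto
    moreover have "\<forall>\<^sub>F m in sequentially. dist (?EK m) ?EG < e/6" using limK e6 by (rule tendstoD)
    ultimately have "\<forall>\<^sub>F m in sequentially. L * (90 * (9/10)^m + 2 * sqrt ((1/2)^m) + tail m) < e/6
        \<and> dist (?EK m) ?EG < e/6" by eventually_elim simp
    then obtain m where m: "L * (90 * (9/10)^m + 2 * sqrt ((1/2)^m) + tail m) < e/6" "dist (?EK m) ?EG < e/6"
      by (auto simp: eventually_sequentially)
    \<comment> \<open>From here on \<open>m\<close> is fixed, so \<open>vK m\<close> is a
      constant.\<close>
    have "(\<lambda>a. L * (1 + vK m) * (90 * (9/10)^a)) \<longlonglongrightarrow> L * (1 + vK m) * (90 * 0)"
      by (intro tendsto_intros nine)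
    then have "\<forall>\<^sub>F a in sequentially. L * (1 + vK m) * (90 * (9/10)^a) < e/6"
      using e6 by (intro order_tendstoD(2)) auto
    moreover have "\<forall>\<^sub>F a in sequentially. dist (?EW m a) (?EK m) < e/6" using limW e6 by (rule tendstoD)
    ultimately have "\<forall>\<^sub>F a in sequentially. L * (1 + vK m) * (90 * (9/10)^a) < e/6
        \<and> dist (?EW m a) (?EK m) < e/6" by eventually_elim simp
    then obtain a where a: "L * (1 + vK m) * (90 * (9/10)^a) < e/6" "dist (?EW m a) (?EK m) < e/6"
      by (auto simp: eventually_sequentially)
    \<comment> \<open>The term \<open>2 / sqrt n\<close> enters \<open>1 + vK m\<close> times from
      level \<open>a\<close> and once from level \<open>m\<close>.\<close>
    have "(\<lambda>n. L * ((2 + vK m) * (2 / sqrt (real n)))) \<longlonglongrightarrow> L * ((2 + vK m) * 0)"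
    proof (intro tendsto_intros)
      show "(\<lambda>n. 2 / sqrt (real n)) \<longlonglongrightarrow> 0"
        by (intro tendsto_divide_0[OF tendsto_const] filterlim_at_top_imp_at_infinity
            filterlim_compose[OF sqrt_at_top filterlim_real_sequentially])
    qed
    then have "\<forall>\<^sub>F n in sequentially. L * ((2 + vK m) * (2 / sqrt (real n))) < e/6"
      using e6 by (intro order_tendstoD(2)) auto
    moreover have "\<forall>\<^sub>F n in sequentially. dist (?EY m a n) (?EW m a) < e/6" using limY e6 by (rule tendstoD)
    moreover have "\<forall>\<^sub>F n in sequentially. 2^a \<le> n" "\<forall>\<^sub>F n in sequentially. 2^m \<le> n"
      by (rule eventually_ge_at_top)+
    ultimately show "\<forall>\<^sub>F n in sequentially.
        ereal (?EG - e) \<le> outer_expectation M (\<lambda>\<omega>. ereal (h (empirical_process F X n \<omega>))) \<and>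
        outer_expectation M (\<lambda>\<omega>. ereal (h (empirical_process F X n \<omega>))) \<le> ereal (?EG + e)"
    proof eventually_elim
      case (elim n)
      obtain S where S: "integrable M S"
        "(\<integral>\<omega>. S \<omega> \<partial>M) \<le> (1 + vK m) * (90 * (9/10)^a + 2 / sqrt (real n))
          + (90 * (9/10)^m + 2 / sqrt (real n) + 2 * sqrt (1/2^m) + tail m)"
        "AE \<omega> in M. L_norm borel \<mu> (\<lambda>x. empirical_process F X n \<omega> x - step m a (\<lambda>j. emp n (dyadic_set a j) \<omega>) x) \<le> S \<omega>"
        using step_approximation[OF elim(3,4)] by blast
      let ?T = "\<lambda>\<omega>. h (step m a (\<lambda>j. emp n (dyadic_set a j) \<omega>))"
      have T: "integrable M ?T"
        by (intro P.integrable_const_bound[where B=C] measurable_Lipschitz_step[OF L h] measurable_emp sets_dyadic)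
          (auto simp: hC step_in_L)
      have ae: "AE \<omega> in M. \<bar>h (empirical_process F X n \<omega>) - ?T \<omega>\<bar> \<le> L * S \<omega>"
        using S(3) empirical_process_in_L[of n]
      proof eventually_elim
        case (elim \<omega>)
        have "\<bar>h (empirical_process F X n \<omega>) - ?T \<omega>\<bar>
            \<le> L * L_norm borel \<mu> (\<lambda>x. empirical_process F X n \<omega> x - step m a (\<lambda>j. emp n (dyadic_set a j) \<omega>) x)"
          by (rule h[OF elim(2) step_in_L])
        also have "\<dots> \<le> L * S \<omega>" by (intro mult_left_mono elim(1) L)
        finally show ?case .
      qed
      have "L * (\<integral>\<omega>. S \<omega> \<partial>M) \<le> L * ((1 + vK m) * (90 * (9/10)^a + 2 / sqrt (real n))
          + (90 * (9/10)^m + 2 / sqrt (real n) + 2 * sqrt (1/2^m) + tail m))"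
        by (intro mult_left_mono S(2) L)
      also have "\<dots> = L * (1 + vK m) * (90 * (9/10)^a) + L * ((2 + vK m) * (2 / sqrt (real n)))
          + L * (90 * (9/10)^m + 2 * sqrt ((1/2)^m) + tail m)"
      proof -
        have "L * ((1 + v) * (A + r) + (B + r + 2 * s + t)) = L * (1 + v) * A + L * ((2 + v) * r) + L * (B + 2 * s + t)"
          for v A r B s t by (simp add: algebra_simps)
        then show ?thesis unfolding power_one_over .
      qed
      also have "\<dots> < e/2" using m(1) a(1) elim(1) by linarith
      finally have ES: "L * (\<integral>\<omega>. S \<omega> \<partial>M) < e/2" .
      have close: "\<bar>?EY m a n - ?EG\<bar> < e/2"
        using m(2) a(2) elim(2) unfolding dist_real_def by linarith
      \<comment> \<open>The outer expectation is caught between the expectations of two integrable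
        functions, and linearity is used only for these.\<close>
      have ae_lower: "AE \<omega> in M. ?T \<omega> - L * S \<omega> \<le> h (empirical_process F X n \<omega>)"
        using ae by eventually_elim linarith
      have ae_upper: "AE \<omega> in M. h (empirical_process F X n \<omega>) \<le> ?T \<omega> + L * S \<omega>"
        using ae by eventually_elim linarith
      have EL: "(\<integral>\<omega>. ?T \<omega> - L * S \<omega> \<partial>M) = ?EY m a n - L * (\<integral>\<omega>. S \<omega> \<partial>M)"
        and EU: "(\<integral>\<omega>. ?T \<omega> + L * S \<omega> \<partial>M) = ?EY m a n + L * (\<integral>\<omega>. S \<omega> \<partial>M)"
        using T S(1) by simp_all
      have "ereal (?EG - e) \<le> ereal (\<integral>\<omega>. ?T \<omega> - L * S \<omega> \<partial>M)"
        unfolding EL ereal_less_eq using ES close by linarith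
      also have "\<dots> \<le> outer_expectation M (\<lambda>\<omega>. ereal (h (empirical_process F X n \<omega>)))"
        using T S(1) ae_lower by (intro outer_expectation_lower) auto
      finally have low: "ereal (?EG - e) \<le> outer_expectation M (\<lambda>\<omega>. ereal (h (empirical_process F X n \<omega>)))" .
      have "outer_expectation M (\<lambda>\<omega>. ereal (h (empirical_process F X n \<omega>))) \<le> ereal (\<integral>\<omega>. ?T \<omega> + L * S \<omega> \<partial>M)"
        using T S(1) ae_upper by (intro outer_expectation_upper) auto
      also have "\<dots> \<le> ereal (?EG + e)"
        unfolding EU ereal_less_eq using ES close by linarith
      finally show ?case using low by simp
    qed
  qed
qed

end

theorem proposition3p1:
  fixes \<mu> :: "real set \<Rightarrow> ereal" and F :: "real measure"
    and M :: "'w measure" and X :: "nat \<Rightarrow> 'w \<Rightarrow> real"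
  assumes "sigma_finite_signed_measure borel \<mu>"
    and "real_distribution F"
    and "(\<integral>\<^sup>+x. ennreal (sqrt (cdf F x * (1 - cdf F x))) \<partial>total_variation borel \<mu>) < \<infinity>"
    and "prob_space M"
    and "prob_space.indep_vars M (\<lambda>_. borel) X UNIV"
    and "\<And>i. distr M borel (X i) = F"
  shows "\<exists>(N :: (real \<Rightarrow> real) measure) (G :: (real \<Rightarrow> real) \<Rightarrow> real \<Rightarrow> real).
    prob_space N \<and>
    gaussian_process N G \<and>
    (\<forall>x. (\<integral>\<omega>. G \<omega> x \<partial>N) = 0) \<and>
    (\<forall>x y. covariance N (\<lambda>\<omega>. G \<omega> x) (\<lambda>\<omega>. G \<omega> y) = cdf F (min x y) - cdf F x * cdf F y) \<and>
    converges_weakly_HJ (L_topology \<mu>) M (empirical_process F X) N G"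
proof -
  interpret S: L_sample F M X \<mu>
    using assms by (simp add: L_sample_def L_sample_axioms_def iid_sample_def iid_sample_axioms_def)
  show ?thesis
    using prob_space_gauss_noise S.gaussian_process_G S.mean_G S.covariance_G S.empirical_process_converges
    by blast
qed

end
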